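(* Let $V=\coprod_{n\in\mathbb{Z}}V_{(n)}$ be a vertex operator algebra over $\mathbb{C}$, let $\sigma$ be an automorphism of $V$ of order $N$ (a positive integer), let $\omega_N=\exp(2\pi\sqrt{-1}/N)$, let $G=\langle\sigma\rangle\subset\mathrm{Aut}(V)$, and let $\phi:G\to\mathbb{C}^\times$ be the injective group homomorphism with $\phi(\sigma^j)=\omega_N^j$ for $j=0,\dots,N-1$. Let $(W,Y_W)$ be a $(G,\phi)$-quasi $V$-module. For $u\in V$ set $$\bar{Y}_W(u,x)=Y_W(\Delta_N(x)u,x^{1/N})\in(\mathrm{End}\,W)[[x^{1/N},x^{-1/N}]],$$ where $$\Delta_N(x)=\exp\Big(\sum_{n\ge1}a_nx^{-n/N}L(n)\Big)N^{-L(0)}x^{(1/N-1)L(0)}$$ and the complex numbers $a_n$ ($n\ge1$) are defined by $$\exp\Big(-\sum_{n\ge 1}a_nx^{n+1}\frac{d}{dx}\Big)\cdot x=\frac1N(1+x)^N-\frac1N.$$ Then $(W,\bar{Y}_W)$ carries the structure of a weak $\sigma$-twisted $V$-module.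
   Context: Conventions. $V$ has vertex operator map $Y(\cdot,x)$, vacuum vector $\mathbf{1}$, and Virasoro operators $L(n)$, $n\in\mathbb{Z}$, where $L(0)$ acts on $V_{(n)}$ as the scalar $n$. Automorphisms of $V$ preserve $Y$, $\mathbf 1$ and the conformal vector. $\delta(x)=\sum_{n\in\mathbb{Z}}x^n$. For $\alpha\in\mathbb{R}$, $(x_1\pm x_2)^\alpha$ is always expanded in nonnegative integral powers of the second variable: $(x_1\pm x_2)^\alpha=\sum_{i\ge0}\binom{\alpha}{i}(\pm1)^ix_1^{\alpha-i}x_2^i$. For a nonzero scalar $c$, the operator $c^{L(0)}$ acts on $V_{(n)}$ as multiplication by $c^n$; likewise $N^{-L(0)}$ and $x^{(1/N-1)L(0)}$ act on $V_{(n)}$ as $N^{-n}$ and $x^{(1/N-1)n}$. One has $\Delta_N(x)u\in V[x^{1/N},x^{-1/N}]$ for $u\in V$. Quasi $V$-module: a vector space $W$ with a linear map $Y_W:V\to\mathrm{Hom}(W,W((x)))\subset(\mathrm{End}\,W)[[x,x^{-1}]]$, $v\mapsto Y_W(v,x)$, such that $Y_W(\mathbf{1},x)=1_W$ and for any $u,v\in V$ there exists a nonzero polynomial $p(x_1,x_2)$ such that the quasi Jacobi identity holds: $$x_0^{-1}\delta\Big(\frac{x_1-x_2}{x_0}\Big)p(x_1,x_2)Y_W(u,x_1)Y_W(v,x_2)-x_0^{-1}\delta\Big(\frac{x_2-x_1}{-x_0}\Big)p(x_1,x_2)Y_W(v,x_2)Y_W(u,x_1)$$ $$=x_2^{-1}\delta\Big(\frac{x_1-x_0}{x_2}\Big)p(x_1,x_2)Y_W(Y(u,x_0)v,x_2).$$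 $(G,\phi)$-quasi $V$-module: a quasi $V$-module $(W,Y_W)$ such that for any $u,v\in V$ there is a nonnegative integer $k$ for which the quasi Jacobi identity holds with $p(x_1,x_2)=(x_1^N-x_2^N)^k$, and such that $$Y_W(\phi(g)^{-L(0)}g(u),x)=Y_W(u,\phi(g)x)\quad\text{for all }g\in G,\ u\in V.$$ In the expression $Y_W(\Delta_N(x)u,x^{1/N})$, the map $Y_W(\cdot,z)$ is extended linearly over $\mathbb{C}[x^{1/N},x^{-1/N}]$ to $V[x^{1/N},x^{-1/N}]$, and then $z$ is replaced by $x^{1/N}$. Weak $\sigma$-twisted $V$-module: a vector space $W$ with a linear map $Y_W:V\to\mathrm{Hom}(W,W((x^{1/N})))\subset(\mathrm{End}\,W)[[x^{1/N},x^{-1/N}]]$, $v\mapsto Y_W(v,x)$, such that $Y_W(\mathbf{1},x)=1_W$ and for all $u,v\in V$ the twisted Jacobi identity holds: $$x_0^{-1}\delta\Big(\frac{x_1-x_2}{x_0}\Big)Y_W(u,x_1)Y_W(v,x_2)-x_0^{-1}\delta\Big(\frac{x_2-x_1}{-x_0}\Big)Y_W(v,x_2)Y_W(u,x_1)$$ $$=\frac1N\sum_{r=0}^{N-1}x_1^{-1}\delta\Big(\omega_N^r\Big(\frac{x_2+x_0}{x_1}\Big)^{1/N}\Big)Y_W(Y(\sigma^ru,x_0)v,x_2).$$ *)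

theory Defs
  imports
    "HOL-Analysis.Product_Vector"
    "HOL-Library.Groups_Big_Fun"
    "HOL-Algebra.Multiplicative_Group"
    "HOL-Algebra.Generated_Groups"
    "HOL-Computational_Algebra.Polynomial"
    "HOL-Computational_Algebra.Formal_Power_Series"
begin

section \<open>Formal series\<close>

text \<open>
  A formal series is a function from exponents to coefficients. Exponents are real numbers
  (one variable) or triples of real numbers; the triple \<open>(e0, e1, e2)\<close> stands for the monomial
  \<open>x0^e0 * x1^e1 * x2^e2\<close>. All infinite sums of coefficients are taken with \<^const>\<open>Sum_any\<close>, the sum
  over the support of the summand; every such sum below has finite support in the situations in
  which it is used.
\<close>

type_synonym expo3 = "real \<times> real \<times> real"

abbreviation X0 :: expo3 where "X0 \<equiv> (1, 0, 0)"
abbreviation X1 :: expo3 where "X1 \<equiv> (0, 1, 0)"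
abbreviation X2 :: expo3 where "X2 \<equiv> (0, 0, 1)"

text \<open>Cauchy product of a scalar series and a series with coefficients in a vector space
  whose scalar multiplication is \<open>s\<close>.\<close>

definition series_mult ::
  "(complex \<Rightarrow> 'w \<Rightarrow> 'w) \<Rightarrow> ('e::ab_group_add \<Rightarrow> complex) \<Rightarrow> ('e \<Rightarrow> 'w::ab_group_add) \<Rightarrow> 'e \<Rightarrow> 'w" where
  "series_mult s f g = (\<lambda>e. Sum_any (\<lambda>d. s (f d) (g (e - d))))"

text \<open>\<open>(A + c B)^\<alpha>\<close> for two distinct variables \<open>A\<close>, \<open>B\<close> (given as unit exponent vectors), expanded
  in nonnegative integral powers of the second variable \<open>B\<close>.\<close>

definition binomial_series :: "expo3 \<Rightarrow> complex \<Rightarrow> expo3 \<Rightarrow> real \<Rightarrow> expo3 \<Rightarrow> complex" where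
  "binomial_series A c B \<alpha> = (\<lambda>e. Sum_any (\<lambda>i::nat.
     if e = (\<alpha> - real i) *\<^sub>R A + real i *\<^sub>R B then (complex_of_real \<alpha> gchoose i) * c ^ i else 0))"

text \<open>\<open>C^(-1) \<delta>(\<zeta> ((A + c B) / C)^(1/N))\<close>, where \<open>\<delta>(x)\<close> is the sum of all integral powers of \<open>x\<close>;
  that is, the sum over all integers \<open>n\<close> of \<open>\<zeta>^n C^(-1-n/N) (A + c B)^(n/N)\<close>.\<close>

definition delta_series ::
  "nat \<Rightarrow> complex \<Rightarrow> expo3 \<Rightarrow> expo3 \<Rightarrow> complex \<Rightarrow> expo3 \<Rightarrow> expo3 \<Rightarrow> complex" where
  "delta_series N \<zeta> C A c B = (\<lambda>e. Sum_any (\<lambda>n::int.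
     \<zeta> powi n * binomial_series A c B (real_of_int n / real N)
       (e - (- 1 - real_of_int n / real N) *\<^sub>R C)))"

text \<open>A polynomial \<open>p(x1, x2)\<close> is a polynomial in \<open>x2\<close> whose coefficients are polynomials in \<open>x1\<close>.\<close>

definition poly_series :: "complex poly poly \<Rightarrow> expo3 \<Rightarrow> complex" where
  "poly_series p = (\<lambda>(e0, e1, e2). if e0 = 0 \<and> e1 \<in> \<nat> \<and> e2 \<in> \<nat>
     then Polynomial.coeff (Polynomial.coeff p (nat \<lfloor>e2\<rfloor>)) (nat \<lfloor>e1\<rfloor>) else 0)"

definition x1N_minus_x2N :: "nat \<Rightarrow> complex poly poly" where
  "x1N_minus_x2N N = [:Polynomial.monom 1 N:] - Polynomial.monom 1 N"

text \<open>The space \<open>W((x^(1/N)))\<close>.\<close>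

definition laurent_series :: "nat \<Rightarrow> (real \<Rightarrow> 'w::zero) set" where
  "laurent_series N = {f. (\<forall>r. f r \<noteq> 0 \<longrightarrow> real N * r \<in> \<int>) \<and> (\<exists>b. \<forall>r<b. f r = 0)}"


section \<open>Vertex operator algebras\<close>

text \<open>
  \<open>vop V u r\<close> is the coefficient of \<open>x^r\<close> in \<open>Y(u, x)\<close>, so the customary mode \<open>u_n\<close> is
  \<open>vop V u (- n - 1)\<close>. The same convention is used for the vertex operator maps of modules.
\<close>

record 'v voa =
  smul :: "complex \<Rightarrow> 'v \<Rightarrow> 'v"
  grade :: "int \<Rightarrow> 'v set"
  vop :: "'v \<Rightarrow> real \<Rightarrow> 'v \<Rightarrow> 'v"
  vac :: 'v
  conf :: 'v

text \<open>\<open>Y(\<omega>, x)\<close> is the sum of \<open>L(n) x^(-n-2)\<close>.\<close>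

definition Vir :: "'v voa \<Rightarrow> int \<Rightarrow> 'v \<Rightarrow> 'v" where
  "Vir V n = vop V (conf V) (real_of_int (- n - 2))"

text \<open>A linear map \<open>Y\<close> from \<open>V\<close> to \<open>Hom(W, W((x^(1/N))))\<close>.\<close>

definition vertex_map ::
  "'v::ab_group_add voa \<Rightarrow> (complex \<Rightarrow> 'w \<Rightarrow> 'w) \<Rightarrow> nat \<Rightarrow> ('v \<Rightarrow> real \<Rightarrow> 'w \<Rightarrow> 'w::ab_group_add) \<Rightarrow> bool"
where
  "vertex_map V sW N Y \<longleftrightarrow>
     (\<forall>r w. Vector_Spaces.linear (smul V) sW (\<lambda>v. Y v r w)) \<and>
     (\<forall>v r. Vector_Spaces.linear sW sW (Y v r)) \<and>
     (\<forall>v w. (\<lambda>r. Y v r w) \<in> laurent_series N)"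

text \<open>The three products of vertex operators occurring in the Jacobi identities, applied to \<open>w\<close>:
  \<open>Y(u, x1) Y(v, x2) w\<close>, \<open>Y(v, x2) Y(u, x1) w\<close> and \<open>Y(Y(u, x0) v, x2) w\<close>.\<close>

definition prod12 :: "('v \<Rightarrow> real \<Rightarrow> 'w \<Rightarrow> 'w::zero) \<Rightarrow> 'v \<Rightarrow> 'v \<Rightarrow> 'w \<Rightarrow> expo3 \<Rightarrow> 'w" where
  "prod12 Y u v w = (\<lambda>(e0, e1, e2). if e0 = 0 then Y u e1 (Y v e2 w) else 0)"

definition prod21 :: "('v \<Rightarrow> real \<Rightarrow> 'w \<Rightarrow> 'w::zero) \<Rightarrow> 'v \<Rightarrow> 'v \<Rightarrow> 'w \<Rightarrow> expo3 \<Rightarrow> 'w" where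
  "prod21 Y u v w = (\<lambda>(e0, e1, e2). if e0 = 0 then Y v e2 (Y u e1 w) else 0)"

definition iterate ::
  "'v voa \<Rightarrow> ('v \<Rightarrow> real \<Rightarrow> 'w \<Rightarrow> 'w::zero) \<Rightarrow> 'v \<Rightarrow> 'v \<Rightarrow> 'w \<Rightarrow> expo3 \<Rightarrow> 'w" where
  "iterate V Y u v w = (\<lambda>(e0, e1, e2). if e1 = 0 then Y (vop V u e0 v) e2 w else 0)"

text \<open>The quasi Jacobi identity for \<open>u\<close>, \<open>v\<close> with polynomial factor \<open>p\<close>; the ordinary Jacobi identity
  is the case \<open>p = 1\<close>.\<close>

definition quasi_jacobi ::
  "'v voa \<Rightarrow> (complex \<Rightarrow> 'w \<Rightarrow> 'w) \<Rightarrow> ('v \<Rightarrow> real \<Rightarrow> 'w \<Rightarrow> 'w::ab_group_add) \<Rightarrow>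
     complex poly poly \<Rightarrow> 'v \<Rightarrow> 'v \<Rightarrow> bool" where
  "quasi_jacobi V sW Y p u v \<longleftrightarrow> (\<forall>w e.
     series_mult sW (delta_series 1 1 X0 X1 (- 1) X2)
       (series_mult sW (poly_series p) (prod12 Y u v w)) e
     - series_mult sW (delta_series 1 (- 1) X0 X2 (- 1) X1)
       (series_mult sW (poly_series p) (prod21 Y u v w)) e
     = series_mult sW (delta_series 1 1 X2 X1 (- 1) X0)
       (series_mult sW (poly_series p) (iterate V Y u v w)) e)"

locale vertex_operator_algebra = vector_space "smul V"
  for V :: "'v::ab_group_add voa" +
  assumes grade_subspace: "subspace (grade V n)"
    and grade_direct_sum:
      "\<exists>!f. (\<forall>n. f n \<in> grade V n) \<and> finite {n. f n \<noteq> 0} \<and> Sum_any f = v"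
    and grade_finite_dim: "\<exists>B. finite B \<and> grade V n = span B"
    and grade_bounded_below: "\<exists>m. \<forall>n<m. grade V n = {0}"
    and vertex_map: "vertex_map V (smul V) 1 (vop V)"
    and vacuum: "vop V (vac V) r v = (if r = 0 then v else 0)"
    and creation_regular: "r < 0 \<Longrightarrow> vop V v r (vac V) = 0"
    and creation: "vop V v 0 (vac V) = v"
    and jacobi: "quasi_jacobi V (smul V) (vop V) 1 u v"
    and vac_grade: "vac V \<in> grade V 0"
    and conf_grade: "conf V \<in> grade V 2"
    and virasoro: "\<exists>c. \<forall>m n v.
      Vir V m (Vir V n v) - Vir V n (Vir V m v)
      = smul V (of_int (m - n)) (Vir V (m + n) v)
        + (if m + n = 0 then smul V (of_int (m ^ 3 - m) / 12 * c) v else 0)"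
    and L0_grade: "v \<in> grade V n \<Longrightarrow> Vir V 0 v = smul V (of_int n) v"
    and L_minus1_derivative:
      "vop V (Vir V (- 1) v) r w = smul V (of_real (r + 1)) (vop V v (r + 1) w)"

text \<open>The homogeneous components of a vector, and the operator acting on \<open>V_(n)\<close> as the scalar \<open>c n\<close>
  (for instance \<open>z^L(0)\<close> for \<open>c n = z^n\<close>).\<close>

definition hcomp :: "'v::ab_group_add voa \<Rightarrow> 'v \<Rightarrow> int \<Rightarrow> 'v" where
  "hcomp V v = (THE f. (\<forall>n. f n \<in> grade V n) \<and> finite {n. f n \<noteq> 0} \<and> Sum_any f = v)"

definition weight_op :: "'v::ab_group_add voa \<Rightarrow> (int \<Rightarrow> complex) \<Rightarrow> 'v \<Rightarrow> 'v" where
  "weight_op V c v = Sum_any (\<lambda>n. smul V (c n) (hcomp V v n))"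

definition aut_group :: "'v::ab_group_add voa \<Rightarrow> ('v \<Rightarrow> 'v) monoid" where
  "aut_group V = \<lparr>
     carrier = {g. Vector_Spaces.linear (smul V) (smul V) g \<and> bij g \<and>
       (\<forall>u r v. g (vop V u r v) = vop V (g u) r (g v)) \<and> g (vac V) = vac V \<and> g (conf V) = conf V},
     monoid.mult = (\<circ>), one = id\<rparr>"

lemma group_aut_group:
  assumes "vector_space (smul V)"
  shows "group (aut_group V)"
proof -
  interpret V: vector_space "smul V" by fact
  show ?thesis
  proof (rule groupI)
    fix g h assume "g \<in> carrier (aut_group V)" "h \<in> carrier (aut_group V)"
    then show "g \<otimes>\<^bsub>aut_group V\<^esub> h \<in> carrier (aut_group V)"
      by (auto simp: aut_group_def bij_comp intro: Vector_Spaces.linear_compose)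
  next
    show "\<one>\<^bsub>aut_group V\<^esub> \<in> carrier (aut_group V)"
      by (auto simp: aut_group_def V.linear_id)
  next
    fix g assume g: "g \<in> carrier (aut_group V)"
    let ?h = "inv_into UNIV g"
    have lin: "Vector_Spaces.linear (smul V) (smul V) g" and "bij g"
      using g by (auto simp: aut_group_def)
    have gh: "g (?h x) = x" and hg: "?h (g x) = x" for x
      using \<open>bij g\<close> by (simp_all add: bij_is_surj surj_f_inv_f bij_is_inj inv_f_f)
    have "Vector_Spaces.linear (smul V) (smul V) ?h"
    proof -
      interpret g: Vector_Spaces.linear "smul V" "smul V" g by (fact lin)
      show ?thesis
        by unfold_locales (metis g.add gh hg, metis g.scale gh hg)
    qed
    moreover have "?h (vop V u r v) = vop V (?h u) r (?h v)" for u r v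
    proof -
      have "g (vop V (?h u) r (?h v)) = vop V u r v"
        using g by (simp add: aut_group_def gh)
      then show ?thesis by (metis hg)
    qed
    moreover have "?h (vac V) = vac V" "?h (conf V) = conf V"
      using g hg[of "vac V"] hg[of "conf V"] by (simp_all add: aut_group_def)
    ultimately have "?h \<in> carrier (aut_group V)"
      using \<open>bij g\<close> by (simp add: aut_group_def bij_imp_bij_inv)
    then show "\<exists>h\<in>carrier (aut_group V). h \<otimes>\<^bsub>aut_group V\<^esub> g = \<one>\<^bsub>aut_group V\<^esub>"
      by (rule bexI[rotated]) (auto simp: aut_group_def hg)
  qed (auto simp: aut_group_def)
qed

definition complex_units :: "complex monoid" where
  "complex_units = \<lparr>carrier = - {0}, monoid.mult = (*), one = 1\<rparr>"


section \<open>Quasi modules and twisted modules\<close>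

locale quasi_module = vertex_operator_algebra V + W: vector_space sW
  for V :: "'v::ab_group_add voa" and sW :: "complex \<Rightarrow> 'w::ab_group_add \<Rightarrow> 'w" +
  fixes YW :: "'v \<Rightarrow> real \<Rightarrow> 'w \<Rightarrow> 'w"
  assumes module_vertex_map: "vertex_map V sW 1 YW"
    and module_vacuum: "YW (vac V) r w = (if r = 0 then w else 0)"
    and module_quasi_jacobi: "\<exists>p. p \<noteq> 0 \<and> quasi_jacobi V sW YW p u v"

text \<open>\<open>G\<close> is a group of automorphisms of \<open>V\<close> and \<open>\<phi>\<close> a character of \<open>G\<close>.\<close>

locale G_phi_quasi_module = quasi_module V sW YW
  for V :: "'v::ab_group_add voa" and N :: nat and G :: "('v \<Rightarrow> 'v) monoid"
    and \<phi> :: "('v \<Rightarrow> 'v) \<Rightarrow> complex"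
    and sW :: "complex \<Rightarrow> 'w::ab_group_add \<Rightarrow> 'w" and YW :: "'v \<Rightarrow> real \<Rightarrow> 'w \<Rightarrow> 'w" +
  assumes quasi_jacobi_power: "\<exists>k. quasi_jacobi V sW YW (x1N_minus_x2N N ^ k) u v"
    and equivariance: "g \<in> carrier G \<Longrightarrow>
      YW (weight_op V (\<lambda>n. \<phi> g powi (- n)) (g u)) (real_of_int m) w
      = sW (\<phi> g powi m) (YW u (real_of_int m) w)"

definition root_of_unity :: "nat \<Rightarrow> complex" where
  "root_of_unity N = exp (2 * of_real pi * \<i> / of_nat N)"

locale weak_twisted_module = vertex_operator_algebra V + W: vector_space sW
  for V :: "'v::ab_group_add voa" and N :: nat and \<sigma> :: "'v \<Rightarrow> 'v"
    and sW :: "complex \<Rightarrow> 'w::ab_group_add \<Rightarrow> 'w" +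
  fixes YW :: "'v \<Rightarrow> real \<Rightarrow> 'w \<Rightarrow> 'w"
  assumes twist_aut: "\<sigma> \<in> carrier (aut_group V)"
    and twist_order: "N > 0" "group.ord (aut_group V) \<sigma> = N"
    and twisted_vertex_map: "vertex_map V sW N YW"
    and twisted_vacuum: "YW (vac V) r w = (if r = 0 then w else 0)"
    and twisted_jacobi:
      "series_mult sW (delta_series 1 1 X0 X1 (- 1) X2) (prod12 YW u v w) e
       - series_mult sW (delta_series 1 (- 1) X0 X2 (- 1) X1) (prod21 YW u v w) e
       = sW (1 / of_nat N) (\<Sum>r<N.
           series_mult sW (delta_series N (root_of_unity N ^ r) X1 X2 1 X0)
             (iterate V YW ((\<sigma> ^^ r) u) v w) e)"


section \<open>The operator Delta\<close>

text \<open>\<open>exp(- (\<Sum>n\<ge>1. a n x^(n+1) d/dx)) f\<close>, computed coefficientwise. Only the values \<open>a n\<close> with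
  \<open>n \<ge> 1\<close> matter.\<close>

definition vector_field :: "(nat \<Rightarrow> complex) \<Rightarrow> complex fps \<Rightarrow> complex fps" where
  "vector_field a f = - (Abs_fps (\<lambda>m. if m \<ge> 2 then a (m - 1) else 0) * fps_deriv f)"

definition exp_vector_field :: "(nat \<Rightarrow> complex) \<Rightarrow> complex fps \<Rightarrow> complex fps" where
  "exp_vector_field a f = Abs_fps (\<lambda>m. Sum_any (\<lambda>k. fps_nth ((vector_field a ^^ k) f) m / fact k))"

text \<open>A series \<open>x + \<dots>\<close> is of the form \<open>exp(- (\<Sum>n\<ge>1. a n x^(n+1) d/dx)) x\<close> for exactly one sequence
  \<open>a 1, a 2, \<dots>\<close> (normalised by \<open>a 0 = 0\<close>), so the coefficients of \<open>\<Delta>_N\<close> are well defined.\<close>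

lemma vector_field_nth:
  "fps_nth (vector_field a f) m =
     - (\<Sum>i=2..m. a (i - 1) * (of_nat (m - i + 1) * fps_nth f (m - i + 1)))"
proof -
  have "fps_nth (vector_field a f) m =
      - (\<Sum>i=0..m. (if i \<ge> 2 then a (i - 1) else 0) * (of_nat (m - i + 1) * fps_nth f (m - i + 1)))"
    by (simp add: vector_field_def fps_mult_nth)
  also have "(\<Sum>i=0..m. (if i \<ge> 2 then a (i - 1) else 0) * (of_nat (m - i + 1) * fps_nth f (m - i + 1)))
      = (\<Sum>i=2..m. a (i - 1) * (of_nat (m - i + 1) * fps_nth f (m - i + 1)))"
    by (rule sum.mono_neutral_cong_right) auto
  finally show ?thesis .
qed

lemma vector_field_pow_low:
  "m \<le> k \<Longrightarrow> fps_nth ((vector_field a ^^ k) fps_X) m = 0"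
proof (induction k arbitrary: m)
  case (Suc k)
  have "fps_nth ((vector_field a ^^ k) fps_X) (m - i + 1) = 0" if "i \<in> {2..m}" for i
    using that Suc.prems by (intro Suc.IH) auto
  then show ?case by (simp add: vector_field_nth)
qed simp

lemma vector_field_pow_cong:
  assumes "\<And>j. 1 \<le> j \<Longrightarrow> j < M \<Longrightarrow> a j = b j" and "m \<le> M"
  shows "fps_nth ((vector_field a ^^ k) fps_X) m = fps_nth ((vector_field b ^^ k) fps_X) m"
  using assms(2)
proof (induction k arbitrary: m)
  case (Suc k)
  have "a (i - 1) * (of_nat (m - i + 1) * fps_nth ((vector_field a ^^ k) fps_X) (m - i + 1))
      = b (i - 1) * (of_nat (m - i + 1) * fps_nth ((vector_field b ^^ k) fps_X) (m - i + 1))"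
    if "i \<in> {2..m}" for i
    using that Suc.prems Suc.IH[of "m - i + 1"] assms(1)[of "i - 1"] by auto
  then show ?case
    unfolding funpow.simps comp_apply vector_field_nth
    by (intro arg_cong[where f = uminus] sum.cong refl)
qed simp

lemma vector_field_pow_top:
  assumes "\<And>j. 1 \<le> j \<Longrightarrow> j < M \<Longrightarrow> a j = b j" and "1 \<le> M"
  shows "fps_nth ((vector_field a ^^ k) fps_X) (Suc M) + (if k = 1 then a M else 0)
       = fps_nth ((vector_field b ^^ k) fps_X) (Suc M) + (if k = 1 then b M else 0)"
proof (cases k)
  case (Suc k')
  have peel: "fps_nth (vector_field c f) (Suc M) = - c M * fps_nth f 1
      - (\<Sum>i=2..M. c (i - 1) * (of_nat (Suc M - i + 1) * fps_nth f (Suc M - i + 1)))" for c f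
    using assms(2) by (simp add: vector_field_nth)
  have "(\<Sum>i=2..M. a (i - 1) * (of_nat (Suc M - i + 1) * fps_nth ((vector_field a ^^ k') fps_X) (Suc M - i + 1)))
      = (\<Sum>i=2..M. b (i - 1) * (of_nat (Suc M - i + 1) * fps_nth ((vector_field b ^^ k') fps_X) (Suc M - i + 1)))"
  proof (rule sum.cong)
    fix i assume i: "i \<in> {2..M}"
    have "fps_nth ((vector_field a ^^ k') fps_X) (Suc M - i + 1)
        = fps_nth ((vector_field b ^^ k') fps_X) (Suc M - i + 1)"
      using i by (intro vector_field_pow_cong[where M = M] assms(1)) auto
    moreover have "a (i - 1) = b (i - 1)"
      using i by (intro assms(1)) auto
    ultimately show "a (i - 1) * (of_nat (Suc M - i + 1) * fps_nth ((vector_field a ^^ k') fps_X) (Suc M - i + 1))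
      = b (i - 1) * (of_nat (Suc M - i + 1) * fps_nth ((vector_field b ^^ k') fps_X) (Suc M - i + 1))"
      by (simp only:)
  qed simp
  moreover have "fps_nth ((vector_field c ^^ k') fps_X) 1 = (if k' = 0 then 1 else 0)" for c
    using vector_field_pow_low[of 1 k' c] by (cases "k' = 0") auto
  ultimately show ?thesis by (simp add: Suc peel del: One_nat_def)
qed simp

lemma exp_vector_field_nth:
  "fps_nth (exp_vector_field a fps_X) m = (\<Sum>k<m. fps_nth ((vector_field a ^^ k) fps_X) m / fact k)"
  unfolding exp_vector_field_def
  by (simp, rule Sum_any.expand_superset) (use vector_field_pow_low[of m _ a] not_less in auto)

lemma exp_vector_field_top:
  assumes "\<And>j. 1 \<le> j \<Longrightarrow> j < M \<Longrightarrow> a j = b j" and "1 \<le> M"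
  shows "fps_nth (exp_vector_field a fps_X) (Suc M) + a M
       = fps_nth (exp_vector_field b fps_X) (Suc M) + b M"
proof -
  have *: "fps_nth (exp_vector_field c fps_X) (Suc M) + c M
      = (\<Sum>k<Suc M. (fps_nth ((vector_field c ^^ k) fps_X) (Suc M) + (if k = 1 then c M else 0)) / fact k)"
    for c
  proof -
    have "(\<Sum>k<Suc M. (if k = 1 then c M else 0) / fact k) = (\<Sum>k<Suc M. if k = 1 then c M else 0)"
      by (rule sum.cong) auto
    also have "\<dots> = c M" using assms(2) by simp
    finally show ?thesis
      by (simp only: exp_vector_field_nth add_divide_distrib sum.distrib)
  qed
  show ?thesis
    unfolding * using vector_field_pow_top[of M a b, OF assms] by simp
qed

fun vector_field_coeffs :: "complex fps \<Rightarrow> nat \<Rightarrow> complex" where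
  "vector_field_coeffs h M = (if M = 0 then 0 else
     fps_nth (exp_vector_field (\<lambda>j. if j < M then vector_field_coeffs h j else 0) fps_X) (Suc M)
     - fps_nth h (Suc M))"

declare vector_field_coeffs.simps [simp del]

lemma ex1_exp_vector_field:
  assumes "fps_nth h 0 = 0" and "fps_nth h 1 = 1"
  shows "\<exists>!a. a 0 = 0 \<and> exp_vector_field a fps_X = h"
proof (rule ex1I)
  let ?a = "vector_field_coeffs h"
  have "fps_nth (exp_vector_field ?a fps_X) m = fps_nth h m" for m
  proof (cases "m \<le> 1")
    case True
    then consider "m = 0" | "m = 1" by linarith
    then show ?thesis using assms by cases (simp_all add: exp_vector_field_nth)
  next
    case False
    then obtain M where M: "m = Suc M" "1 \<le> M" by (cases m) auto
    show ?thesis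
      using exp_vector_field_top[of M ?a "\<lambda>j. if j < M then ?a j else 0"] M
        vector_field_coeffs.simps[of h M] by simp
  qed
  then show "?a 0 = 0 \<and> exp_vector_field ?a fps_X = h"
    by (simp add: fps_eq_iff vector_field_coeffs.simps)
next
  fix b assume b: "b 0 = 0 \<and> exp_vector_field b fps_X = h"
  have "b M = vector_field_coeffs h M" for M
  proof (induction M rule: less_induct)
    case (less M)
    show ?case
    proof (cases "M = 0")
      case False
      let ?c = "\<lambda>j. if j < M then vector_field_coeffs h j else 0"
      have "fps_nth h (Suc M) + b M = fps_nth (exp_vector_field ?c fps_X) (Suc M)"
        using exp_vector_field_top[of M b ?c] False less b by simp
      moreover have "vector_field_coeffs h M = fps_nth (exp_vector_field ?c fps_X) (Suc M) - fps_nth h (Suc M)"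
        using False vector_field_coeffs.simps[of h M] by simp
      ultimately show ?thesis by (metis add_diff_cancel_left')
    qed (use b in \<open>simp add: vector_field_coeffs.simps\<close>)
  qed
  then show "b = vector_field_coeffs h" by blast
qed

lemma ex1_Delta_coeffs:
  assumes "N > 0"
  shows "\<exists>!a. a 0 = 0 \<and>
    exp_vector_field a fps_X = fps_const (1 / of_nat N) * (1 + fps_X) ^ N - fps_const (1 / of_nat N)"
proof (rule ex1_exp_vector_field)
  have *: "fps_nth ((1 + fps_X :: complex fps) ^ n) 0 = 1 \<and>
      fps_nth ((1 + fps_X :: complex fps) ^ n) 1 = of_nat n" for n
    by (induction n) (simp_all add: distrib_right fps_X_mult_nth)
  show "fps_nth (fps_const (1 / of_nat N) * (1 + fps_X) ^ N - fps_const (1 / of_nat N) :: complex fps) 0 = 0"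
    "fps_nth (fps_const (1 / of_nat N) * (1 + fps_X) ^ N - fps_const (1 / of_nat N) :: complex fps) 1 = 1"
    using *[of N] assms by simp_all
qed

text \<open>The action of \<open>\<Sum>n\<ge>1. a n x^(-n/N) L(n)\<close> on a series with coefficients in \<open>V\<close>, and its
  exponential.\<close>

definition vir_sum ::
  "'v::ab_group_add voa \<Rightarrow> nat \<Rightarrow> (nat \<Rightarrow> complex) \<Rightarrow> (real \<Rightarrow> 'v) \<Rightarrow> real \<Rightarrow> 'v" where
  "vir_sum V N a f = (\<lambda>r. Sum_any (\<lambda>n::nat.
     if n \<ge> 1 then smul V (a n) (Vir V (int n) (f (r + real n / real N))) else 0))"

definition exp_vir_sum ::
  "'v::ab_group_add voa \<Rightarrow> nat \<Rightarrow> (nat \<Rightarrow> complex) \<Rightarrow> (real \<Rightarrow> 'v) \<Rightarrow> real \<Rightarrow> 'v" where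
  "exp_vir_sum V N a f = (\<lambda>r. Sum_any (\<lambda>k. smul V (1 / fact k) ((vir_sum V N a ^^ k) f r)))"

text \<open>\<open>x^((1/N - 1) L(0)) u\<close>.\<close>

definition x_pow_L0 :: "'v::ab_group_add voa \<Rightarrow> nat \<Rightarrow> 'v \<Rightarrow> real \<Rightarrow> 'v" where
  "x_pow_L0 V N u = (\<lambda>r. Sum_any (\<lambda>n::int.
     if r = (1 / real N - 1) * real_of_int n then hcomp V u n else 0))"

definition Delta ::
  "'v::ab_group_add voa \<Rightarrow> nat \<Rightarrow> (nat \<Rightarrow> complex) \<Rightarrow> 'v \<Rightarrow> real \<Rightarrow> 'v" where
  "Delta V N a u = exp_vir_sum V N a
     (\<lambda>r. weight_op V (\<lambda>n. of_nat N powi (- n)) (x_pow_L0 V N u r))"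

text \<open>\<open>Y_W(\<Delta>_N(x) u, x^(1/N))\<close>: a term \<open>v x^s\<close> of \<open>\<Delta>_N(x) u\<close> contributes \<open>x^s Y_W(v, x^(1/N))\<close>, whose
  coefficient of \<open>x^r\<close> is the coefficient of \<open>z^(N (r - s))\<close> in \<open>Y_W(v, z)\<close>.\<close>

definition twisted_map ::
  "'v::ab_group_add voa \<Rightarrow> nat \<Rightarrow> (nat \<Rightarrow> complex) \<Rightarrow>
     ('v \<Rightarrow> real \<Rightarrow> 'w \<Rightarrow> 'w::ab_group_add) \<Rightarrow> 'v \<Rightarrow> real \<Rightarrow> 'w \<Rightarrow> 'w" where
  "twisted_map V N a YW u r w = Sum_any (\<lambda>s. YW (Delta V N a u s) (real N * (r - s)) w)"

end

theory Submission
  imports Defs "HOL-Computational_Algebra.Formal_Laurent_Series" "HOL-Analysis.Complex_Transcendental"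
begin

text \<open>
  Put \<open>z = x^(1/N)\<close>. The core is the conjugation formula
  \<open>\<Delta>_N(x) Y(u, x0) v = Y(\<Delta>_N(x + x0) u, (x + x0)^(1/N) - x^(1/N)) \<Delta>_N(x) v\<close> on \<open>V\<close>. By repeated commutators
  with \<open>L(n)\<close>, the conjugate of \<open>Y(u, x0)\<close> by \<open>exp (\<Sum>n\<ge>1. a n L(n))\<close> is again of the form \<open>Y(f(x0), x0)\<close>, and so
  is the right-hand side; two such fields agree as soon as they agree on the vacuum, where the
  formula follows by induction on the power of \<open>x0\<close> from the \<open>L(-1)\<close>-derivative property.

  On \<open>W\<close>, the quasi Jacobi identity says that \<open>(z1^N - z2^N)^k Y(u, z1) Y(v, z2)\<close> and the product in the opposite
  order are the same series, which is homogeneous with finitely many terms in each degree, and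
  that its substitution \<open>z1 = z2 + z0\<close> is \<open>((z2 + z0)^N - z2^N)^k Y(Y(u, z0) v, z2)\<close>. For the twisted operators,
  \<open>z1^N - z2^N\<close> is \<open>x1 - x2\<close>, and the conjugation formula turns the substitution into \<open>z1 = (x2 + x0)^(1/N)\<close>.
  Equivariance gives the other branches \<open>z1 = \<omega>_N^r (x2 + x0)^(1/N)\<close>, and averaging over \<open>r\<close> yields the
  twisted Jacobi identity. Everything is tested against linear functionals on \<open>W\<close> in a fixed degree,
  where the series become scalar series in \<open>y = z1/z2\<close>.
\<close>

section \<open>Delta series\<close>

text \<open>The obstacle is that the two orders of a product are series of different kinds: in a
  fixed total degree one has exponents of \<open>y\<close> bounded above, the other bounded below,
  and only a power of \<open>y^N - 1\<close> turns both into the same Laurent polynomial. Dividing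
  this power out again is ambiguous. The expansions of a negative power in \<open>1/y\<close> and in
  \<open>y\<close> differ by a derivative of a delta function, and the right-hand side of either
  Jacobi identity records just this difference. In the twisted identity all roots of
  \<open>y^N = 1\<close> contribute to it, whereas an iterate \<open>Y(Y(u, x0) v, x2)\<close> only
  sees the expansion at \<open>y = 1\<close>; equivariance moves the other roots there. The power of
  \<open>y^N - 1\<close> may depend on the functional and on the degree, because it drops out at the
  end. On \<open>V\<close>, exponentials are split by the amount by which they lower the weight, so
  that all sums are finite. The defining equation of the \<open>a n\<close> enters only once,
  through the correspondence of \<open>L(n)\<close> with \<open>- t^(n+1) d/dt\<close>, to commute
  the exponential with \<open>L(-1)\<close>.\<close>

lemma Sum_any_reindex:
  assumes "inj h" and "\<And>d. d \<notin> range h \<Longrightarrow> F d = 0"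
  shows "Sum_any F = Sum_any (\<lambda>x. F (h x))"
proof -
  have "{d. F d \<noteq> 0} = h ` {x. F (h x) \<noteq> 0}"
    using assms(2) by (smt (verit) Collect_cong image_Collect rangeE)
  then show ?thesis
    unfolding Sum_any.expand_set
    by (simp add: sum.reindex inj_on_subset[OF assms(1)])
qed

text \<open>The exponent of \<open>C^(-1-n/N) A^(n/N-i) B^i\<close>: term \<open>i\<close> of the
  binomial expansion inside term \<open>n\<close> of the delta function. For independent
  \<open>A\<close>, \<open>B\<close>, \<open>C\<close> distinct pairs give distinct monomials, so no
  two terms of a delta series have to be collected.\<close>

definition delta_exp :: "nat \<Rightarrow> expo3 \<Rightarrow> expo3 \<Rightarrow> expo3 \<Rightarrow> int \<Rightarrow> nat \<Rightarrow> expo3" where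
  "delta_exp N C A B n i = (- 1 - real_of_int n / real N) *\<^sub>R C
     + ((real_of_int n / real N - real i) *\<^sub>R A + real i *\<^sub>R B)"

definition independent_exps :: "expo3 \<Rightarrow> expo3 \<Rightarrow> expo3 \<Rightarrow> bool" where
  "independent_exps C A B \<longleftrightarrow> (\<forall>\<alpha> \<beta> \<gamma> \<alpha>' \<beta>' \<gamma>'.
     \<alpha> *\<^sub>R C + (\<beta> *\<^sub>R A + \<gamma> *\<^sub>R B) = \<alpha>' *\<^sub>R C + (\<beta>' *\<^sub>R A + \<gamma>' *\<^sub>R B) \<longrightarrow> \<alpha> = \<alpha>' \<and> \<beta> = \<beta>' \<and> \<gamma> = \<gamma>')"

lemma delta_exp_inj:
  assumes "independent_exps C A B" "N > 0" "delta_exp N C A B n i = delta_exp N C A B n' i'"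
  shows "n = n' \<and> i = i'"
proof -
  have "- 1 - real_of_int n / real N = - 1 - real_of_int n' / real N \<and>
    real_of_int n / real N - real i = real_of_int n' / real N - real i' \<and> real i = real i'"
    using assms(1)[unfolded independent_exps_def, rule_format, OF assms(3)[unfolded delta_exp_def]] .
  then show ?thesis using assms(2) by simp
qed

lemma delta_series_eq:
  "delta_series N \<zeta> C A c B d = Sum_any (\<lambda>n. \<zeta> powi n * Sum_any (\<lambda>i.
     if d = delta_exp N C A B n i
     then (complex_of_real (real_of_int n / real N) gchoose i) * c ^ i else 0))"
proof -
  have "d - c' = x \<longleftrightarrow> d = c' + x" for c' x :: expo3 by (metis add_diff_cancel_left' diff_add_cancel add.commute)
  then show ?thesis unfolding delta_series_def binomial_series_def delta_exp_def by simp
qed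

lemma delta_series_delta_exp:
  assumes "independent_exps C A B" "N > 0"
  shows "delta_series N \<zeta> C A c B (delta_exp N C A B n i)
    = \<zeta> powi n * ((complex_of_real (real_of_int n / real N) gchoose i) * c ^ i)"
proof -
  have *: "delta_exp N C A B n i = delta_exp N C A B n' i' \<longleftrightarrow> n' = n \<and> i' = i" for n' i'
    using delta_exp_inj[OF assms] by blast
  have "delta_series N \<zeta> C A c B (delta_exp N C A B n i)
    = Sum_any (\<lambda>n'. if n' = n then \<zeta> powi n' * Sum_any (\<lambda>i'. if i' = i
        then (complex_of_real (real_of_int n' / real N) gchoose i') * c ^ i' else 0) else 0)"
    unfolding delta_series_eq * by (intro Sum_any.cong) simp
  then show ?thesis by simp
qed

lemma delta_series_outside:
  assumes "\<And>n i. d \<noteq> delta_exp N C A B n i"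
  shows "delta_series N \<zeta> C A c B d = 0"
  unfolding delta_series_eq using assms by simp

text \<open>A product with a delta function is a double sum over \<open>n\<close> and
  \<open>i\<close>. When \<open>f\<close> is concentrated in one power of a variable, that variable
  determines \<open>n\<close> from \<open>i\<close>, and a single sum remains; \<open>h\<close> is
  this dependence.\<close>

lemma series_mult_delta_reindex:
  fixes s :: "complex \<Rightarrow> 'w \<Rightarrow> 'w::ab_group_add" and h :: "nat \<Rightarrow> int"
  assumes ind: "independent_exps C A B" "N > 0"
    and s: "\<And>x. s 0 x = 0" "\<And>k. s k 0 = 0"
    and supp: "\<And>n i. n \<noteq> h i \<Longrightarrow> f (e - delta_exp N C A B n i) = 0"
  shows "series_mult s (delta_series N \<zeta> C A c B) f e = Sum_any (\<lambda>i.
    s (\<zeta> powi h i * ((complex_of_real (real_of_int (h i) / real N) gchoose i) * c ^ i))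
      (f (e - delta_exp N C A B (h i) i)))"
proof -
  let ?v = "\<lambda>i. delta_exp N C A B (h i) i"
  have inj: "inj ?v" using delta_exp_inj[OF ind] by (auto intro: injI)
  have "series_mult s (delta_series N \<zeta> C A c B) f e
    = Sum_any (\<lambda>i. s (delta_series N \<zeta> C A c B (?v i)) (f (e - ?v i)))"
    unfolding series_mult_def
  proof (rule Sum_any_reindex[OF inj])
    fix d assume d: "d \<notin> range ?v"
    show "s (delta_series N \<zeta> C A c B d) (f (e - d)) = 0"
    proof (cases "\<exists>n i. d = delta_exp N C A B n i")
      case True
      then obtain n i where "d = delta_exp N C A B n i" by blast
      moreover with d have "n \<noteq> h i" by blast
      ultimately show ?thesis using supp s(2) by simp
    next
      case False
      then show ?thesis by (simp add: delta_series_outside s(1))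
    qed
  qed
  then show ?thesis by (simp add: delta_series_delta_exp[OF ind])
qed

lemma series_mult_delta_zero:
  fixes s :: "complex \<Rightarrow> 'w \<Rightarrow> 'w::ab_group_add"
  assumes s: "\<And>x. s 0 x = 0" "\<And>k. s k 0 = 0"
    and supp: "\<And>n i. f (e - delta_exp N C A B n i) = 0"
  shows "series_mult s (delta_series N \<zeta> C A c B) f e = 0"
proof -
  have "s (delta_series N \<zeta> C A c B d) (f (e - d)) = 0" for d
    using supp s delta_series_outside[of d N C A B \<zeta> c] by metis
  then show ?thesis by (simp add: series_mult_def)
qed

lemma independent_exps_perms:
  "independent_exps X0 X1 X2" "independent_exps X0 X2 X1"
  "independent_exps X2 X1 X0" "independent_exps X1 X2 X0"
  by (auto simp: independent_exps_def)

section \<open>Coefficient extraction for products with the four delta functions\<close>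

locale scaled = fixes s :: "complex \<Rightarrow> 'w \<Rightarrow> 'w::ab_group_add"
  assumes s0: "\<And>x. s 0 x = 0" and s0': "\<And>k. s k 0 = 0"
begin

text \<open>Since \<open>f\<close> lives in \<open>x0^0\<close>, the exponent \<open>- 1 - m\<close>
  of \<open>x0\<close> leaves only the term \<open>n = m\<close> of the delta function, and what
  remains is the expansion of \<open>(x1 - x2)^m\<close>.\<close>

lemma delta_012:
  assumes "\<And>a b c. a \<noteq> 0 \<Longrightarrow> f (a, b, c) = 0"
  shows "series_mult s (delta_series 1 1 X0 X1 (- 1) X2) f (- 1 - of_int m, p, q)
    = Sum_any (\<lambda>i. s ((of_int m gchoose i) * (- 1) ^ i) (f (0, p - of_int m + real i, q - real i)))"
proof -
  have "series_mult s (delta_series 1 1 X0 X1 (- 1) X2) f (- 1 - of_int m, p, q)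
    = Sum_any (\<lambda>i. s (1 powi m * ((complex_of_real (real_of_int m / real 1) gchoose i) * (-1) ^ i))
      (f ((- 1 - of_int m, p, q) - delta_exp 1 X0 X1 X2 m i)))"
    by (rule series_mult_delta_reindex[where h = "\<lambda>_. m"])
      (auto simp: independent_exps_perms s0 s0' delta_exp_def assms)
  then show ?thesis by (simp add: delta_exp_def algebra_simps)
qed

lemma delta_021:
  assumes "\<And>a b c. a \<noteq> 0 \<Longrightarrow> f (a, b, c) = 0"
  shows "series_mult s (delta_series 1 (- 1) X0 X2 (- 1) X1) f (- 1 - of_int m, p, q)
    = Sum_any (\<lambda>i. s ((- 1) powi m * ((of_int m gchoose i) * (- 1) ^ i)) (f (0, p - real i, q - of_int m + real i)))"
proof -
  have "series_mult s (delta_series 1 (- 1) X0 X2 (- 1) X1) f (- 1 - of_int m, p, q)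
    = Sum_any (\<lambda>i. s ((- 1) powi m * ((complex_of_real (real_of_int m / real 1) gchoose i) * (-1) ^ i))
      (f ((- 1 - of_int m, p, q) - delta_exp 1 X0 X2 X1 m i)))"
    by (rule series_mult_delta_reindex[where h = "\<lambda>_. m"])
      (auto simp: independent_exps_perms s0 s0' delta_exp_def assms)
  then show ?thesis by (simp add: delta_exp_def algebra_simps)
qed

text \<open>Here \<open>f\<close> is concentrated in \<open>x1^t\<close>, and
  \<open>(x1 - x0)^n\<close> contributes \<open>x1^(n-i)\<close>, hence \<open>n = p - t + i\<close>
  varies with \<open>i\<close>. The value \<open>t\<close> is kept free because a polynomial factor
  shifts the iterate out of \<open>x1^0\<close>.\<close>

lemma delta_210:
  fixes p t :: int
  assumes "\<And>a b c. b \<noteq> of_int t \<Longrightarrow> f (a, b, c) = 0"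
  shows "series_mult s (delta_series 1 1 X2 X1 (- 1) X0) f (r, of_int p, q)
    = Sum_any (\<lambda>i. s ((of_int (p - t + int i) gchoose i) * (- 1) ^ i)
        (f (r - real i, of_int t, q + 1 + of_int (p - t) + real i)))"
proof -
  have ne: "real_of_int p - (real_of_int n - real i) \<noteq> of_int t" if "n \<noteq> p - t + int i" for n i
  proof
    assume "real_of_int p - (real_of_int n - real i) = of_int t"
    then have "real_of_int (p - (n - int i)) = of_int t" by simp
    then have "p - (n - int i) = t" by (simp only: of_int_eq_iff)
    then show False using that by simp
  qed
  have "series_mult s (delta_series 1 1 X2 X1 (- 1) X0) f (r, of_int p, q)
    = Sum_any (\<lambda>i. s (1 powi (p - t + int i) * ((complex_of_real (real_of_int (p - t + int i) / real 1) gchoose i) * (-1) ^ i))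
      (f ((r, of_int p, q) - delta_exp 1 X2 X1 X0 (p - t + int i) i)))"
    by (rule series_mult_delta_reindex[where h = "\<lambda>i. p - t + int i"])
      (auto simp: independent_exps_perms s0 s0' delta_exp_def intro!: assms dest!: ne)
  then show ?thesis by (simp add: delta_exp_def algebra_simps)
qed

text \<open>The exponent \<open>-1 - n/N\<close> of \<open>x1\<close> has to equal
  \<open>p/N\<close>, which forces \<open>n = -N - p\<close>. The branch \<open>\<zeta>\<close> of
  the root therefore enters with a power depending on \<open>p\<close> only.\<close>

lemma delta_120:
  fixes p :: int
  assumes "\<And>a b c. b \<noteq> 0 \<Longrightarrow> f (a, b, c) = 0" and N: "N > 0"
  shows "series_mult s (delta_series N \<zeta> X1 X2 1 X0) f (r, of_int p / real N, q)
    = Sum_any (\<lambda>i. s (\<zeta> powi (- int N - p) * (complex_of_real (of_int (- int N - p) / real N) gchoose i))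
        (f (r - real i, 0, q - of_int (- int N - p) / real N + real i)))"
proof -
  let ?n = "- int N - p"
  have eq: "real_of_int p / real N - (- 1 - real_of_int n / real N) = 0 \<longleftrightarrow> n = ?n" for n
  proof -
    have "real_of_int p / real N - (- 1 - real_of_int n / real N) = real_of_int (p + int N + n) / real N"
      using N by (simp add: field_simps)
    then show ?thesis using N by (simp del: of_int_add) linarith
  qed
  have "series_mult s (delta_series N \<zeta> X1 X2 1 X0) f (r, of_int p / real N, q)
    = Sum_any (\<lambda>i. s (\<zeta> powi ?n * ((complex_of_real (real_of_int ?n / real N) gchoose i) * 1 ^ i))
      (f ((r, of_int p / real N, q) - delta_exp N X1 X2 X0 ?n i)))"
  proof (rule series_mult_delta_reindex[where h = "\<lambda>_. ?n"])
    fix n i assume "n \<noteq> ?n"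
    then have "of_int p / real N - (- 1 - real_of_int n / real N) \<noteq> 0" using eq by blast
    then show "f ((r, of_int p / real N, q) - delta_exp N X1 X2 X0 n i) = 0"
      unfolding delta_exp_def using assms(1) by simp
  qed (auto simp: independent_exps_perms s0 s0' N)
  moreover have "(r, of_int p / real N, q) - delta_exp N X1 X2 X0 ?n i
      = (r - real i, 0, q - of_int ?n / real N + real i)" for i
    using eq[of ?n] by (simp add: delta_exp_def)
  ultimately show ?thesis by simp
qed

end

section \<open>Multiplication by powers of \<open>x1^N - x2^N\<close>\<close>

lemma x1N_minus_x2N_power_coeff:
  "Polynomial.coeff (Polynomial.coeff (x1N_minus_x2N N ^ k) b) a
   = (\<Sum>j\<le>k. if a = N * (k - j) \<and> b = N * j then of_nat (k choose j) * (- 1) ^ j else 0)"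
proof -
  let ?A = "[:Polynomial.monom 1 N:] :: complex poly poly"
  let ?B = "Polynomial.monom 1 N :: complex poly poly"
  have pA: "?A ^ m = [:Polynomial.monom 1 (N * m):]" for m
    by (induction m) (simp_all add: mult_monom one_pCons monom_0 algebra_simps)
  have pB: "(- ?B) ^ m = Polynomial.monom ((-1) ^ m) (N * m)" for m
    by (induction m) (simp_all add: mult_monom minus_monom one_pCons monom_0 algebra_simps)
  have "x1N_minus_x2N N ^ k = (- ?B + ?A) ^ k" by (simp add: x1N_minus_x2N_def)
  also have "\<dots> = (\<Sum>j\<le>k. of_nat (k choose j) * (- ?B) ^ j * ?A ^ (k - j))"
    by (rule binomial_ring)
  also have "\<dots> = (\<Sum>j\<le>k. Polynomial.monom (smult (of_nat (k choose j) * (- 1) ^ j) (Polynomial.monom 1 (N * (k - j)))) (N * j))"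
  proof (rule sum.cong[OF refl])
    fix j assume "j \<in> {..k}"
    have e: "((- 1) ^ j :: complex poly) = [:(- 1) ^ j:]"
      by (induction j) (simp_all add: one_pCons)
    have "of_nat (k choose j) * (- ?B) ^ j * ?A ^ (k - j)
      = smult (of_nat (k choose j)) (Polynomial.monom ((-1) ^ j * Polynomial.monom 1 (N * (k - j))) (N * j))"
      unfolding pA pB by (simp add: of_nat_poly smult_monom mult.commute)
    then show "of_nat (k choose j) * (- ?B) ^ j * ?A ^ (k - j)
      = Polynomial.monom (smult (of_nat (k choose j) * (- 1) ^ j) (Polynomial.monom 1 (N * (k - j)))) (N * j)"
      by (simp add: smult_monom of_nat_poly e mult_ac)
  qed
  finally show ?thesis
    by (auto simp: coeff_sum if_distrib[where f = "\<lambda>p. Polynomial.coeff p a"] intro!: sum.cong)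
qed

lemma poly_series_x1N_minus_x2N_power:
  "poly_series (x1N_minus_x2N N ^ k) d
   = (\<Sum>j\<le>k. if d = (0, real (N * (k - j)), real (N * j)) then of_nat (k choose j) * (- 1) ^ j else 0)"
proof -
  obtain a b c where d: "d = (a, b, c)" by (cases d)
  show ?thesis
  proof (cases "a = 0 \<and> b \<in> \<nat> \<and> c \<in> \<nat>")
    case True
    then obtain b' c' where "a = 0" "b = real b'" "c = real c'" by (auto elim!: Nats_cases)
    then show ?thesis
      unfolding d poly_series_def by (simp add: x1N_minus_x2N_power_coeff del: of_nat_mult)
  next
    case False
    then have ne: "d \<noteq> (0, real (N * (k - j)), real (N * j))" for j
      using d by (metis prod.inject of_nat_in_Nats)
    have "(\<Sum>j\<le>k. if d = (0, real (N * (k - j)), real (N * j)) then of_nat (k choose j) * (- 1) ^ j else 0 :: complex) = 0"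
      by (intro sum.neutral ballI) (simp only: ne if_False)
    then show ?thesis using False d unfolding poly_series_def by auto
  qed
qed

lemma series_mult_x1N_minus_x2N_power:
  assumes "vector_space s"
  shows "series_mult s (poly_series (x1N_minus_x2N N ^ k)) f (r, p, q)
    = (\<Sum>j\<le>k. s (of_nat (k choose j) * (- 1) ^ j) (f (r, p - real (N * (k - j)), q - real (N * j))))"
proof -
  interpret vector_space s by fact
  let ?c = "\<lambda>j. of_nat (k choose j) * (- 1) ^ j :: complex"
  let ?d = "\<lambda>j. (0, real (N * (k - j)), real (N * j)) :: expo3"
  have "series_mult s (poly_series (x1N_minus_x2N N ^ k)) f (r, p, q)
    = Sum_any (\<lambda>d. \<Sum>j\<le>k. s (if d = ?d j then ?c j else 0) (f ((r, p, q) - d)))"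
    unfolding series_mult_def poly_series_x1N_minus_x2N_power scale_sum_left ..
  also have "\<dots> = (\<Sum>d\<in>?d ` {..k}. \<Sum>j\<le>k. s (if d = ?d j then ?c j else 0) (f ((r, p, q) - d)))"
    by (rule Sum_any.expand_superset) (auto elim!: sum.not_neutral_contains_not_neutral split: if_splits)
  also have "\<dots> = (\<Sum>j\<le>k. \<Sum>d\<in>?d ` {..k}. s (if d = ?d j then ?c j else 0) (f ((r, p, q) - d)))"
    by (rule sum.swap)
  also have "\<dots> = (\<Sum>j\<le>k. s (?c j) (f ((r, p, q) - ?d j)))"
  proof (rule sum.cong[OF refl])
    fix j assume "j \<in> {..k}"
    have "(\<Sum>d\<in>?d ` {..k}. s (if d = ?d j then ?c j else 0) (f ((r, p, q) - d)))
      = (\<Sum>d\<in>?d ` {..k}. if d = ?d j then s (?c j) (f ((r, p, q) - d)) else 0)"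
      by (rule sum.cong) auto
    also have "\<dots> = s (?c j) (f ((r, p, q) - ?d j))"
      using \<open>j \<in> {..k}\<close> by (subst sum.delta) auto
    finally show "(\<Sum>d\<in>?d ` {..k}. s (if d = ?d j then ?c j else 0) (f ((r, p, q) - d)))
      = s (?c j) (f ((r, p, q) - ?d j))" .
  qed
  finally show ?thesis by simp
qed

lemma linear_mapD:
  assumes "Vector_Spaces.linear s1 s2 f"
  shows "f (x + y) = f x + f y" "f (s1 c x) = s2 c (f x)" "f 0 = 0" "f (- x) = - f x"
    "f (x - y) = f x - f y" "f (sum g A) = (\<Sum>a\<in>A. f (g a))"
proof -
  interpret Vector_Spaces.linear s1 s2 f by fact
  show "f (x + y) = f x + f y" "f (s1 c x) = s2 c (f x)" "f 0 = 0" "f (- x) = - f x"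
    "f (x - y) = f x - f y" "f (sum g A) = (\<Sum>a\<in>A. f (g a))"
    by (rule add scale zero neg diff sum)+
qed

lemma linear_mapI:
  assumes "vector_space s1" "vector_space s2"
    and "\<And>x y. f (x + y) = f x + f y" "\<And>c x. f (s1 c x) = s2 c (f x)"
  shows "Vector_Spaces.linear s1 s2 f"
  using assms by (simp add: Vector_Spaces.linear_iff)

lemma linear_Sum_any:
  assumes "Vector_Spaces.linear s1 s2 f" "finite {x. g x \<noteq> 0}"
  shows "f (Sum_any g) = Sum_any (\<lambda>x. f (g x))"
proof -
  have "f (Sum_any g) = (\<Sum>x | g x \<noteq> 0. f (g x))"
    unfolding Sum_any.expand_set by (rule linear_mapD(6)[OF assms(1)])
  also have "\<dots> = Sum_any (\<lambda>x. f (g x))"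
    by (rule Sum_any.expand_superset[symmetric]) (use assms linear_mapD(3)[OF assms(1)] in auto)
  finally show ?thesis .
qed

lemma Sum_any_atMost:
  assumes "\<And>i::nat. i > n \<Longrightarrow> f i = 0"
  shows "Sum_any f = (\<Sum>i\<le>n. f i)"
  by (rule Sum_any.expand_superset) (use assms not_le in auto)

section \<open>Components of the quasi Jacobi identity\<close>

lemma series_mult_delta_finite:
  fixes s :: "complex \<Rightarrow> 'w \<Rightarrow> 'w::ab_group_add" and h :: "nat \<Rightarrow> int"
  assumes ind: "independent_exps C A B" "N > 0"
    and s: "\<And>x. s 0 x = 0" "\<And>k. s k 0 = 0"
    and supp: "\<And>n i. n \<noteq> h i \<Longrightarrow> f (e - delta_exp N C A B n i) = 0"
    and fin: "finite {i. f (e - delta_exp N C A B (h i) i) \<noteq> 0}"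
  shows "finite {d. s (delta_series N \<zeta> C A c B d) (f (e - d)) \<noteq> 0}"
proof (rule finite_subset)
  show "finite ((\<lambda>i. delta_exp N C A B (h i) i) ` {i. f (e - delta_exp N C A B (h i) i) \<noteq> 0})"
    using fin by blast
  show "{d. s (delta_series N \<zeta> C A c B d) (f (e - d)) \<noteq> 0}
    \<subseteq> (\<lambda>i. delta_exp N C A B (h i) i) ` {i. f (e - delta_exp N C A B (h i) i) \<noteq> 0}"
  proof
    fix d assume "d \<in> {d. s (delta_series N \<zeta> C A c B d) (f (e - d)) \<noteq> 0}"
    then have d: "s (delta_series N \<zeta> C A c B d) (f (e - d)) \<noteq> 0" by simp
    then have "delta_series N \<zeta> C A c B d \<noteq> 0" using s(1) by metis
    then obtain n i where d': "d = delta_exp N C A B n i" using delta_series_outside by blast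
    have f: "f (e - d) \<noteq> 0" using d s(2) by metis
    then have "n = h i" using supp d' by blast
    then show "d \<in> (\<lambda>i. delta_exp N C A B (h i) i) ` {i. f (e - delta_exp N C A B (h i) i) \<noteq> 0}"
      using f d' by blast
  qed
qed

text \<open>Additivity of \<open>Sum_any\<close> requires finite supports, so a polynomial factor
  can be expanded inside a delta product once each of its terms is known to give a finite
  sum.\<close>

lemma series_mult_linear_combination:
  fixes J :: "'j set"
  assumes "vector_space s" "finite J"
    and fin: "\<And>j. j \<in> J \<Longrightarrow> finite {d. s (\<delta> d) (f j (e - d)) \<noteq> 0}"
  shows "series_mult s \<delta> (\<lambda>e. \<Sum>j\<in>J. s (c j) (f j e)) e = (\<Sum>j\<in>J. s (c j) (series_mult s \<delta> (f j) e))"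
proof -
  interpret vector_space s by fact
  define D where "D = (\<Union>j\<in>J. {d. s (\<delta> d) (f j (e - d)) \<noteq> 0})"
  have D: "finite D" using assms(2) fin by (auto simp: D_def)
  have ze: "s (\<delta> d) (f j (e - d)) = 0" if "d \<notin> D" "j \<in> J" for d j
    using that by (auto simp: D_def)
  have "series_mult s \<delta> (\<lambda>e. \<Sum>j\<in>J. s (c j) (f j e)) e
    = Sum_any (\<lambda>d. \<Sum>j\<in>J. s (c j) (s (\<delta> d) (f j (e - d))))"
    unfolding series_mult_def by (simp add: scale_sum_right mult.commute)
  also have "\<dots> = (\<Sum>d\<in>D. \<Sum>j\<in>J. s (c j) (s (\<delta> d) (f j (e - d))))"
  proof (rule Sum_any.expand_superset[OF D])
    show "{a. (\<Sum>j\<in>J. s (c j) (s (\<delta> a) (f j (e - a)))) \<noteq> 0} \<subseteq> D"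
      using ze by (auto intro!: sum.neutral simp del: scale_scale)
  qed
  also have "\<dots> = (\<Sum>j\<in>J. \<Sum>d\<in>D. s (c j) (s (\<delta> d) (f j (e - d))))" by (rule sum.swap)
  also have "\<dots> = (\<Sum>j\<in>J. s (c j) (series_mult s \<delta> (f j) e))"
  proof (rule sum.cong[OF refl])
    fix j assume j: "j \<in> J"
    have "Sum_any (\<lambda>d. s (\<delta> d) (f j (e - d))) = (\<Sum>d\<in>D. s (\<delta> d) (f j (e - d)))"
      by (rule Sum_any.expand_superset[OF D]) (use ze j in auto)
    then show "(\<Sum>d\<in>D. s (c j) (s (\<delta> d) (f j (e - d)))) = s (c j) (series_mult s \<delta> (f j) e)"
      by (simp add: series_mult_def scale_sum_right del: scale_scale)
  qed
  finally show ?thesis .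
qed

text \<open>Multiplication by \<open>(x1^N - x2^N)^k\<close> on the coefficients of
  \<open>x1^p x2^q\<close>, with integer exponents.\<close>

definition diff_power_mult ::
  "(complex \<Rightarrow> 'w \<Rightarrow> 'w) \<Rightarrow> nat \<Rightarrow> nat \<Rightarrow> (int \<Rightarrow> int \<Rightarrow> 'w) \<Rightarrow> int \<Rightarrow> int \<Rightarrow> 'w::ab_group_add" where
  "diff_power_mult s N k f p q =
     (\<Sum>j\<le>k. s (of_nat (k choose j) * (- 1) ^ j) (f (p - int (N * (k - j))) (q - int (N * j))))"

lemma vertex_mapD:
  assumes "vertex_map V sW N Y" and "N > 0"
  shows "Vector_Spaces.linear (smul V) sW (\<lambda>v. Y v r w)"
    "Vector_Spaces.linear sW sW (Y v r)"
    "real N * r \<notin> \<int> \<Longrightarrow> Y v r w = 0" "\<exists>b::int. \<forall>r<b. Y v (of_int r / real N) w = 0"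
proof -
  show "Vector_Spaces.linear (smul V) sW (\<lambda>v. Y v r w)"
    "Vector_Spaces.linear sW sW (Y v r)" using assms by (auto simp: vertex_map_def)
  have l: "(\<lambda>r. Y v r w) \<in> laurent_series N" using assms by (auto simp: vertex_map_def)
  then show "real N * r \<notin> \<int> \<Longrightarrow> Y v r w = 0" by (auto simp: laurent_series_def)
  obtain b where b: "\<forall>r<b. Y v r w = 0" using l by (auto simp: laurent_series_def)
  show "\<exists>b::int. \<forall>r<b. Y v (of_int r / real N) w = 0"
  proof -
    have "of_int r / real N < b" if "r < \<lfloor>b * real N\<rfloor>" for r
    proof -
      have "of_int r < b * real N" using that by linarith
      then show ?thesis using assms(2) by (simp add: pos_divide_less_eq)
    qed
    then show ?thesis using b by blast
  qed
qed

text \<open>The coefficient of \<open>x0^(-1-m) x1^p x2^q\<close>. On the left the polynomial is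
  multiplied into the products first. On the right its monomials move the iterate to different
  powers of \<open>x1\<close>, each of which selects different terms of the delta function, so the
  sum over \<open>j\<close> stays outside.\<close>

lemma quasi_jacobi_components:
  fixes V :: "'v::ab_group_add voa" and sW :: "complex \<Rightarrow> 'w::ab_group_add \<Rightarrow> 'w" and m p q :: int
  assumes W: "vector_space sW" and Y: "vertex_map V sW 1 Y"
    and trunc: "\<exists>b::int. \<forall>r<b. vop V u (of_int r) v = 0"
    and qj: "quasi_jacobi V sW Y (x1N_minus_x2N N ^ k) u v"
  shows "Sum_any (\<lambda>i. sW ((of_int m gchoose i) * (- 1) ^ i)
        (diff_power_mult sW N k (\<lambda>p q. Y u (of_int p) (Y v (of_int q) w)) (p - m + int i) (q - int i)))
    - Sum_any (\<lambda>i. sW ((- 1) powi m * ((of_int m gchoose i) * (- 1) ^ i))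
        (diff_power_mult sW N k (\<lambda>p q. Y v (of_int q) (Y u (of_int p) w)) (p - int i) (q - m + int i)))
    = (\<Sum>j\<le>k. sW (of_nat (k choose j) * (- 1) ^ j) (Sum_any (\<lambda>i.
        sW ((of_int (p - int (N * (k - j)) + int i) gchoose i) * (- 1) ^ i)
          (Y (vop V u (of_int (- 1 - m - int i)) v) (of_int (q + 1 + p - int (N * (k - j)) - int (N * j) + int i)) w))))"
proof -
  interpret W: vector_space sW by fact
  interpret scaled sW by unfold_locales simp_all
  note lin = linear_mapD[OF vertex_mapD(1)[OF Y zero_less_one]] linear_mapD[OF vertex_mapD(2)[OF Y zero_less_one]]
  let ?e = "(- 1 - of_int m, of_int p, of_int q) :: expo3"
  let ?P = "series_mult sW (poly_series (x1N_minus_x2N N ^ k))"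
  have P: "?P f (r, p, q) = (\<Sum>j\<le>k. sW (of_nat (k choose j) * (- 1) ^ j)
      (f (r, p - real (N * (k - j)), q - real (N * j))))" for f r p q
    by (rule series_mult_x1N_minus_x2N_power[OF W])
  have 1: "series_mult sW (delta_series 1 1 X0 X1 (- 1) X2) (?P (prod12 Y u v w)) ?e
    = Sum_any (\<lambda>i. sW ((of_int m gchoose i) * (- 1) ^ i)
        (diff_power_mult sW N k (\<lambda>p q. Y u (of_int p) (Y v (of_int q) w)) (p - m + int i) (q - int i)))"
    by (subst delta_012) (simp_all add: P prod12_def diff_power_mult_def algebra_simps)
  have 2: "series_mult sW (delta_series 1 (- 1) X0 X2 (- 1) X1) (?P (prod21 Y u v w)) ?e
    = Sum_any (\<lambda>i. sW ((- 1) powi m * ((of_int m gchoose i) * (- 1) ^ i))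
        (diff_power_mult sW N k (\<lambda>p q. Y v (of_int q) (Y u (of_int p) w)) (p - int i) (q - m + int i)))"
    by (subst delta_021) (simp_all add: P prod21_def diff_power_mult_def algebra_simps)
  let ?f = "\<lambda>j (a, b, c). iterate V Y u v w (a, b - real (N * (k - j)), c - real (N * j))"
  obtain b :: int where b: "\<And>r. r < b \<Longrightarrow> vop V u (of_int r) v = 0" using trunc by blast
  let ?t = "\<lambda>j. int (N * (k - j))"
  \<comment> \<open>Truncation of \<open>Y(u, x0) v\<close> in \<open>x0\<close> bounds
    \<open>i\<close>; this is what permits the interchange of the two sums.\<close>
  have fin: "finite {d. sW (delta_series 1 1 X2 X1 (- 1) X0 d) (?f j (?e - d)) \<noteq> 0}" for j
  proof (rule series_mult_delta_finite[where h = "\<lambda>i. p - ?t j + int i"])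
    fix n :: int and i :: nat assume n: "n \<noteq> p - ?t j + int i"
    have "real_of_int p - (real_of_int n - real i) - real (N * (k - j)) \<noteq> 0"
    proof
      assume "real_of_int p - (real_of_int n - real i) - real (N * (k - j)) = 0"
      then have "real_of_int (p - (n - int i) - ?t j) = 0" by simp
      then show False using n by linarith
    qed
    then show "?f j (?e - delta_exp 1 X2 X1 X0 n i) = 0"
      by (simp add: delta_exp_def iterate_def del: of_nat_mult)
  next
    have "{i. ?f j (?e - delta_exp 1 X2 X1 X0 (p - ?t j + int i) i) \<noteq> 0} \<subseteq> {..nat (- 1 - m - b)}"
    proof
      fix i assume i: "i \<in> {i. ?f j (?e - delta_exp 1 X2 X1 X0 (p - ?t j + int i) i) \<noteq> 0}"
      have "vop V u (of_int (- 1 - m - int i)) v \<noteq> 0"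
      proof
        assume "vop V u (of_int (- 1 - m - int i)) v = 0"
        then show False using i lin(3)
          by (simp add: delta_exp_def iterate_def split: if_splits)
      qed
      then have "\<not> - 1 - m - int i < b" using b by blast
      then show "i \<in> {..nat (- 1 - m - b)}" by simp
    qed
    then show "finite {i. ?f j (?e - delta_exp 1 X2 X1 X0 (p - ?t j + int i) i) \<noteq> 0}"
      by (rule finite_subset) simp
  qed (simp_all add: independent_exps_perms)
  have "?P (iterate V Y u v w) = (\<lambda>e. \<Sum>j\<le>k. sW (of_nat (k choose j) * (- 1) ^ j) (?f j e))"
    by (rule ext) (auto simp: P split: prod.splits)
  then have "series_mult sW (delta_series 1 1 X2 X1 (- 1) X0) (?P (iterate V Y u v w)) ?e
    = (\<Sum>j\<le>k. sW (of_nat (k choose j) * (- 1) ^ j)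
        (series_mult sW (delta_series 1 1 X2 X1 (- 1) X0) (?f j) ?e))"
    by (simp only: series_mult_linear_combination[OF W _ fin] finite_atMost)
  also have "\<dots> = (\<Sum>j\<le>k. sW (of_nat (k choose j) * (- 1) ^ j) (Sum_any (\<lambda>i.
        sW ((of_int (p - ?t j + int i) gchoose i) * (- 1) ^ i)
          (Y (vop V u (of_int (- 1 - m - int i)) v) (of_int (q + 1 + p - ?t j - int (N * j) + int i)) w))))"
  proof (intro sum.cong refl arg_cong[where f = "sW _"])
    fix j
    have "series_mult sW (delta_series 1 1 X2 X1 (- 1) X0) (?f j) ?e = Sum_any (\<lambda>i.
        sW ((of_int (p - ?t j + int i) gchoose i) * (- 1) ^ i)
          (?f j (- 1 - of_int m - real i, of_int (?t j), of_int q + 1 + of_int (p - ?t j) + real i)))"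
      by (rule delta_210) (simp add: iterate_def)
    then show "series_mult sW (delta_series 1 1 X2 X1 (- 1) X0) (?f j) ?e = Sum_any (\<lambda>i.
        sW ((of_int (p - ?t j + int i) gchoose i) * (- 1) ^ i)
          (Y (vop V u (of_int (- 1 - m - int i)) v) (of_int (q + 1 + p - ?t j - int (N * j) + int i)) w))"
      by (simp add: iterate_def algebra_simps)
  qed
  finally show ?thesis
    using qj[unfolded quasi_jacobi_def, rule_format, of w ?e] unfolding 1 2 by simp
qed

lemma sum_swap_triangle:
  fixes f :: "nat \<Rightarrow> nat \<Rightarrow> 'b::comm_monoid_add"
  shows "(\<Sum>p\<le>j. \<Sum>n\<le>j - p. f n p) = (\<Sum>n\<le>j. \<Sum>p\<le>j - n. f n p)"
proof -
  have "(\<Sum>p\<le>j. \<Sum>n\<le>j - p. f n p) = (\<Sum>(p, n)\<in>(SIGMA p:{..j}. {..j - p}). f n p)"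
    by (simp add: sum.Sigma)
  also have "\<dots> = (\<Sum>(n, p)\<in>(SIGMA n:{..j}. {..j - n}). f n p)"
    by (rule sum.reindex_bij_witness[where i = prod.swap and j = prod.swap]) auto
  also have "\<dots> = (\<Sum>n\<le>j. \<Sum>p\<le>j - n. f n p)" by (simp add: sum.Sigma)
  finally show ?thesis .
qed

lemma sum_triangle_diagonal:
  fixes f :: "nat \<Rightarrow> nat \<Rightarrow> 'b::comm_monoid_add"
  shows "(\<Sum>n\<le>j. \<Sum>p\<le>j - n. f n p) = (\<Sum>q\<le>j. \<Sum>n\<le>q. f n (q - n))"
proof -
  have "(\<Sum>n\<le>j. \<Sum>p\<le>j - n. f n p) = (\<Sum>(n, p)\<in>(SIGMA n:{..j}. {..j - n}). f n p)"
    by (simp add: sum.Sigma)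
  also have "\<dots> = (\<Sum>(q, n)\<in>(SIGMA q:{..j}. {..q}). f n (q - n))"
    by (rule sum.reindex_bij_witness[where i = "\<lambda>(q, n). (n, q - n)" and j = "\<lambda>(n, p). (n + p, n)"]) auto
  also have "\<dots> = (\<Sum>q\<le>j. \<Sum>n\<le>q. f n (q - n))" by (simp add: sum.Sigma)
  finally show ?thesis .
qed

text \<open>This is the induction step of Leibniz's formula for divided powers; \<open>sc n\<close> stands for the
  \<open>n\<close>-fold multiple.\<close>

lemma divided_power_sum:
  fixes T :: "nat \<Rightarrow> nat \<Rightarrow> 'b::comm_monoid_add" and sc :: "nat \<Rightarrow> 'b \<Rightarrow> 'b"
  assumes sc: "\<And>m n x. sc (m + n) x = sc m x + sc n x" "\<And>x. sc 0 x = 0"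
  shows "(\<Sum>i\<le>k. sc (Suc i) (T (Suc i) (k - i)) + sc (Suc (k - i)) (T i (Suc (k - i))))
    = (\<Sum>i\<le>Suc k. sc (Suc k) (T i (Suc k - i)))"
proof -
  have "(\<Sum>i\<le>Suc k. sc (Suc k) (T i (Suc k - i)))
    = (\<Sum>i\<le>Suc k. sc i (T i (Suc k - i)) + sc (Suc k - i) (T i (Suc k - i)))"
    by (intro sum.cong refl) (simp flip: sc(1))
  also have "\<dots> = (\<Sum>i\<le>Suc k. sc i (T i (Suc k - i))) + (\<Sum>i\<le>Suc k. sc (Suc k - i) (T i (Suc k - i)))"
    by (rule sum.distrib)
  also have "(\<Sum>i\<le>Suc k. sc i (T i (Suc k - i))) = (\<Sum>i\<le>k. sc (Suc i) (T (Suc i) (k - i)))"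
    by (subst sum.atMost_Suc_shift) (simp add: sc)
  also have "(\<Sum>i\<le>Suc k. sc (Suc k - i) (T i (Suc k - i))) = (\<Sum>i\<le>k. sc (Suc (k - i)) (T i (Suc (k - i))))"
    by (simp add: sc Suc_diff_le)
  finally show ?thesis by (simp add: sum.distrib)
qed

section \<open>The adjoint action of a formal vector field\<close>

abbreviation root_coordinate :: "nat \<Rightarrow> (nat \<Rightarrow> complex) \<Rightarrow> bool" where
  "root_coordinate N a \<equiv>
     exp_vector_field a fps_X = fps_const (1 / of_nat N) * (1 + fps_X) ^ N - fps_const (1 / of_nat N)"

definition field_series :: "(nat \<Rightarrow> complex) \<Rightarrow> complex fps" where
  "field_series a = fps_X * Abs_fps a"

text \<open>\<open>ad_series a b k\<close> is the coefficient function of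
  \<open>ad(X)^k (b d/dt) / k!\<close> for \<open>X = - field_series a d/dt\<close>, because
  \<open>[- f d/dt, b d/dt] = (b f' - f b') d/dt\<close>. With the divided power built in, summing
  over \<open>k\<close> gives \<open>exp(ad X)\<close>.\<close>

primrec ad_series :: "(nat \<Rightarrow> complex) \<Rightarrow> complex fps \<Rightarrow> nat \<Rightarrow> complex fps" where
  "ad_series a b 0 = b"
| "ad_series a b (Suc k) = fps_const (1 / of_nat (Suc k)) *
     (ad_series a b k * fps_deriv (field_series a) - field_series a * fps_deriv (ad_series a b k))"

lemma ad_series_Suc:
  "of_nat (Suc k) * ad_series a b (Suc k) =
     ad_series a b k * fps_deriv (field_series a) - field_series a * fps_deriv (ad_series a b k)"
proof -
  have "(of_nat (Suc k) :: complex fps) * fps_const (1 / of_nat (Suc k)) = 1"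
    unfolding fps_of_nat[symmetric] fps_const_mult[symmetric]
    by (simp only: fps_const_mult) (simp del: of_nat_Suc)
  then show ?thesis by (simp add: mult.assoc[symmetric] del: of_nat_Suc)
qed

lemma fps_X_deriv_nth: "fps_nth (fps_X * fps_deriv f) n = of_nat n * fps_nth f n"
  by (cases n) simp_all

text \<open>When \<open>L(n)\<close> corresponds to \<open>- t^(n+1) d/dt\<close>, the factor
  \<open>2 n + 1 - p = n - (p - n - 1)\<close> is the structure constant of
  \<open>[L(n), L(p - n - 1)]\<close>. In this form the recursion can be matched with commutators of
  Virasoro modes.\<close>

lemma ad_series_Suc_nth:
  "of_nat (Suc k) * fps_nth (ad_series a b (Suc k)) p =
     (\<Sum>n\<le>p. a n * fps_nth (ad_series a b k) (p - n) * of_int (2 * int n + 1 - int p))"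
proof -
  let ?A = "Abs_fps a" and ?b = "ad_series a b k"
  have "of_nat (Suc k) * fps_nth (ad_series a b (Suc k)) p = fps_nth (of_nat (Suc k) * ad_series a b (Suc k)) p"
    by (simp add: fps_of_nat[symmetric] del: of_nat_Suc)
  also have "of_nat (Suc k) * ad_series a b (Suc k) = ?A * ?b + (fps_X * fps_deriv ?A) * ?b - ?A * (fps_X * fps_deriv ?b)"
    unfolding ad_series_Suc field_series_def by (simp add: algebra_simps)
  also have "fps_nth \<dots> p = (\<Sum>n\<le>p. a n * fps_nth ?b (p - n) * of_int (2 * int n + 1 - int p))"
    unfolding fps_sub_nth fps_add_nth fps_mult_nth[of _ "fps_X * _"] fps_mult_nth[of "Abs_fps a"]
      fps_mult_nth[of "fps_X * _" "ad_series _ _ _"] fps_X_deriv_nth atLeast0AtMost fps_nth_Abs_fps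
      sum.distrib[symmetric] sum_subtractf[symmetric]
    by (intro sum.cong refl) (simp add: algebra_simps of_nat_diff)
  finally show ?thesis .
qed

text \<open>With \<open>a 0 = 0\<close> the field starts at \<open>t^2\<close>, so every bracket
  raises the order by at least one. This makes the sum over \<open>k\<close> finite in each
  degree.\<close>

lemma ad_series_low:
  assumes "a 0 = 0"
  shows "p < k \<Longrightarrow> fps_nth (ad_series a b k) p = 0"
proof (induction k arbitrary: p)
  case (Suc k)
  have "a n * fps_nth (ad_series a b k) (p - n) = 0" if "n \<le> p" for n
    using that Suc.prems assms Suc.IH[of "p - n"] by (cases n) auto
  then have "of_nat (Suc k) * fps_nth (ad_series a b (Suc k)) p = 0"
    unfolding ad_series_Suc_nth by (intro sum.neutral) auto
  then show ?case by (simp del: of_nat_Suc)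
qed simp

definition field_power :: "(nat \<Rightarrow> complex) \<Rightarrow> nat \<Rightarrow> complex fps \<Rightarrow> complex fps" where
  "field_power a k f = fps_const (1 / fact k) * (vector_field a ^^ k) f"

lemma vector_field_eq:
  assumes "a 0 = 0"
  shows "vector_field a f = - (field_series a * fps_deriv f)"
proof -
  have "Abs_fps (\<lambda>m. if m \<ge> 2 then a (m - 1) else 0) = field_series a"
    by (rule fps_ext) (use assms in \<open>auto simp: field_series_def intro: arg_cong[where f = a]\<close>)
  then show ?thesis by (simp add: vector_field_def)
qed

lemma vector_field_linear:
  "vector_field a (f + g) = vector_field a f + vector_field a g"
  "vector_field a (sum h A) = (\<Sum>x\<in>A. vector_field a (h x))"
  "vector_field a (fps_const c * f) = fps_const c * vector_field a f"
proof -
  show *: "vector_field a (f + g) = vector_field a f + vector_field a g" for f g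
    by (simp add: vector_field_def algebra_simps)
  have z: "vector_field a 0 = 0" by (simp add: vector_field_def)
  show "vector_field a (sum h A) = (\<Sum>x\<in>A. vector_field a (h x))"
    by (induction A rule: infinite_finite_induct) (simp_all add: * z)
  show "vector_field a (fps_const c * f) = fps_const c * vector_field a f"
    by (simp add: vector_field_def algebra_simps)
qed

lemma field_power_Suc: "of_nat (Suc k) * field_power a (Suc k) f = vector_field a (field_power a k f)"
proof -
  have "(of_nat (Suc k) :: complex fps) * fps_const (1 / fact (Suc k)) = fps_const (1 / fact k)"
    unfolding fps_of_nat[symmetric] by (simp add: fps_const_mult field_simps del: of_nat_Suc)
  then show ?thesis
    by (simp add: field_power_def vector_field_linear mult.assoc[symmetric] del: of_nat_Suc)
qed

text \<open>For \<open>X = vector_field a\<close> and \<open>D = b d/dt\<close> this is the part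
  with \<open>k\<close> factors \<open>X\<close> of \<open>exp(X) D = (exp(ad X) D) exp(X)\<close>,
  applied to \<open>f\<close>.\<close>

lemma field_power_mult_deriv:
  assumes a: "a 0 = 0"
  shows "field_power a k (b * fps_deriv f) = (\<Sum>i\<le>k. ad_series a b i * fps_deriv (field_power a (k - i) f))"
proof (induction k)
  case 0
  then show ?case by (simp add: field_power_def)
next
  case (Suc k)
  let ?T = "\<lambda>i l. ad_series a b i * fps_deriv (field_power a l f)"
  have step: "vector_field a (c * fps_deriv g)
      = (c * fps_deriv (field_series a) - field_series a * fps_deriv c) * fps_deriv g
        + c * fps_deriv (vector_field a g)" for c g
    unfolding vector_field_eq[of a, OF a] by (simp add: algebra_simps)
  have d: "fps_deriv (of_nat n * g) = of_nat n * fps_deriv g" for n and g :: "complex fps"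
    by (simp add: fps_of_nat[symmetric])
  have "of_nat (Suc k) * field_power a (Suc k) (b * fps_deriv f) = vector_field a (\<Sum>i\<le>k. ?T i (k - i))"
    by (simp only: field_power_Suc Suc.IH)
  also have "\<dots> = (\<Sum>i\<le>k. of_nat (Suc i) * ?T (Suc i) (k - i) + of_nat (Suc (k - i)) * ?T i (Suc (k - i)))"
    unfolding vector_field_linear(2)
    by (intro sum.cong refl, subst step, subst ad_series_Suc[symmetric], subst field_power_Suc[symmetric])
      (simp only: d mult_ac)
  also have "\<dots> = (\<Sum>i\<le>Suc k. of_nat (Suc k) * ?T i (Suc k - i))"
    by (rule divided_power_sum) (simp_all add: algebra_simps)
  also have "\<dots> = of_nat (Suc k) * (\<Sum>i\<le>Suc k. ?T i (Suc k - i))" by (simp only: sum_distrib_left)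
  finally show ?case by (simp del: of_nat_Suc sum.atMost_Suc)
qed

text \<open>Apply \<open>exp(X) D = (exp(ad X) D) exp(X)\<close> with
  \<open>D = (1 + N t) d/dt\<close> to the coordinate \<open>t\<close>. With
  \<open>H = exp(X) t\<close> the left side is \<open>1 + N H = (1 + t)^N\<close> and the right side
  is \<open>B H'\<close> with \<open>H' = (1 + t)^(N-1)\<close>, so \<open>B = 1 + t\<close>. The
  shape of \<open>H\<close> is exactly what makes the two fields correspond.\<close>

lemma ad_series_sum:
  assumes a: "a 0 = 0" and N: "N > 0"
    and h: "root_coordinate N a"
  shows "(\<Sum>k\<le>p. fps_nth (ad_series a (1 + of_nat N * fps_X) k) p) = (if p \<le> 1 then 1 else 0)"
proof -
  let ?b = "1 + of_nat N * fps_X :: complex fps"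
  define H where "H = exp_vector_field a fps_X"
  define B where "B = Abs_fps (\<lambda>p. \<Sum>k\<le>p. fps_nth (ad_series a ?b k) p)"
  let ?x = "\<lambda>k. field_power a k fps_X"
  have x0: "fps_nth (?x k) m = 0" if "m \<le> k" for k m
    using that by (simp add: field_power_def vector_field_pow_low)
  have Hx: "fps_nth H m = (\<Sum>k\<le>M. fps_nth (?x k) m)" if "m \<le> Suc M" for m M
  proof -
    have "fps_nth H m = (\<Sum>k<m. fps_nth (?x k) m)"
      by (simp add: H_def exp_vector_field_nth field_power_def)
    also have "\<dots> = (\<Sum>k\<le>M. fps_nth (?x k) m)"
      by (rule sum.mono_neutral_left) (use that x0 in auto)
    finally show ?thesis .
  qed
  have Bx: "fps_nth B m = (\<Sum>k\<le>M. fps_nth (ad_series a ?b k) m)" if "m \<le> M" for m M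
    unfolding B_def fps_nth_Abs_fps by (rule sum.mono_neutral_left) (use that ad_series_low[of a, OF a] in auto)
  have key: "1 + of_nat N * H = B * fps_deriv H"
  proof (rule fps_ext)
    fix m
    \<comment> \<open>Orders add: the first factor starts in degree \<open>i\<close>, the derivative
      in degree \<open>l\<close>. This later allows the triangle \<open>i + l <= m\<close> to be
      completed to a square.\<close>
    have low: "fps_nth (ad_series a ?b i * fps_deriv (?x l)) m = 0" if "m < i + l" for i l
    proof -
      have nz: "fps_nth (ad_series a ?b i) r * fps_nth (fps_deriv (?x l)) (m - r) = 0" if "r \<le> m" for r
      proof (cases "r < i")
        case False
        then have "m - r + 1 \<le> l" using \<open>m < i + l\<close> that by linarith
        then show ?thesis by (simp add: x0)
      qed (simp add: ad_series_low[of a, OF a])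
      show ?thesis unfolding fps_mult_nth by (intro sum.neutral ballI nz) simp
    qed
    have "vector_field a 1 = 0" by (simp add: vector_field_def)
    moreover have "vector_field a 0 = 0" by (simp add: vector_field_def)
    ultimately have v1: "(vector_field a ^^ k) 1 = (if k = 0 then 1 else 0)" for k by (induction k) auto
    have vl: "(vector_field a ^^ k) (f + g) = (vector_field a ^^ k) f + (vector_field a ^^ k) g"
      "(vector_field a ^^ k) (fps_const c * f) = fps_const c * (vector_field a ^^ k) f" for k f g c
      by (induction k) (simp_all add: vector_field_linear)
    have fb: "field_power a k ?b = (if k = 0 then 1 else 0) + of_nat N * ?x k" for k
      unfolding field_power_def fps_of_nat[symmetric] vl v1 by (simp add: algebra_simps)
    have "(\<Sum>k\<le>m. fps_nth (field_power a k ?b) m)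
      = (\<Sum>k\<le>m. (if k = 0 then fps_nth 1 m else 0) + of_nat N * fps_nth (?x k) m)"
      unfolding fb by (intro sum.cong refl) (simp add: fps_of_nat[symmetric])
    also have "\<dots> = fps_nth (1 + of_nat N * H) m"
      by (simp add: sum.distrib sum_distrib_left[symmetric] Hx[of m m] fps_of_nat[symmetric])
    finally have "fps_nth (1 + of_nat N * H) m = (\<Sum>k\<le>m. fps_nth (field_power a k ?b) m)" ..
    also have "\<dots> = (\<Sum>k\<le>m. \<Sum>i\<le>k. fps_nth (ad_series a ?b i * fps_deriv (?x (k - i))) m)"
      using field_power_mult_deriv[of a _ ?b fps_X, OF a] by (simp add: fps_sum_nth)
    also have "\<dots> = (\<Sum>i\<le>m. \<Sum>l\<le>m - i. fps_nth (ad_series a ?b i * fps_deriv (?x l)) m)"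
      by (rule sum_triangle_diagonal[symmetric])
    also have "\<dots> = (\<Sum>i\<le>m. \<Sum>l\<le>m. fps_nth (ad_series a ?b i * fps_deriv (?x l)) m)"
      by (rule sum.cong[OF refl], rule sum.mono_neutral_left) (auto intro!: low)
    also have "\<dots> = fps_nth ((\<Sum>i\<le>m. ad_series a ?b i) * fps_deriv (\<Sum>l\<le>m. ?x l)) m"
      by (simp only: fps_deriv_sum sum_product fps_sum_nth)
    also have "\<dots> = fps_nth (B * fps_deriv H) m"
      unfolding fps_mult_nth
      by (intro sum.cong refl arg_cong2[where f = "(*)"]) (simp_all add: fps_sum_nth Bx[of _ m] Hx[of _ m] del: of_nat_Suc)
    finally show "fps_nth (1 + of_nat N * H) m = fps_nth (B * fps_deriv H) m" .
  qed
  have N1: "fps_const (of_nat N) * fps_const (1 / of_nat N) = (1 :: complex fps)"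
    using N by (simp add: fps_const_mult)
  have "of_nat N * H = (1 + fps_X) ^ N - 1"
    unfolding H_def h right_diff_distrib fps_of_nat[symmetric] mult.assoc[symmetric] N1 by simp
  then have 1: "1 + of_nat N * H = (1 + fps_X) ^ N" by simp
  have dH: "fps_deriv H = (1 + fps_X) ^ (N - 1)"
  proof -
    have "fps_const (of_nat N) * fps_deriv H = fps_deriv (1 + of_nat N * H)" by (simp add: fps_of_nat[symmetric])
    also have "\<dots> = fps_const (of_nat N) * (1 + fps_X) ^ (N - 1)" unfolding 1 by (simp add: fps_deriv_power)
    finally show ?thesis using N by simp
  qed
  have "B * (1 + fps_X) ^ (N - 1) = (1 + fps_X) ^ (N - 1) * (1 + fps_X)"
    using key N unfolding 1 dH by (metis Suc_diff_1 power_Suc2)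
  moreover have "(1 + fps_X :: complex fps) \<noteq> 0"
    by (metis fps_add_nth fps_one_nth fps_X_nth fps_zero_nth add_0_right zero_neq_one)
  ultimately have "B = 1 + fps_X" by (simp add: mult.commute)
  then have "fps_nth B p = (if p \<le> 1 then 1 else 0)" by (auto simp: fps_X_def)
  then show ?thesis by (simp add: B_def)
qed

section \<open>Modes, grading and Virasoro relations on \<open>V\<close>\<close>

context vertex_operator_algebra
begin

abbreviation sV where "sV \<equiv> smul V"

lemmas endo_linearI = linear_mapI[OF vector_space_axioms vector_space_axioms]

definition mode :: "'v \<Rightarrow> int \<Rightarrow> 'v \<Rightarrow> 'v" where "mode u r = vop V u (of_int r)"

lemma mode_linear:
  shows mode_add_left: "mode (u + v) r w = mode u r w + mode v r w"
    and mode_scale_left: "mode (sV c u) r w = sV c (mode u r w)"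
    and mode_zero_left: "mode 0 r w = 0"
    and mode_add: "mode u r (w + w') = mode u r w + mode u r w'"
    and mode_scale: "mode u r (sV c w) = sV c (mode u r w)"
    and mode_zero: "mode u r 0 = 0"
    and mode_diff: "mode u r (w - w') = mode u r w - mode u r w'"
    and mode_sum: "mode u r (sum f A) = (\<Sum>x\<in>A. mode u r (f x))"
  using linear_mapD[OF vertex_mapD(1)[OF vertex_map zero_less_one]]
    linear_mapD[OF vertex_mapD(2)[OF vertex_map zero_less_one]]
  by (simp_all add: mode_def)

lemma mode_truncation: "\<exists>b. \<forall>r<b. mode u r w = 0"
  using vertex_mapD(4)[OF vertex_map zero_less_one, of u w] by (simp add: mode_def)

lemma vop_nonint: "r \<notin> \<int> \<Longrightarrow> vop V u r w = 0"
  using vertex_mapD(3)[OF vertex_map zero_less_one, of r u w] by simp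

lemma Vir_mode: "Vir V n = mode (conf V) (- n - 2)"
  by (simp add: Vir_def mode_def)

lemmas Vir_linear = mode_linear(4-8)[of "conf V" "- n - 2" for n, folded Vir_mode]

lemma mode_creation: "r < 0 \<Longrightarrow> mode u r (vac V) = 0" "mode u 0 (vac V) = u"
  by (simp_all add: mode_def creation_regular creation)

lemma Vir_vac: "n \<ge> - 1 \<Longrightarrow> Vir V n (vac V) = 0"
  by (simp add: Vir_mode mode_creation)

text \<open>The residue in \<open>x0\<close> of the Jacobi identity: at \<open>m = 0\<close> both
  binomial sums on the left collapse to their first terms.\<close>

lemma mode_commutator:
  "mode u p (mode v q w) - mode v q (mode u p w)
    = Sum_any (\<lambda>i. sV ((of_int (p + int i) gchoose i) * (- 1) ^ i) (mode (mode u (- 1 - int i) v) (q + 1 + p + int i) w))"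
proof -
  have gc0: "(0::complex) gchoose i = (if i = 0 then 1 else 0)" for i by (cases i) simp_all
  have S1: "Sum_any (\<lambda>i::nat. sV ((if i = 0 then 1 else 0) * c i) (f i)) = sV (c 0) (f 0)" for c and f :: "nat \<Rightarrow> 'v"
  proof -
    have "Sum_any (\<lambda>i::nat. sV ((if i = 0 then 1 else 0) * c i) (f i)) = (\<Sum>i\<in>{0}. sV ((if i = 0 then 1 else 0) * c i) (f i))"
      by (rule Sum_any.expand_superset) auto
    then show ?thesis by simp
  qed
  have "\<exists>b::int. \<forall>r<b. vop V u (of_int r) v = 0" using mode_truncation by (simp add: mode_def)
  moreover have "quasi_jacobi V (smul V) (vop V) (x1N_minus_x2N 1 ^ 0) u v" using jacobi by simp
  ultimately show ?thesis
    using quasi_jacobi_components[OF vector_space_axioms vertex_map, where u = u and v = v and N = 1 and k = 0 and m = 0 and p = p and q = q and w = w]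
    by (simp add: gc0 S1 diff_power_mult_def mode_def)
qed

text \<open>\<open>L(m-1)\<close> is the coefficient of \<open>x^(-m-1)\<close>, and negating the
  upper index turns the signed binomial coefficient into \<open>m choose i\<close>, which ends the
  sum at \<open>i = m\<close>.\<close>

lemma Vir_commutator:
  "Vir V (int m - 1) (mode u r w) - mode u r (Vir V (int m - 1) w)
    = (\<Sum>i\<le>m. sV (of_nat (m choose i)) (mode (Vir V (int i - 1) u) (r - int m + int i) w))"
proof -
  have b: "(of_int (- int m - 1 + int i) gchoose i) * (- 1) ^ i = (of_nat (m choose i) :: complex)" for i
  proof -
    have "(of_int (- int m - 1 + int i) :: complex) gchoose i = (- 1) ^ i * (of_nat m gchoose i)"
      using gbinomial_negated_upper[of "of_int (- int m - 1 + int i) :: complex" i] by simp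
    then show ?thesis by (simp add: binomial_gbinomial power_mult_distrib[symmetric])
  qed
  have e: "mode (conf V) (- int m - 1) = Vir V (int m - 1)"
    "mode (conf V) (- 1 - int i) = Vir V (int i - 1)"
    "r + 1 + (- int m - 1) + int i = r - int m + int i" for i
    unfolding Vir_mode by (rule arg_cong[where f = "mode (conf V)"], simp)+ simp
  have "Vir V (int m - 1) (mode u r w) - mode u r (Vir V (int m - 1) w)
    = Sum_any (\<lambda>i. sV (of_nat (m choose i)) (mode (Vir V (int i - 1) u) (r - int m + int i) w))"
    using mode_commutator[of "conf V" "- int m - 1" u r w] by (simp only: b e)
  also have "\<dots> = (\<Sum>i\<le>m. sV (of_nat (m choose i)) (mode (Vir V (int i - 1) u) (r - int m + int i) w))"
    by (rule Sum_any_atMost) simp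
  finally show ?thesis .
qed

lemma mode_derivative: "mode (Vir V (- 1) u) r w = sV (of_int (r + 1)) (mode u (r + 1) w)"
  using L_minus1_derivative[of u "of_int r" w] by (simp add: mode_def)

lemma grade_zero: "0 \<in> grade V n"
  using grade_subspace by (rule subspace_0)

lemma grade_closed:
  "u \<in> grade V n \<Longrightarrow> v \<in> grade V n \<Longrightarrow> u + v \<in> grade V n"
  "u \<in> grade V n \<Longrightarrow> sV c u \<in> grade V n"
  "(\<And>x. x \<in> A \<Longrightarrow> f x \<in> grade V n) \<Longrightarrow> sum f A \<in> grade V n"
  using grade_subspace[of n] by (auto intro: subspace_add subspace_scale subspace_sum)

lemma hcomp:
  "hcomp V v n \<in> grade V n" "finite {n. hcomp V v n \<noteq> 0}" "Sum_any (hcomp V v) = v"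
  using theI'[OF grade_direct_sum[of v]] unfolding hcomp_def[symmetric] by blast+

lemma hcomp_unique:
  assumes "\<And>n. f n \<in> grade V n" "finite {n. f n \<noteq> 0}" "Sum_any f = v"
  shows "hcomp V v = f"
  using grade_direct_sum[of v] assms hcomp[of v] by blast

lemma hcomp_grade: "u \<in> grade V n \<Longrightarrow> hcomp V u = (\<lambda>m. if m = n then u else 0)"
proof (rule hcomp_unique)
  show "finite {m. (if m = n then u else 0) \<noteq> 0}"
    by (rule finite_subset[of _ "{n}"]) auto
qed (auto simp: grade_zero)

lemma hcomp_add: "hcomp V (u + v) = (\<lambda>n. hcomp V u n + hcomp V v n)"
proof (rule hcomp_unique)
  show "finite {n. hcomp V u n + hcomp V v n \<noteq> 0}"
    by (rule finite_subset[of _ "{n. hcomp V u n \<noteq> 0} \<union> {n. hcomp V v n \<noteq> 0}"]) (auto simp: hcomp(2))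
  show "Sum_any (\<lambda>n. hcomp V u n + hcomp V v n) = u + v"
    by (simp add: Sum_any.distrib hcomp)
qed (simp add: hcomp grade_closed)

lemma hcomp_scale: "hcomp V (sV c u) = (\<lambda>n. sV c (hcomp V u n))"
proof (rule hcomp_unique)
  show "finite {n. sV c (hcomp V u n) \<noteq> 0}"
    by (rule finite_subset[of _ "{n. hcomp V u n \<noteq> 0}"]) (auto simp: hcomp(2))
  show "Sum_any (\<lambda>n. sV c (hcomp V u n)) = sV c u"
    using linear_Sum_any[OF linear_scale_self hcomp(2), of c u] by (simp add: hcomp)
qed (simp add: hcomp grade_closed)

lemma homogeneous_induct [consumes 0, case_names grade add]:
  assumes "\<And>n u. u \<in> grade V n \<Longrightarrow> P u" and "\<And>u v. P u \<Longrightarrow> P v \<Longrightarrow> P (u + v)"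
  shows "P u"
proof -
  have P0: "P 0" by (rule assms(1)[OF grade_zero])
  have "P (\<Sum>n\<in>A. hcomp V u n)" if "finite A" for A
    using that by induction (auto intro: P0 assms hcomp(1))
  then have "P (Sum_any (hcomp V u))"
    unfolding Sum_any.expand_set using hcomp(2) by blast
  then show ?thesis by (simp add: hcomp)
qed

text \<open>By uniqueness of the decomposition, the components of an eigenvector of
  \<open>L(0)\<close> with the wrong weight vanish. Weights can then be found by computing
  eigenvalues.\<close>

lemma grade_iff: "u \<in> grade V n \<longleftrightarrow> Vir V 0 u = sV (of_int n) u"
proof
  assume e: "Vir V 0 u = sV (of_int n) u"
  have lin: "Vector_Spaces.linear sV sV (Vir V 0)"
    unfolding Vir_def by (rule vertex_mapD(2)[OF vertex_map zero_less_one])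
  have "Sum_any (\<lambda>m. sV (of_int m) (hcomp V u m)) = Sum_any (\<lambda>m. Vir V 0 (hcomp V u m))"
    by (simp add: L0_grade[OF hcomp(1)])
  also have "\<dots> = Vir V 0 u"
    using linear_Sum_any[OF lin hcomp(2)[of u]] by (simp add: hcomp)
  finally have s: "Sum_any (\<lambda>m. sV (of_int m) (hcomp V u m)) = sV (of_int n) u" by (simp add: e)
  have "hcomp V (sV (of_int n) u) = (\<lambda>m. sV (of_int m) (hcomp V u m))"
  proof (rule hcomp_unique[OF _ _ s])
    show "finite {m. sV (of_int m) (hcomp V u m) \<noteq> 0}"
      by (rule finite_subset[of _ "{n. hcomp V u n \<noteq> 0}"]) (auto simp: hcomp(2))
  qed (simp add: hcomp grade_closed)
  then have "sV (of_int n) (hcomp V u m) = sV (of_int m) (hcomp V u m)" for m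
    by (simp add: hcomp_scale fun_eq_iff)
  then have "hcomp V u m = 0" if "m \<noteq> n" for m
    using that by (metis of_int_eq_iff scale_cancel_right)
  then have "Sum_any (hcomp V u) = (\<Sum>m\<in>{n}. hcomp V u m)"
    by (intro Sum_any.expand_superset) auto
  then show "u \<in> grade V n" using hcomp by (metis sum.insert sum.empty add_0_right finite.emptyI empty_iff)
qed (rule L0_grade)

text \<open>Commuting with \<open>L(0)\<close> adds the weight of \<open>u\<close> and, through the
  \<open>L(-1)\<close>-derivative, the exponent \<open>r\<close>. Modes are indexed by powers of
  \<open>x\<close>, hence the plus sign.\<close>

lemma mode_grade:
  assumes "u \<in> grade V n" "w \<in> grade V m"
  shows "mode u r w \<in> grade V (n + m + r)"
proof -
  have "Vir V 0 (mode u r w) - mode u r (Vir V 0 w)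
      = mode (Vir V (- 1) u) (r - 1) w + mode (Vir V 0 u) r w"
    using Vir_commutator[of 1 u r w] by (simp add: numeral_eq_Suc)
  then have "Vir V 0 (mode u r w) = mode u r (Vir V 0 w) + (mode (Vir V (- 1) u) (r - 1) w + mode (Vir V 0 u) r w)"
    by (simp add: algebra_simps)
  then show ?thesis
    unfolding grade_iff L0_grade[OF assms(1)] L0_grade[OF assms(2)] mode_derivative
    by (simp add: mode_scale mode_scale_left scale_left_distrib)
qed

lemma Vir_grade: "u \<in> grade V n \<Longrightarrow> Vir V k u \<in> grade V (n - k)"
  using mode_grade[OF conf_grade, of u n "- k - 2"] by (simp add: Vir_mode)

text \<open>The central term occurs only for \<open>m + n = 0\<close>. Under the two bounds
  \<open>m\<close> is then -1, 0 or 1, where \<open>m^3 - m\<close> vanishes.\<close>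

lemma Vir_bracket:
  assumes "m \<ge> - 1" "n \<ge> - 1"
  shows "Vir V m (Vir V n u) - Vir V n (Vir V m u) = sV (of_int (m - n)) (Vir V (m + n) u)"
proof -
  obtain c where "\<And>m n v. Vir V m (Vir V n v) - Vir V n (Vir V m v)
      = smul V (of_int (m - n)) (Vir V (m + n) v)
        + (if m + n = 0 then smul V (of_int (m ^ 3 - m) / 12 * c) v else 0)"
    using virasoro by blast
  moreover have "m ^ 3 - m = 0" if "m + n = 0"
  proof -
    have "m = - 1 \<or> m = 0 \<or> m = 1" using assms that by linarith
    then show ?thesis by auto
  qed
  ultimately show ?thesis by simp
qed

lemma grade_trivial: "\<exists>b. \<forall>n<b. \<forall>u\<in>grade V n. u = 0"
  using grade_bounded_below by auto

end

section \<open>The exponential of the positive Virasoro modes\<close>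

context vertex_operator_algebra
begin

text \<open>The part of \<open>(sum a n L(n))^k / k!\<close> that lowers weights by
  \<open>j\<close>. Splitting by \<open>j\<close> makes every sum finite before anything is
  exponentiated.\<close>

primrec exp_part :: "(nat \<Rightarrow> complex) \<Rightarrow> nat \<Rightarrow> nat \<Rightarrow> 'v \<Rightarrow> 'v" where
  "exp_part a 0 = (\<lambda>j u. if j = 0 then u else 0)"
| "exp_part a (Suc k) = (\<lambda>j u. sV (1 / of_nat (Suc k)) (\<Sum>n\<le>j. sV (a n) (Vir V (int n) (exp_part a k (j - n) u))))"

text \<open>The member \<open>c p\<close> is regarded as having degree \<open>p\<close>, and
  \<open>ad_part a c k\<close> consists of the graded parts of \<open>ad^k / k!\<close> applied to
  the sum of the \<open>c p\<close>. The degree may be offset from the drop in weight: below,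
  \<open>L(-1)\<close> is placed in degree 0.\<close>

primrec ad_part :: "(nat \<Rightarrow> complex) \<Rightarrow> (nat \<Rightarrow> 'v \<Rightarrow> 'v) \<Rightarrow> nat \<Rightarrow> nat \<Rightarrow> 'v \<Rightarrow> 'v" where
  "ad_part a c 0 = c"
| "ad_part a c (Suc k) = (\<lambda>p w. sV (1 / of_nat (Suc k)) (\<Sum>n\<le>p. sV (a n)
     (Vir V (int n) (ad_part a c k (p - n) w) - ad_part a c k (p - n) (Vir V (int n) w))))"

definition exp_comp :: "(nat \<Rightarrow> complex) \<Rightarrow> nat \<Rightarrow> 'v \<Rightarrow> 'v" where
  "exp_comp a j u = (\<Sum>k\<le>j. exp_part a k j u)"

definition ad_comp :: "(nat \<Rightarrow> complex) \<Rightarrow> (nat \<Rightarrow> 'v \<Rightarrow> 'v) \<Rightarrow> nat \<Rightarrow> 'v \<Rightarrow> 'v" where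
  "ad_comp a c p w = (\<Sum>k\<le>p. ad_part a c k p w)"

lemma exp_part_Suc:
  "sV (of_nat (Suc k)) (exp_part a (Suc k) j u) = (\<Sum>n\<le>j. sV (a n) (Vir V (int n) (exp_part a k (j - n) u)))"
  by (simp del: of_nat_Suc)

lemma ad_part_Suc:
  "sV (of_nat (Suc k)) (ad_part a c (Suc k) p w) = (\<Sum>n\<le>p. sV (a n)
     (Vir V (int n) (ad_part a c k (p - n) w) - ad_part a c k (p - n) (Vir V (int n) w)))"
  by (simp del: of_nat_Suc)

lemma exp_part_low: "a 0 = 0 \<Longrightarrow> j < k \<Longrightarrow> exp_part a k j u = 0"
proof (induction k arbitrary: j)
  case (Suc k)
  have "sV (a n) (Vir V (int n) (exp_part a k (j - n) u)) = 0" if "n \<le> j" for n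
    using that Suc.prems Suc.IH[of "j - n"] by (cases n) (auto simp: Vir_linear)
  then have "(\<Sum>n\<le>j. sV (a n) (Vir V (int n) (exp_part a k (j - n) u))) = 0"
    by (intro sum.neutral) blast
  then show ?case by simp
qed simp

lemma ad_part_low: "a 0 = 0 \<Longrightarrow> p < k \<Longrightarrow> ad_part a c k p w = 0"
proof (induction k arbitrary: p w)
  case (Suc k)
  have "sV (a n) (Vir V (int n) (ad_part a c k (p - n) w) - ad_part a c k (p - n) (Vir V (int n) w)) = 0" if "n \<le> p" for n
    using that Suc.prems Suc.IH[of "p - n"] by (cases n) (auto simp: Vir_linear)
  then have "(\<Sum>n\<le>p. sV (a n) (Vir V (int n) (ad_part a c k (p - n) w) - ad_part a c k (p - n) (Vir V (int n) w))) = 0"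
    by (intro sum.neutral) blast
  then show ?case by simp
qed simp

lemma exp_part_linear: "Vector_Spaces.linear sV sV (exp_part a k j)"
proof (induction k arbitrary: j)
  case 0
  show ?case by (rule endo_linearI) auto
next
  case (Suc k)
  note l = linear_mapD[OF Suc]
  show ?case
    by (rule endo_linearI)
      (auto simp: l Vir_linear sum.distrib scale_right_distrib scale_sum_right mult_ac)
qed

lemma ad_part_linear:
  assumes "\<And>p. Vector_Spaces.linear sV sV (c p)"
  shows "Vector_Spaces.linear sV sV (ad_part a c k p)"
proof (induction k arbitrary: p)
  case (Suc k)
  note l = linear_mapD[OF Suc]
  show ?case
    by (rule endo_linearI)
      (auto simp: l Vir_linear sum.distrib sum_subtractf scale_right_distrib scale_right_diff_distrib scale_sum_right mult_ac)
qed (simp add: assms)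

lemma exp_comp_linear: "Vector_Spaces.linear sV sV (exp_comp a j)"
  by (rule endo_linearI)
    (auto simp: exp_comp_def linear_mapD[OF exp_part_linear] sum.distrib scale_sum_right)

lemmas exp_comp_lin = linear_mapD[OF exp_comp_linear]

lemma exp_part_grade: "u \<in> grade V n \<Longrightarrow> exp_part a k j u \<in> grade V (n - int j)"
proof (induction k arbitrary: j)
  case (Suc k)
  have "Vir V (int i) (exp_part a k (j - i) u) \<in> grade V (n - int j)" if "i \<le> j" for i
    using Vir_grade[OF Suc.IH[OF Suc.prems, of "j - i"], of "int i"] that by (simp add: of_nat_diff)
  then show ?case by (auto intro!: grade_closed)
qed (auto simp: grade_zero)

lemma exp_comp_grade: "u \<in> grade V n \<Longrightarrow> exp_comp a j u \<in> grade V (n - int j)"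
  unfolding exp_comp_def by (intro grade_closed exp_part_grade)

lemma exp_comp_eventually_zero:
  assumes "u \<in> grade V n"
  shows "\<exists>J. \<forall>j>J. exp_comp a j u = 0"
proof -
  obtain b where b: "\<forall>n<b. \<forall>u\<in>grade V n. u = 0" using grade_trivial by blast
  then have "exp_comp a j u = 0" if "j > nat (n - b)" for j
  proof -
    have "n - int j < b" using that by linarith
    then show ?thesis using b exp_comp_grade[OF assms, of a j] by blast
  qed
  then show ?thesis by blast
qed

lemma exp_comp_0: "exp_comp a 0 u = u"
  by (simp add: exp_comp_def)

lemma exp_comp_sum: "a 0 = 0 \<Longrightarrow> j \<le> K \<Longrightarrow> (\<Sum>k\<le>K. exp_part a k j u) = exp_comp a j u"
  unfolding exp_comp_def by (rule sum.mono_neutral_right) (auto simp: exp_part_low)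

lemma ad_comp_sum: "a 0 = 0 \<Longrightarrow> j \<le> K \<Longrightarrow> (\<Sum>k\<le>K. ad_part a c k j u) = ad_comp a c j u"
  unfolding ad_comp_def by (rule sum.mono_neutral_right) (auto simp: ad_part_low)

lemma exp_part_vac: "exp_part a k j (vac V) = (if k = 0 \<and> j = 0 then vac V else 0)"
proof (induction k arbitrary: j)
  case (Suc k)
  then show ?case by (auto intro!: sum.neutral simp: Vir_vac Vir_linear)
qed simp

lemma exp_comp_vac: "exp_comp a j (vac V) = (if j = 0 then vac V else 0)"
  by (auto simp: exp_comp_def exp_part_vac intro!: sum.neutral)

text \<open>Graded form of the expansion of \<open>X^k c / k!\<close> into products of
  \<open>ad(X)^i c / i!\<close> and \<open>X^(k-i) / (k-i)!\<close>, for
  \<open>X = sum a n L(n)\<close>.\<close>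

lemma exp_part_Leibniz:
  assumes c: "\<And>p. Vector_Spaces.linear sV sV (c p)"
  shows "(\<Sum>p\<le>j. exp_part a k (j - p) (c p w)) = (\<Sum>i\<le>k. \<Sum>p\<le>j. ad_part a c i p (exp_part a (k - i) (j - p) w))"
proof (induction k arbitrary: j)
  case 0
  have "(\<Sum>p\<le>j. if j - p = 0 then c p w else 0) = (\<Sum>p\<le>j. c p (if j - p = 0 then w else 0))"
    by (rule sum.cong) (auto simp: linear_mapD[OF c])
  then show ?case by simp
next
  case (Suc k)
  note l = linear_mapD[OF ad_part_linear[of c a, OF c]]
  let ?T = "\<lambda>i l. \<Sum>p\<le>j. ad_part a c i p (exp_part a l (j - p) w)"
  have "sV (of_nat (Suc k)) (\<Sum>p\<le>j. exp_part a (Suc k) (j - p) (c p w))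
    = (\<Sum>p\<le>j. \<Sum>n\<le>j - p. sV (a n) (Vir V (int n) (exp_part a k (j - p - n) (c p w))))"
    unfolding scale_sum_right exp_part_Suc ..
  also have "\<dots> = (\<Sum>n\<le>j. \<Sum>p\<le>j - n. sV (a n) (Vir V (int n) (exp_part a k (j - p - n) (c p w))))"
    by (rule sum_swap_triangle)
  also have "\<dots> = (\<Sum>n\<le>j. sV (a n) (Vir V (int n) (\<Sum>p\<le>j - n. exp_part a k (j - n - p) (c p w))))"
    by (simp add: Vir_linear scale_sum_right add.commute)
  also have "\<dots> = (\<Sum>n\<le>j. \<Sum>i\<le>k. \<Sum>p\<le>j - n. sV (a n) (Vir V (int n) (ad_part a c i p (exp_part a (k - i) (j - n - p) w))))"
    by (simp only: Suc.IH Vir_linear scale_sum_right)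
  also have "\<dots> = (\<Sum>i\<le>k. \<Sum>n\<le>j. \<Sum>p\<le>j - n. sV (a n) (Vir V (int n) (ad_part a c i p (exp_part a (k - i) (j - n - p) w))))"
    by (rule sum.swap)
  \<comment> \<open>Each \<open>L(n)\<close> is moved past \<open>ad_part\<close> as a commutator
    plus the opposite product. The former advances the adjoint factor, the latter the exponential
    factor, with multiplicities \<open>i + 1\<close> and \<open>k - i + 1\<close>.\<close>
  also have "\<dots> = (\<Sum>i\<le>k. sV (of_nat (Suc i)) (?T (Suc i) (k - i)) + sV (of_nat (Suc (k - i))) (?T i (Suc (k - i))))"
  proof (rule sum.cong[OF refl])
    fix i
    let ?E = "exp_part a (k - i)" and ?A = "ad_part a c i"
    have "(\<Sum>n\<le>j. \<Sum>p\<le>j - n. sV (a n) (Vir V (int n) (?A p (?E (j - n - p) w))))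
      = (\<Sum>n\<le>j. \<Sum>p\<le>j - n. sV (a n) (Vir V (int n) (?A p (?E (j - (n + p)) w)) - ?A p (Vir V (int n) (?E (j - (n + p)) w))))
       + (\<Sum>n\<le>j. \<Sum>p\<le>j - n. ?A p (sV (a n) (Vir V (int n) (?E (j - p - n) w))))"
      unfolding sum.distrib[symmetric] by (intro sum.cong refl) (simp add: l scale_right_diff_distrib add.commute)
    also have "(\<Sum>n\<le>j. \<Sum>p\<le>j - n. sV (a n) (Vir V (int n) (?A p (?E (j - (n + p)) w)) - ?A p (Vir V (int n) (?E (j - (n + p)) w))))
      = (\<Sum>q\<le>j. \<Sum>n\<le>q. sV (a n) (Vir V (int n) (?A (q - n) (?E (j - q) w)) - ?A (q - n) (Vir V (int n) (?E (j - q) w))))"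
      unfolding sum_triangle_diagonal by (intro sum.cong refl) simp
    also have "\<dots> = sV (of_nat (Suc i)) (?T (Suc i) (k - i))"
      unfolding scale_sum_right ad_part_Suc ..
    also have "(\<Sum>n\<le>j. \<Sum>p\<le>j - n. ?A p (sV (a n) (Vir V (int n) (?E (j - p - n) w))))
      = (\<Sum>p\<le>j. \<Sum>n\<le>j - p. ?A p (sV (a n) (Vir V (int n) (?E (j - p - n) w))))"
      by (rule sum_swap_triangle)
    also have "\<dots> = (\<Sum>p\<le>j. ?A p (sV (of_nat (Suc (k - i))) (exp_part a (Suc (k - i)) (j - p) w)))"
      unfolding exp_part_Suc l(6) ..
    also have "\<dots> = sV (of_nat (Suc (k - i))) (?T i (Suc (k - i)))"
      unfolding scale_sum_right l(2) ..
    finally show "(\<Sum>n\<le>j. \<Sum>p\<le>j - n. sV (a n) (Vir V (int n) (?A p (?E (j - n - p) w))))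
      = sV (of_nat (Suc i)) (?T (Suc i) (k - i)) + sV (of_nat (Suc (k - i))) (?T i (Suc (k - i)))" .
  qed
  also have "\<dots> = (\<Sum>i\<le>Suc k. sV (of_nat (Suc k)) (?T i (Suc k - i)))"
    by (rule divided_power_sum) (simp_all add: scale_left_distrib)
  finally have "sV (of_nat (Suc k)) (\<Sum>p\<le>j. exp_part a (Suc k) (j - p) (c p w)) = sV (of_nat (Suc k)) (\<Sum>i\<le>Suc k. ?T i (Suc k - i))"
    by (simp only: scale_sum_right)
  then show ?case by (simp only: scale_cancel_left of_nat_eq_0_iff nat.distinct simp_thms)
qed

text \<open>Degree \<open>j\<close> of \<open>exp(X) c = (exp(ad X) c) exp(X)\<close>, which is
  conjugation by \<open>exp(X)\<close> written without an inverse.\<close>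

lemma exp_comp_Leibniz:
  assumes c: "\<And>p. Vector_Spaces.linear sV sV (c p)" and a: "a 0 = 0"
  shows "(\<Sum>p\<le>j. exp_comp a (j - p) (c p w)) = (\<Sum>p\<le>j. ad_comp a c p (exp_comp a (j - p) w))"
proof -
  note l = linear_mapD[OF ad_part_linear[of c a, OF c]]
  have "(\<Sum>p\<le>j. exp_comp a (j - p) (c p w)) = (\<Sum>p\<le>j. \<Sum>k\<le>j. exp_part a k (j - p) (c p w))"
    by (simp add: exp_comp_sum[of a, OF a])
  also have "\<dots> = (\<Sum>k\<le>j. \<Sum>p\<le>j. exp_part a k (j - p) (c p w))" by (rule sum.swap)
  also have "\<dots> = (\<Sum>k\<le>j. \<Sum>i\<le>k. \<Sum>p\<le>j. ad_part a c i p (exp_part a (k - i) (j - p) w))"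
    by (simp only: exp_part_Leibniz[OF c])
  also have "\<dots> = (\<Sum>i\<le>j. \<Sum>l\<le>j - i. \<Sum>p\<le>j. ad_part a c i p (exp_part a l (j - p) w))"
    by (rule sum_triangle_diagonal[symmetric])
  \<comment> \<open>Completing the triangle to a square adds only zeros: an added term has
    \<open>p < i\<close> or \<open>j - p < l\<close>.\<close>
  also have "\<dots> = (\<Sum>i\<le>j. \<Sum>l\<le>j. \<Sum>p\<le>j. ad_part a c i p (exp_part a l (j - p) w))"
  proof (rule sum.cong[OF refl], rule sum.mono_neutral_left, simp, simp, intro ballI sum.neutral)
    fix i l p assume "i \<in> {..j}" "l \<in> {..j} - {..j - i}" "p \<in> {..j}"
    then have "p < i \<or> j - p < l" by auto
    then show "ad_part a c i p (exp_part a l (j - p) w) = 0"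
      by (auto simp: ad_part_low[of a, OF a] exp_part_low[of a, OF a] l)
  qed
  also have "\<dots> = (\<Sum>i\<le>j. \<Sum>p\<le>j. \<Sum>l\<le>j. ad_part a c i p (exp_part a l (j - p) w))"
    by (rule sum.cong[OF refl], rule sum.swap)
  also have "\<dots> = (\<Sum>p\<le>j. \<Sum>i\<le>j. \<Sum>l\<le>j. ad_part a c i p (exp_part a l (j - p) w))"
    by (rule sum.swap)
  also have "\<dots> = (\<Sum>p\<le>j. ad_comp a c p (exp_comp a (j - p) w))"
    by (intro sum.cong refl) (simp add: l(6)[symmetric] exp_comp_sum[of a, OF a] ad_comp_sum[of a, OF a])
  finally show ?thesis .
qed

text \<open>The sum over \<open>j\<close> of these identities is \<open>U (L(-1) + N L(0)) = (L(-1) + L(0)) U\<close> for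
  \<open>U = exp (\<Sum>n\<ge>1. a n L(n))\<close>; on the side of vector fields, the substitution \<open>(1 + z)^N = 1 + N t\<close>
  turns \<open>(1 + N t) d/dt\<close> into \<open>(1 + z) d/dz\<close>.\<close>

lemma exp_comp_Vir_minus1:
  assumes a: "a 0 = 0" and N: "N > 0"
    and h: "root_coordinate N a"
    and u: "u \<in> grade V n"
  shows "exp_comp a 0 (Vir V (- 1) u) = Vir V (- 1) (exp_comp a 0 u)"
    "exp_comp a (Suc j) (Vir V (- 1) u) = Vir V (- 1) (exp_comp a (Suc j) u)
      + sV (of_int ((1 - int N) * n - int j)) (exp_comp a j u)"
proof -
  let ?b = "1 + of_nat N * fps_X :: complex fps"
  \<comment> \<open>The series \<open>1 + N t\<close> with \<open>t^p\<close> replaced by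
    \<open>L(p - 1)\<close>.\<close>
  let ?c = "\<lambda>p w. if p = 0 then Vir V (- 1) w else if p = 1 then sV (of_nat N) (Vir V 0 w) else 0"
  have c: "Vector_Spaces.linear sV sV (?c p)" for p
    by (rule endo_linearI)
      (auto simp: Vir_linear scale_right_distrib mult.commute)
  have ad: "ad_part a ?c k p w = sV (fps_nth (ad_series a ?b k) p) (Vir V (int p - 1) w)" for k p w
  proof (induction k arbitrary: p w)
    case 0
    have "fps_nth ?b p = (if p = 0 then 1 else if p = 1 then of_nat N else 0)"
      by (auto simp: fps_of_nat[symmetric])
    then show ?case by simp
  next
    case (Suc k)
    have "sV (of_nat (Suc k)) (ad_part a ?c (Suc k) p w)
      = (\<Sum>n\<le>p. sV (a n * fps_nth (ad_series a ?b k) (p - n) * of_int (2 * int n + 1 - int p)) (Vir V (int p - 1) w))"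
      unfolding ad_part_Suc
    proof (rule sum.cong[OF refl])
      fix m assume m: "m \<in> {..p}"
      have "Vir V (int m) (Vir V (int (p - m) - 1) w) - Vir V (int (p - m) - 1) (Vir V (int m) w)
        = sV (of_int (2 * int m + 1 - int p)) (Vir V (int p - 1) w)"
      proof -
        have "int m - (int (p - m) - 1) = 2 * int m + 1 - int p" "int m + (int (p - m) - 1) = int p - 1"
          using m by auto
        then show ?thesis using Vir_bracket[of "int m" "int (p - m) - 1" w] by simp
      qed
      then show "sV (a m) (Vir V (int m) (ad_part a ?c k (p - m) w) - ad_part a ?c k (p - m) (Vir V (int m) w))
        = sV (a m * fps_nth (ad_series a ?b k) (p - m) * of_int (2 * int m + 1 - int p)) (Vir V (int p - 1) w)"
        unfolding Suc.IH Vir_linear scale_right_diff_distrib[symmetric] by simp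
    qed
    also have "\<dots> = sV (of_nat (Suc k)) (sV (fps_nth (ad_series a ?b (Suc k)) p) (Vir V (int p - 1) w))"
      by (simp only: scale_scale ad_series_Suc_nth scale_sum_left)
    finally show ?case by (simp only: scale_cancel_left of_nat_eq_0_iff nat.distinct simp_thms)
  qed
  \<comment> \<open>The adjoint series turns \<open>1 + N t\<close> into \<open>1 + t\<close>, so
    only \<open>L(-1)\<close> and \<open>L(0)\<close> survive, now both with coefficient 1.\<close>
  have adc: "ad_comp a ?c p w = (if p \<le> 1 then Vir V (int p - 1) w else 0)" for p w
    unfolding ad_comp_def ad scale_sum_left[symmetric] ad_series_sum[of a, OF a N h] by simp
  have L: "(\<Sum>p\<le>j. exp_comp a (j - p) (?c p u)) = (\<Sum>p\<le>j. if p \<le> 1 then Vir V (int p - 1) (exp_comp a (j - p) u) else 0)" for j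
    using exp_comp_Leibniz[of ?c a j u, OF c a] unfolding adc by simp
  note le = exp_comp_lin[of a]
  show "exp_comp a 0 (Vir V (- 1) u) = Vir V (- 1) (exp_comp a 0 u)" by (simp add: exp_comp_0)
  have s2: "(\<Sum>p\<le>Suc j. f p) = f 0 + f 1" if "\<And>p. p \<ge> 2 \<Longrightarrow> f p = 0" for f :: "nat \<Rightarrow> 'v"
  proof -
    have "(\<Sum>p\<le>Suc j. f p) = (\<Sum>p\<in>{0, 1}. f p)"
      by (rule sum.mono_neutral_right) (use that in auto)
    then show ?thesis by simp
  qed
  have "exp_comp a (Suc j) (Vir V (- 1) u) + sV (of_nat N * of_int n) (exp_comp a j u)
    = Vir V (- 1) (exp_comp a (Suc j) u) + sV (of_int (n - int j)) (exp_comp a j u)"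
    using L[of "Suc j"] by (subst (asm) (1 2) s2) (auto simp: le L0_grade[OF u] L0_grade[OF exp_comp_grade[OF u]])
  then have "exp_comp a (Suc j) (Vir V (- 1) u)
    = Vir V (- 1) (exp_comp a (Suc j) u) + sV (of_int (n - int j)) (exp_comp a j u) - sV (of_nat N * of_int n) (exp_comp a j u)"
    by (simp add: algebra_simps)
  also have "\<dots> = Vir V (- 1) (exp_comp a (Suc j) u) + sV (of_int (n - int j) - of_nat N * of_int n) (exp_comp a j u)"
    by (simp add: scale_left_diff_distrib)
  also have "of_int (n - int j) - of_nat N * of_int n = (of_int ((1 - int N) * n - int j) :: complex)"
    by (simp add: algebra_simps)
  finally show "exp_comp a (Suc j) (Vir V (- 1) u) = Vir V (- 1) (exp_comp a (Suc j) u)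
      + sV (of_int ((1 - int N) * n - int j)) (exp_comp a j u)" .
qed

end

section \<open>Coefficients of the inverse coordinate change\<close>

definition root_series :: "nat \<Rightarrow> complex fps" where
  "root_series N = fps_binomial (1 / of_nat N) - 1"

text \<open>The coefficient of \<open>y^r\<close> in \<open>(1 + y)^e ((1 + y)^(1/N) - 1)^s\<close>.
  With \<open>x0 = x y\<close> the first factor comes from the powers of \<open>x + x0\<close> in
  Delta and the second from the argument \<open>(x + x0)^(1/N) - x^(1/N)\<close> of the vertex
  operator; negative \<open>s\<close> calls for Laurent series.\<close>

definition root_coeff :: "nat \<Rightarrow> complex \<Rightarrow> int \<Rightarrow> int \<Rightarrow> complex" where
  "root_coeff N e s r = fls_nth (fps_to_fls (fps_binomial e) * fps_to_fls (root_series N) powi s) r"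

lemma root_series_nth: "fps_nth (root_series N) 0 = 0" "fps_nth (root_series N) 1 = 1 / of_nat N"
  by (simp_all add: root_series_def)

lemma root_series_nonzero: "N > 0 \<Longrightarrow> root_series N \<noteq> 0"
  using root_series_nth(2)[of N] by auto

lemma subdegree_root_series: "N > 0 \<Longrightarrow> subdegree (root_series N) = 1"
  by (rule subdegreeI) (use root_series_nth[of N] in auto)

lemma fls_deriv_power_int:
  fixes F :: "'a::field_char_0 fls"
  assumes "F \<noteq> 0"
  shows "fls_deriv (F powi s) = of_int s * F powi (s - 1) * fls_deriv F"
proof (induction s rule: int_induct[of _ 0])
  case (step1 s)
  have "F powi (s + 1) = F * F powi s" using assms by (simp add: power_int_add mult.commute)
  moreover have "F * F powi (s - 1) = F powi s" using assms by (simp add: power_int_diff)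
  ultimately show ?case using step1 by (simp add: algebra_simps)
next
  case (step2 s)
  have F: "F powi t = F * F powi (t - 1)" for t
    using assms by (simp add: power_int_diff)
  note e = F[of s] F[of "s - 1"]
  have "fls_deriv F * F powi (s - 1) + F * fls_deriv (F powi (s - 1)) = of_int s * F powi (s - 1) * fls_deriv F"
    using step2 by (metis e(1) fls_deriv_mult add.commute)
  then have "F * fls_deriv (F powi (s - 1)) = of_int (s - 1) * F powi (s - 1) * fls_deriv F"
    by (simp add: algebra_simps)
  also have "\<dots> = F * (of_int (s - 1) * F powi (s - 1 - 1) * fls_deriv F)"
    by (subst e(2)) (simp only: mult_ac)
  finally show ?case using assms by simp
qed simp

lemma fps_binomial_deriv_shift: "fps_deriv (fps_binomial c) = fps_const c * fps_binomial (c - 1)"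
  for c :: "'a::field_char_0"
proof -
  have "fps_binomial c = fps_binomial (c - 1) * (1 + fps_X)"
    using fps_binomial_add_mult[of "c - 1" 1] by (simp add: fps_binomial_1)
  moreover have "(1 + fps_X :: 'a fps) \<noteq> 0"
    by (metis fps_add_nth fps_one_nth fps_X_nth fps_zero_nth add_0_right zero_neq_one)
  ultimately show ?thesis unfolding fps_binomial_deriv by (simp add: mult.assoc[symmetric])
qed

lemma root_coeff_deriv:
  assumes N: "N > 0"
  shows "of_int r * root_coeff N e s r = e * root_coeff N (e - 1) s (r - 1)
    + of_int s / of_nat N * root_coeff N (e + 1 / of_nat N - 1) (s - 1) (r - 1)"
proof -
  let ?G = "fps_to_fls (root_series N)" and ?B = "\<lambda>e. fps_to_fls (fps_binomial e) :: complex fls"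
  have nz: "?G \<noteq> 0" using root_series_nonzero[OF N] by simp
  have dG: "fls_deriv ?G = fls_const (1 / of_nat N) * ?B (1 / of_nat N - 1)"
    by (simp add: fls_deriv_fps_to_fls root_series_def fps_binomial_deriv_shift fls_times_fps_to_fls)
  have dB: "fls_deriv (?B e) = fls_const e * ?B (e - 1)"
    by (simp add: fls_deriv_fps_to_fls fps_binomial_deriv_shift fls_times_fps_to_fls)
  have BB: "?B e * ?B (1 / of_nat N - 1) = ?B (e + 1 / of_nat N - 1)"
    unfolding fls_times_fps_to_fls[symmetric] fps_binomial_add_mult[symmetric] by (simp add: algebra_simps)
  have "fls_deriv (?B e * ?G powi s) = ?B e * (of_int s * ?G powi (s - 1) * fls_deriv ?G) + fls_deriv (?B e) * ?G powi s"
    using fls_deriv_power_int[OF nz, of s] by simp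
  also have "\<dots> = fls_const e * (?B (e - 1) * ?G powi s)
      + fls_const (of_int s / of_nat N) * (?B (e + 1 / of_nat N - 1) * ?G powi (s - 1))"
  proof -
    have "(of_int s :: complex fls) * fls_const (1 / of_nat N) = fls_const (of_int s / of_nat N)"
      by (simp add: fls_of_int fls_const_mult_const)
    then show ?thesis unfolding dG dB BB[symmetric] by (simp add: mult_ac)
  qed
  finally have eq: "fls_deriv (?B e * ?G powi s) = fls_const e * (?B (e - 1) * ?G powi s)
      + fls_const (of_int s / of_nat N) * (?B (e + 1 / of_nat N - 1) * ?G powi (s - 1))" .
  have "of_int r * root_coeff N e s r = fls_nth (fls_deriv (?B e * ?G powi s)) (r - 1)"
    by (simp add: root_coeff_def del: fls_deriv_mult)
  then show ?thesis unfolding eq by (simp add: root_coeff_def)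
qed

text \<open>Write \<open>(1 + y)^(1/N) - 1 = (y/N) (1 + \<tau>)\<close>. The power \<open>s\<close>
  contributes \<open>N^(-s)\<close> and \<open>(1 + \<tau>)^s\<close>, whose coefficients are
  polynomial in \<open>s\<close>. The point is that \<open>\<kappa>\<close> does not depend on
  \<open>s\<close>: this is why the coefficients of the conjugated operator can be absorbed into a
  field.\<close>

lemma root_coeff_expand:
  assumes N: "N > 0"
  shows "\<exists>\<kappa>. \<forall>s. root_coeff N e s (s + int d)
    = (1 / of_nat N) powi s * (\<Sum>l\<le>d. (of_int s gchoose l) * \<kappa> l)"
proof -
  define \<tau> where "\<tau> = fps_const (of_nat N) * fps_shift 1 (root_series N) - 1"
  have \<tau>0: "fps_nth \<tau> 0 = 0" using N root_series_nth(2)[of N] by (simp add: \<tau>_def)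
  have "root_series N = fps_shift 1 (root_series N) * fps_X"
    using subdegree_decompose[of "root_series N"] subdegree_root_series[OF N] by simp
  also have "fps_shift 1 (root_series N) = fps_const (1 / of_nat N) * (1 + \<tau>)"
    using N by (simp add: \<tau>_def mult.assoc[symmetric])
  finally have g: "fps_to_fls (root_series N) = fls_const (1 / of_nat N) * (fls_X * fps_to_fls (1 + \<tau>))"
    by (simp only: fls_times_fps_to_fls fps_const_to_fls fps_X_to_fls mult_ac)
  have \<tau>s: "fps_to_fls (1 + \<tau>) powi s = fps_to_fls (fps_binomial (of_int s) oo \<tau>)" for s
  proof (cases "\<tau> = 0")
    \<comment> \<open>This happens for \<open>N = 1\<close>, where the coordinate change is the
      identity.\<close>
    case True
    have "fps_binomial (of_int s :: complex) oo 0 = 1"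
      by (rule fps_ext) (simp add: fps_compose_nth power_0_left if_distrib[where f = "\<lambda>f. fps_nth f _"] cong: if_cong)
    then show ?thesis by (simp add: True)
  next
    case False
    have "fls_compose_fps ((1 + fls_X) powi s) \<tau> = fls_compose_fps (1 + fls_X) \<tau> powi s"
      by (rule fls_compose_fps_powi) (use False \<tau>0 in auto)
    also have "fls_compose_fps (1 + fls_X) \<tau> = fps_to_fls (1 + \<tau>)"
      using False \<tau>0 by (simp add: fls_compose_fps_add)
    finally show ?thesis
      unfolding one_plus_fls_X_powi_eq using False \<tau>0 by simp
  qed
  define \<kappa> where "\<kappa> l = fps_nth (fps_binomial e * \<tau> ^ l) d" for l
  have "root_coeff N e s (s + int d) = (1 / of_nat N) powi s * (\<Sum>l\<le>d. (of_int s gchoose l) * \<kappa> l)" for s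
  proof -
    have "fps_to_fls (fps_binomial e) * fps_to_fls (root_series N) powi s
      = fls_const ((1 / of_nat N) powi s) * (fls_X_intpow s * fps_to_fls (fps_binomial e * (fps_binomial (of_int s) oo \<tau>)))"
      unfolding g power_int_mult_distrib \<tau>s fls_const_power_int fls_X_power_int fls_times_fps_to_fls
      by (simp only: mult_ac)
    then have "root_coeff N e s (s + int d)
      = (1 / of_nat N) powi s * fps_nth (fps_binomial e * (fps_binomial (of_int s) oo \<tau>)) d"
      by (simp add: root_coeff_def fls_X_intpow_times_conv_shift)
    also have "fps_nth (fps_binomial e * (fps_binomial (of_int s) oo \<tau>)) d = (\<Sum>l\<le>d. (of_int s gchoose l) * \<kappa> l)"
    proof -
      have "fps_nth (fps_binomial (of_int s) oo \<tau>) n = (\<Sum>l\<le>d. (of_int s gchoose l) * fps_nth (\<tau> ^ l) n)" if "n \<le> d" for n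
        unfolding fps_compose_nth atLeast0AtMost fps_binomial_nth
        by (rule sum.mono_neutral_left) (use that startsby_zero_power_prefix[OF \<tau>0] in auto)
      then have "fps_nth (fps_binomial e * (fps_binomial (of_int s) oo \<tau>)) d
        = (\<Sum>i=0..d. fps_nth (fps_binomial e) i * (\<Sum>l\<le>d. (of_int s gchoose l) * fps_nth (\<tau> ^ l) (d - i)))"
        unfolding fps_mult_nth by (intro sum.cong refl) simp
      also have "\<dots> = (\<Sum>i=0..d. \<Sum>l\<le>d. (of_int s gchoose l) * (fps_nth (fps_binomial e) i * fps_nth (\<tau> ^ l) (d - i)))"
        by (simp only: sum_distrib_left mult_ac)
      also have "\<dots> = (\<Sum>l\<le>d. \<Sum>i=0..d. (of_int s gchoose l) * (fps_nth (fps_binomial e) i * fps_nth (\<tau> ^ l) (d - i)))"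
        by (rule sum.swap)
      also have "\<dots> = (\<Sum>l\<le>d. (of_int s gchoose l) * \<kappa> l)"
        by (simp only: \<kappa>_def fps_mult_nth sum_distrib_left)
      finally show ?thesis .
    qed
    finally show ?thesis .
  qed
  then show ?thesis by blast
qed

lemma root_coeff_low: "N > 0 \<Longrightarrow> r < s \<Longrightarrow> root_coeff N e s r = 0"
proof -
  assume N: "N > 0" and "r < s"
  let ?G = "fps_to_fls (root_series N)" and ?B = "fps_to_fls (fps_binomial e) :: complex fls"
  have "fps_nth (fps_binomial e) 0 \<noteq> 0" by simp
  then have "fps_binomial e \<noteq> 0" by (metis fps_zero_nth)
  then have "?B * ?G powi s \<noteq> 0" using root_series_nonzero[OF N] by simp
  then have "fls_subdegree (?B * ?G powi s) = fls_subdegree ?B + s * fls_subdegree ?G" by simp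
  moreover have "fls_subdegree ?G = 1" using subdegree_root_series[OF N] by (simp add: fls_subdegree_fls_to_fps)
  moreover have "fls_subdegree ?B \<ge> 0" by (simp add: fls_subdegree_fls_to_fps)
  ultimately show ?thesis using \<open>r < s\<close> by (simp add: root_coeff_def fls_eq0_below_subdegree)
qed

lemma root_coeff_0: "root_coeff N e 0 0 = 1"
  by (simp add: root_coeff_def)

section \<open>Conjugation of vertex operators\<close>

context vertex_operator_algebra
begin

text \<open>Coefficients of \<open>Y(f(x), x)\<close> for a polynomial \<open>f\<close> with values
  in \<open>V\<close>; \<open>single\<close> is \<open>x^m Y(u, x)\<close>. The class is closed
  under commutators with \<open>L(n)\<close>, \<open>n >= 0\<close>, and under factors polynomial in
  the mode index, yet small enough for its members to be determined by their action on the
  vacuum.\<close>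

inductive is_field :: "(int \<Rightarrow> 'v \<Rightarrow> 'v) \<Rightarrow> bool" where
  single: "is_field (\<lambda>r w. mode u (r - int m) w)"
| add: "is_field F \<Longrightarrow> is_field G \<Longrightarrow> is_field (\<lambda>r w. F r w + G r w)"

lemma is_field_scale: "is_field F \<Longrightarrow> is_field (\<lambda>r w. sV c (F r w))"
proof (induction rule: is_field.induct)
  case (single u m)
  then show ?case using is_field.single[of "sV c u" m] by (simp add: mode_scale_left)
next
  case (add F G)
  then show ?case using is_field.add by (simp add: scale_right_distrib)
qed

lemma is_field_zero: "is_field (\<lambda>r w. 0)"
  using is_field.single[of 0 0] by (simp add: mode_zero_left)

lemma is_field_diff: "is_field F \<Longrightarrow> is_field G \<Longrightarrow> is_field (\<lambda>r w. F r w - G r w)"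
  using is_field.add[OF _ is_field_scale[of G "- 1"], of F] by simp

lemma is_field_sum: "(\<And>x. x \<in> A \<Longrightarrow> is_field (F x)) \<Longrightarrow> is_field (\<lambda>r w. \<Sum>x\<in>A. F x r w)"
  by (induction A rule: infinite_finite_induct) (auto intro: is_field_zero is_field.add)

text \<open>The factor \<open>r\<close> on the coefficient of \<open>x^r\<close> is
  \<open>x d/dx\<close>, and \<open>d/dx Y(u, x) = Y(L(-1) u, x)\<close>; the prefactor
  \<open>x^m\<close> adds \<open>m\<close> times the original field.\<close>

lemma is_field_index: "is_field F \<Longrightarrow> is_field (\<lambda>r w. sV (of_int r) (F r w))"
proof (induction rule: is_field.induct)
  case (single u m)
  have "sV (of_int r) (mode u (r - int m) w)
    = mode (Vir V (- 1) u) (r - int (Suc m)) w + sV (of_nat m) (mode u (r - int m) w)" for r w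
  proof -
    have "r - int (Suc m) + 1 = r - int m" by simp
    then show ?thesis by (simp only: mode_derivative scale_left_distrib[symmetric]) simp
  qed
  then show ?case
    using is_field.add[OF is_field.single[of "Vir V (- 1) u" "Suc m"] is_field_scale[OF is_field.single[of u m], of "of_nat m"]]
    by (simp only:)
next
  case (add F G)
  then show ?case using is_field.add by (simp add: scale_right_distrib)
qed

lemma is_field_gchoose: "is_field (\<lambda>r w. sV (of_int (r - int d) gchoose l) (mode u (r - int d) w))"
proof (induction l)
  case 0
  then show ?case using is_field.single[of u d] by simp
next
  case (Suc l)
  let ?F = "\<lambda>r w. sV (of_int (r - int d) gchoose l) (mode u (r - int d) w)"
  have "(a gchoose Suc l) = 1 / of_nat (Suc l) * ((a - of_nat l) * (a gchoose l))" for a :: complex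
  proof -
    have "of_nat (Suc l) * (a gchoose Suc l) = (a - of_nat l) * (a gchoose l)"
      using gbinomial_mult_1[of a l] by (simp add: algebra_simps)
    then show ?thesis by (metis mult.commute nonzero_eq_divide_eq of_nat_eq_0_iff nat.distinct(1) times_divide_eq_left mult_1)
  qed
  then have sc: "(of_int (r - int d) gchoose Suc l) = (1 / of_nat (Suc l) * (of_int r * (of_int (r - int d) gchoose l)
      - of_nat (d + l) * (of_int (r - int d) gchoose l)) :: complex)" for r
    by (simp only:) (simp add: algebra_simps del: of_nat_Suc)
  have "sV (of_int (r - int d) gchoose Suc l) (mode u (r - int d) w)
    = sV (1 / of_nat (Suc l)) (sV (of_int r) (?F r w) - sV (of_nat (d + l)) (?F r w))" for r w
    by (simp only: sc scale_scale scale_left_diff_distrib[symmetric])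
  then show ?case
    using is_field_scale[OF is_field_diff[OF is_field_index[OF Suc] is_field_scale[OF Suc]]] by (simp only:)
qed

text \<open>\<open>[L(n), Y(u, x)]\<close> is a combination of
  \<open>x^(n+1-i) Y(L(i-1) u, x)\<close> with \<open>i <= n + 1\<close>, so no negative powers of
  \<open>x\<close> arise.\<close>

lemma is_field_commutator: "is_field F \<Longrightarrow> is_field (\<lambda>r w. Vir V (int n) (F r w) - F r (Vir V (int n) w))"
proof (induction rule: is_field.induct)
  case (single u m)
  have "is_field (\<lambda>r w. \<Sum>i\<le>Suc n. sV (of_nat (Suc n choose i)) (mode (Vir V (int i - 1) u) (r - int (m + (Suc n - i))) w))"
    by (intro is_field_sum is_field_scale is_field.single)
  moreover have "Vir V (int n) (mode u (r - int m) w) - mode u (r - int m) (Vir V (int n) w)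
    = (\<Sum>i\<le>Suc n. sV (of_nat (Suc n choose i)) (mode (Vir V (int i - 1) u) (r - int (m + (Suc n - i))) w))" for r w
  proof -
    have "r - int m - int (Suc n) + int i = r - int (m + (Suc n - i))" if "i \<le> Suc n" for i
      using that by (simp add: of_nat_diff)
    then have "(\<Sum>i\<le>Suc n. sV (of_nat (Suc n choose i)) (mode (Vir V (int i - 1) u) (r - int m - int (Suc n) + int i) w))
      = (\<Sum>i\<le>Suc n. sV (of_nat (Suc n choose i)) (mode (Vir V (int i - 1) u) (r - int (m + (Suc n - i))) w))"
      by (intro sum.cong refl) (simp only: atMost_iff)
    moreover have "int (Suc n) - 1 = int n" by simp
    ultimately show ?thesis using Vir_commutator[of "Suc n" u "r - int m" w] by (simp only:)
  qed
  ultimately show ?case by (simp only:)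
next
  case (add F G)
  have "Vir V (int n) (F r w + G r w) - (F r (Vir V (int n) w) + G r (Vir V (int n) w))
    = (Vir V (int n) (F r w) - F r (Vir V (int n) w)) + (Vir V (int n) (G r w) - G r (Vir V (int n) w))" for r w
    by (simp add: Vir_linear)
  then show ?case using is_field.add[OF add.IH] by (simp only:)
qed

lemma is_field_normal_form:
  "is_field F \<Longrightarrow> \<exists>f M. (\<forall>m>M. f m = 0) \<and> (\<forall>r w. F r w = (\<Sum>m\<le>M. mode (f m) (r - int m) w))"
proof (induction rule: is_field.induct)
  case (single u m)
  have "(\<Sum>m'\<le>m. mode (if m' = m then u else 0) (r - int m') w) = mode u (r - int m) w" for r w
  proof -
    have "(\<Sum>m'\<le>m. mode (if m' = m then u else 0) (r - int m') w) = (\<Sum>m'\<le>m. if m' = m then mode u (r - int m') w else 0)"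
      by (rule sum.cong) (auto simp: mode_zero_left)
    then show ?thesis by simp
  qed
  then show ?case by (intro exI[of _ "\<lambda>m'. if m' = m then u else 0"] exI[of _ m]) auto
next
  case (add F G)
  obtain f M g M' where f: "\<forall>m>M. f m = 0" "\<And>r w. F r w = (\<Sum>m\<le>M. mode (f m) (r - int m) w)"
    and g: "\<forall>m>M'. g m = 0" "\<And>r w. G r w = (\<Sum>m\<le>M'. mode (g m) (r - int m) w)"
    using add.IH by blast
  have "F r w = (\<Sum>m\<le>max M M'. mode (f m) (r - int m) w)" for r w
    unfolding f(2) by (rule sum.mono_neutral_left) (use f(1) in \<open>auto simp: mode_zero_left\<close>)
  moreover have "G r w = (\<Sum>m\<le>max M M'. mode (g m) (r - int m) w)" for r w
    unfolding g(2) by (rule sum.mono_neutral_left) (use g(1) in \<open>auto simp: mode_zero_left\<close>)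
  ultimately have "F r w + G r w = (\<Sum>m\<le>max M M'. mode (f m + g m) (r - int m) w)" for r w
    by (simp add: mode_add_left sum.distrib)
  moreover have "\<forall>m>max M M'. f m + g m = 0" using f(1) g(1) by simp
  ultimately show ?case by (intro exI[of _ "\<lambda>m. f m + g m"] exI[of _ "max M M'"]) auto
qed

text \<open>The constant term of \<open>Y(f, x) 1\<close> is \<open>f\<close>, so the coefficients can be read off from the action on
  the vacuum one after the other.\<close>

lemma is_field_eq_zero:
  assumes "is_field F" and vac: "\<And>r. F r (vac V) = 0"
  shows "F r w = 0"
proof -
  obtain f M where f: "\<forall>m>M. f m = 0" and F: "\<And>r w. F r w = (\<Sum>m\<le>M. mode (f m) (r - int m) w)"
    using is_field_normal_form[OF assms(1)] by blast
  have "f m = 0" for m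
  proof (induction m rule: less_induct)
    case (less m)
    show ?case
    proof (cases "m \<le> M")
      case True
      have "(\<Sum>m'\<le>M. mode (f m') (int m - int m') (vac V)) = (\<Sum>m'\<in>{m}. mode (f m') (int m - int m') (vac V))"
      proof (rule sum.mono_neutral_right)
        show "\<forall>m'\<in>{..M} - {m}. mode (f m') (int m - int m') (vac V) = 0"
        proof
          fix m' assume "m' \<in> {..M} - {m}"
          then have "m' < m \<or> int m - int m' < 0" by auto
          then show "mode (f m') (int m - int m') (vac V) = 0"
            using less mode_creation(1) by (auto simp: mode_zero_left)
        qed
      qed (use True in auto)
      then show ?thesis using vac[of "int m"] by (simp add: F mode_creation)
    qed (use f in auto)
  qed
  then show ?thesis by (simp add: F mode_zero_left)
qed

text \<open>For \<open>u\<close> of weight \<open>n\<close>, the terms of \<open>\<Delta>_N(z^N) u\<close> are \<open>N^(-n) z^(weight_exp N n i)\<close> times the part of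
  \<open>exp (\<Sum>j\<ge>1. a j L(j)) u\<close> of weight \<open>n - i\<close>, which is \<open>exp_comp a i u\<close>.\<close>

definition weight_exp :: "nat \<Rightarrow> int \<Rightarrow> nat \<Rightarrow> int" where
  "weight_exp N n i = (1 - int N) * n - int i"

text \<open>The degree \<open>p\<close> part of the conjugate of \<open>mode u r\<close> by
  \<open>exp (sum a n L(n))\<close>, as the conjugation formula predicts it. A term loses weight
  \<open>i\<close> in \<open>u\<close> and \<open>p - i\<close> through the mode index. The factor
  \<open>N^r\<close> is what remains of the powers \<open>N^(-L(0))\<close> on \<open>u\<close>,
  \<open>v\<close> and \<open>Y(u, x0) v\<close>.\<close>

definition conj_part :: "nat \<Rightarrow> (nat \<Rightarrow> complex) \<Rightarrow> 'v \<Rightarrow> int \<Rightarrow> nat \<Rightarrow> int \<Rightarrow> 'v \<Rightarrow> 'v" where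
  "conj_part N a u n p r w = sV (of_nat N powi r) (\<Sum>i\<le>p.
     sV (root_coeff N (of_int (weight_exp N n i) / of_nat N) (r - int (p - i)) r)
       (mode (exp_comp a i u) (r - int (p - i)) w))"

text \<open>\<open>N^r\<close> and the factor \<open>N^(-(r-d))\<close> of the root coefficient
  combine to the constant \<open>N^d\<close>; the rest is polynomial in the mode index.\<close>

lemma conj_part_is_field:
  assumes N: "N > 0"
  shows "is_field (conj_part N a u n p)"
proof -
  have "is_field (\<lambda>r w. sV (of_nat N powi r) (sV (root_coeff N e (r - int d) r) (mode b (r - int d) w)))" for e d b
  proof -
    obtain \<kappa> where \<kappa>: "\<And>s. root_coeff N e s (s + int d)
      = (1 / of_nat N) powi s * (\<Sum>l\<le>d. (of_int s gchoose l) * \<kappa> l)"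
      using root_coeff_expand[OF N] by metis
    have "sV (of_nat N powi r) (sV (root_coeff N e (r - int d) r) (mode b (r - int d) w))
      = sV (of_nat N ^ d) (\<Sum>l\<le>d. sV (\<kappa> l) (sV (of_int (r - int d) gchoose l) (mode b (r - int d) w)))" for r w
    proof -
      have "of_nat N powi r * (1 / of_nat N) powi (r - int d) = (of_nat N ^ d :: complex)"
        using N by (simp add: power_int_diff power_int_divide_distrib)
      then have "of_nat N powi r * root_coeff N e (r - int d) r
        = of_nat N ^ d * (\<Sum>l\<le>d. (of_int (r - int d) gchoose l) * \<kappa> l)"
        using \<kappa>[of "r - int d"] by (simp add: mult.assoc[symmetric])
      then show ?thesis by (simp add: scale_sum_left[symmetric] mult.commute)
    qed
    moreover have "is_field (\<lambda>r w. sV (of_nat N ^ d) (\<Sum>l\<le>d. sV (\<kappa> l) (sV (of_int (r - int d) gchoose l) (mode b (r - int d) w))))"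
      by (intro is_field_scale is_field_sum is_field_gchoose)
    ultimately show ?thesis by (simp only:)
  qed
  then show ?thesis unfolding conj_part_def[abs_def] scale_sum_right by (intro is_field_sum)
qed

text \<open>Since \<open>L(-1)\<close> acts as \<open>d/dx\<close> on vertex operators, this reduces to the differential equation of
  \<open>(1 + y)^e ((1 + y)^(1/N) - 1)^s\<close>.\<close>

lemma conj_part_Vir_minus1:
  assumes a: "a 0 = 0" and N: "N > 0"
    and h: "root_coordinate N a"
    and u: "u \<in> grade V n"
  shows "conj_part N a (Vir V (- 1) u) (n + 1) p r w = sV (of_int (r + 1)) (conj_part N a u n p (r + 1) w)"
proof -
  define e where "e n i = (of_int (weight_exp N n i) / of_nat N :: complex)" for n i
  define S where "S i = r + 1 - int (p - i)" for i
  define M where "M i = mode (exp_comp a i u) (S i) w" for i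
  \<comment> \<open>\<open>A i\<close> comes from differentiating the vertex operator of
    \<open>exp_comp a i u\<close>, \<open>B i\<close> from the correction term in commuting the
    exponential with \<open>L(-1)\<close>. The correction appears one index later, which is the
    shift repaired below.\<close>
  define A where "A i = root_coeff N (e (n + 1) i) (S i - 1) r * of_int (S i)" for i
  define B where "B i = root_coeff N (e (n + 1) (Suc i)) (S i) r * of_int (weight_exp N n i)" for i
  have eN: "e n i - 1 = e (n + 1) (Suc i)" "e n i + 1 / of_nat N - 1 = e (n + 1) i"
    "of_nat N * e n i = of_int (weight_exp N n i)" for i
    using N by (simp_all add: e_def weight_exp_def field_simps)
  have c: "of_nat N * (of_int (r + 1) * root_coeff N (e n i) (S i) (r + 1)) = A i + B i" for i
  proof -
    have "of_nat N * (of_int (r + 1) * root_coeff N (e n i) (S i) (r + 1))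
      = (of_nat N * e n i) * root_coeff N (e (n + 1) (Suc i)) (S i) r
        + (of_nat N * (of_int (S i) / of_nat N)) * root_coeff N (e (n + 1) i) (S i - 1) r"
      unfolding root_coeff_deriv[OF N, of "r + 1"] eN(1,2) by (simp only: distrib_left mult.assoc add_diff_cancel_right')
    then show ?thesis using N unfolding eN(3) A_def B_def by simp
  qed
  \<comment> \<open>The last correction would belong to the index \<open>p + 1\<close> outside the
    sum; its exponent \<open>r\<close> lies below the order \<open>r + 1\<close> of the power of the
    root series.\<close>
  have Bp: "B p = 0" by (simp add: B_def S_def root_coeff_low[OF N])
  have T0: "sV (root_coeff N (e (n + 1) 0) (S 0 - 1) r) (mode (exp_comp a 0 (Vir V (- 1) u)) (S 0 - 1) w) = sV (A 0) (M 0)"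
    by (simp add: exp_comp_Vir_minus1[of a, OF a N h u] mode_derivative A_def M_def)
  have TS: "sV (root_coeff N (e (n + 1) (Suc i)) (S (Suc i) - 1) r) (mode (exp_comp a (Suc i) (Vir V (- 1) u)) (S (Suc i) - 1) w)
    = sV (A (Suc i)) (M (Suc i)) + sV (B i) (M i)" if "i < p" for i
  proof -
    have "S (Suc i) = S i + 1" using that by (simp add: S_def of_nat_diff)
    then show ?thesis
      by (simp add: exp_comp_Vir_minus1[of a, OF a N h u] mode_derivative mode_add_left mode_scale_left
        A_def B_def M_def weight_exp_def scale_right_distrib)
  qed
  have "(\<Sum>i\<le>p. sV (root_coeff N (e (n + 1) i) (S i - 1) r) (mode (exp_comp a i (Vir V (- 1) u)) (S i - 1) w))
    = (\<Sum>i\<le>p. sV (A i) (M i) + sV (B i) (M i))"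
  proof (cases p)
    case 0
    then show ?thesis using T0 Bp by simp
  next
    case (Suc p')
    have "(\<Sum>i\<le>p. sV (root_coeff N (e (n + 1) i) (S i - 1) r) (mode (exp_comp a i (Vir V (- 1) u)) (S i - 1) w))
      = sV (A 0) (M 0) + (\<Sum>i\<le>p'. sV (A (Suc i)) (M (Suc i)) + sV (B i) (M i))"
      unfolding Suc sum.atMost_Suc_shift T0
      by (intro arg_cong2[where f = "(+)"] refl sum.cong TS) (simp add: Suc)
    also have "\<dots> = (\<Sum>i\<le>p. sV (A i) (M i)) + (\<Sum>i\<le>p'. sV (B i) (M i))"
      unfolding Suc sum.atMost_Suc_shift[of "\<lambda>i. sV (A i) (M i)"] by (simp add: sum.distrib)
    also have "(\<Sum>i\<le>p'. sV (B i) (M i)) = (\<Sum>i\<le>p. sV (B i) (M i))"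
      using Bp by (simp add: Suc)
    finally show ?thesis by (simp add: sum.distrib)
  qed
  also have "\<dots> = sV (of_nat N * of_int (r + 1)) (\<Sum>i\<le>p. sV (root_coeff N (e n i) (S i) (r + 1)) (M i))"
    unfolding scale_sum_right scale_scale scale_left_distrib[symmetric] c[symmetric] by (simp only: mult.assoc)
  finally have main: "(\<Sum>i\<le>p. sV (root_coeff N (e (n + 1) i) (S i - 1) r) (mode (exp_comp a i (Vir V (- 1) u)) (S i - 1) w))
    = sV (of_nat N * of_int (r + 1)) (\<Sum>i\<le>p. sV (root_coeff N (e n i) (S i) (r + 1)) (M i))" .
  have S1: "r - int (p - i) = S i - 1" "r + 1 - int (p - i) = S i" for i by (simp_all add: S_def)
  have Nr: "of_nat N powi r * (of_nat N * of_int (r + 1)) = of_int (r + 1) * (of_nat N powi (r + 1) :: complex)"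
    using N by (simp add: power_int_add)
  show ?thesis
    unfolding conj_part_def S1 e_def[symmetric] M_def[symmetric] main
    by (simp only: scale_scale Nr)
qed

lemma exp_comp_creation:
  assumes a: "a 0 = 0" and N: "N > 0"
    and h: "root_coordinate N a"
    and u: "u \<in> grade V n"
  shows "exp_comp a p (mode u r (vac V)) = conj_part N a u n p r (vac V)"
proof (cases "r < 0")
  case True
  then have "r - int (p - i) < 0" for i by linarith
  then show ?thesis using True
    by (simp add: conj_part_def mode_creation exp_comp_lin(3))
next
  case False
  have "exp_comp a p (mode u (int r) (vac V)) = conj_part N a u n p (int r) (vac V)" for r
    using u
  proof (induction r arbitrary: u n)
    case 0
    \<comment> \<open>Modes of negative index annihilate the vacuum, so only \<open>i = p\<close>
      contributes.\<close>
    have "(\<Sum>i\<le>p. sV (root_coeff N (of_int (weight_exp N n i) / of_nat N) (0 - int (p - i)) 0)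
       (mode (exp_comp a i u) (0 - int (p - i)) (vac V)))
      = (\<Sum>i\<in>{p}. sV (root_coeff N (of_int (weight_exp N n i) / of_nat N) (0 - int (p - i)) 0)
       (mode (exp_comp a i u) (0 - int (p - i)) (vac V)))"
    proof (rule sum.mono_neutral_right)
      show "\<forall>i\<in>{..p} - {p}. sV (root_coeff N (of_int (weight_exp N n i) / of_nat N) (0 - int (p - i)) 0)
         (mode (exp_comp a i u) (0 - int (p - i)) (vac V)) = 0"
        by (auto simp: mode_creation)
    qed auto
    then show ?case by (simp add: conj_part_def mode_creation root_coeff_0)
  next
    case (Suc r)
    \<comment> \<open>Raising the exponent by one costs a factor \<open>r + 1\<close> and replaces
      \<open>u\<close> by \<open>L(-1) u\<close> of weight \<open>n + 1\<close>; hence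
      \<open>u\<close> and \<open>n\<close> vary in the induction.\<close>
    have Lu: "Vir V (- 1) u \<in> grade V (n + 1)" using Vir_grade[OF Suc.prems, of "- 1"] by simp
    have "sV (of_int (int r + 1)) (exp_comp a p (mode u (int r + 1) (vac V)))
      = exp_comp a p (mode (Vir V (- 1) u) (int r) (vac V))"
      by (simp only: mode_derivative exp_comp_lin(2))
    also have "\<dots> = conj_part N a (Vir V (- 1) u) (n + 1) p (int r) (vac V)"
      by (rule Suc.IH[OF Lu])
    also have "\<dots> = sV (of_int (int r + 1)) (conj_part N a u n p (int r + 1) (vac V))"
      by (rule conj_part_Vir_minus1[of a, OF a N h Suc.prems])
    finally have "sV (of_int (int r + 1)) (exp_comp a p (mode u (int r + 1) (vac V)))
      = sV (of_int (int r + 1)) (conj_part N a u n p (int r + 1) (vac V))" .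
    moreover have "(of_int (int r + 1) :: complex) \<noteq> 0" using of_int_eq_0_iff[where 'a = complex, of "int r + 1"] by simp
    moreover have "int (Suc r) = int r + 1" by simp
    ultimately show ?case by (simp only: scale_cancel_left simp_thms)
  qed
  from this[of "nat r"] show ?thesis using False by simp
qed

theorem exp_comp_mode:
  assumes a: "a 0 = 0" and N: "N > 0"
    and h: "root_coordinate N a"
    and u: "u \<in> grade V n"
  shows "exp_comp a j (mode u r w) = (\<Sum>p\<le>j. conj_part N a u n p r (exp_comp a (j - p) w))"
proof -
  \<comment> \<open>The mode as a family concentrated in degree 0, so that the Leibniz identity
    describes its conjugate.\<close>
  define c where "c r = (\<lambda>p::nat. if p = 0 then mode u r else (\<lambda>_. 0))" for r
  have c: "Vector_Spaces.linear sV sV (c r p)" for r p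
    by (rule endo_linearI) (auto simp: c_def mode_linear)
  have L: "exp_comp a j (mode u r w) = (\<Sum>p\<le>j. ad_comp a (c r) p (exp_comp a (j - p) w))" for j r w
  proof -
    have "(\<Sum>p\<le>j. exp_comp a (j - p) (c r p w)) = (\<Sum>p\<in>{0}. exp_comp a (j - p) (c r p w))"
      by (rule sum.mono_neutral_right) (auto simp: c_def exp_comp_lin)
    then show ?thesis using exp_comp_Leibniz[of "c r" a j w, OF c a] by (simp add: c_def)
  qed
  have part: "is_field (\<lambda>r w. ad_part a (c r) k p w)" for k p
  proof (induction k arbitrary: p)
    case 0
    show ?case using is_field.single[of u 0] is_field_zero by (cases "p = 0") (auto simp: c_def)
  next
    case (Suc k)
    show ?case unfolding ad_part.simps
      by (intro is_field_scale is_field_sum is_field_commutator Suc)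
  qed
  have ad: "is_field (\<lambda>r w. ad_comp a (c r) p w)" for p
    unfolding ad_comp_def by (intro is_field_sum part)
  \<comment> \<open>The exponential fixes the vacuum, so on it the Leibniz sum has the single term
    \<open>q = p\<close>.\<close>
  have "ad_comp a (c r) p (vac V) = conj_part N a u n p r (vac V)" for p r
  proof -
    have l: "ad_comp a (c r) p 0 = 0" for p r
      by (simp add: ad_comp_def linear_mapD(3)[OF ad_part_linear[of "c r" a, OF c]])
    have "(\<Sum>q\<le>p. ad_comp a (c r) q (exp_comp a (p - q) (vac V)))
      = (\<Sum>q\<in>{p}. ad_comp a (c r) q (exp_comp a (p - q) (vac V)))"
      by (rule sum.mono_neutral_right) (auto simp: exp_comp_vac l)
    then show ?thesis using L[of p r "vac V"] exp_comp_creation[of a, OF a N h u, of p r] by (simp add: exp_comp_vac)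
  qed
  then have "ad_comp a (c r) p w - conj_part N a u n p r w = 0" for p r w
    using is_field_eq_zero[OF is_field_diff[OF ad[of p] conj_part_is_field[OF N, of a u n p]]] by simp
  then show ?thesis unfolding L by simp
qed

end

section \<open>Scalar formal distributions in one variable\<close>

text \<open>In a fixed total degree the exponents of \<open>y = z1/z2\<close> in
  \<open>Y(u, z1) Y(v, z2) w\<close> are bounded above, because \<open>v\<close> acts first; in the
  opposite order they are bounded below.\<close>

definition bounded_above :: "(int \<Rightarrow> complex) \<Rightarrow> bool" where
  "bounded_above f \<longleftrightarrow> (\<exists>b. \<forall>h>b. f h = 0)"

definition bounded_below :: "(int \<Rightarrow> complex) \<Rightarrow> bool" where
  "bounded_below f \<longleftrightarrow> (\<exists>b. \<forall>h<b. f h = 0)"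

definition poly_act :: "complex poly \<Rightarrow> (int \<Rightarrow> complex) \<Rightarrow> int \<Rightarrow> complex" where
  "poly_act p f h = (\<Sum>i\<le>degree p. Polynomial.coeff p i * f (h - int i))"

text \<open>\<open>x1^N - x2^N\<close> with \<open>x2\<close> set to 1, as is possible in a fixed
  total degree.\<close>

definition diff_poly :: "nat \<Rightarrow> complex poly" where
  "diff_poly N = Polynomial.monom 1 N - 1"

abbreviation diff_act :: "nat \<Rightarrow> nat \<Rightarrow> (int \<Rightarrow> complex) \<Rightarrow> int \<Rightarrow> complex" where
  "diff_act N k \<equiv> poly_act (diff_poly N ^ k)"

lemma poly_act_bound:
  assumes "degree p \<le> n"
  shows "poly_act p f h = (\<Sum>i\<le>n. Polynomial.coeff p i * f (h - int i))"
  unfolding poly_act_def by (rule sum.mono_neutral_left) (use assms in \<open>auto simp: coeff_eq_0\<close>)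

lemma poly_act_add: "poly_act (p + q) f h = poly_act p f h + poly_act q f h"
proof -
  let ?n = "max (degree p) (degree q)"
  have "poly_act (p + q) f h = (\<Sum>i\<le>?n. Polynomial.coeff (p + q) i * f (h - int i))"
    by (rule poly_act_bound) (rule degree_add_le_max)
  then show ?thesis
    by (simp add: poly_act_bound[of p ?n] poly_act_bound[of q ?n] distrib_right sum.distrib)
qed

lemma poly_act_0: "poly_act 0 f h = 0"
  by (simp add: poly_act_def)

lemma poly_act_sum: "poly_act (sum p A) f h = (\<Sum>x\<in>A. poly_act (p x) f h)"
  by (induction A rule: infinite_finite_induct) (simp_all add: poly_act_add poly_act_0)

lemma poly_act_monom: "poly_act (Polynomial.monom c n) f h = c * f (h - int n)"
proof -
  have "poly_act (Polynomial.monom c n) f h = (\<Sum>i\<le>n. Polynomial.coeff (Polynomial.monom c n) i * f (h - int i))"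
    by (rule poly_act_bound) (rule degree_monom_le)
  also have "\<dots> = (\<Sum>i\<le>n. if i = n then c * f (h - int i) else 0)" by (rule sum.cong) auto
  finally show ?thesis by simp
qed

lemma poly_act_smult: "poly_act (smult c p) f h = c * poly_act p f h"
  using poly_act_bound[OF degree_smult_le, of c p f h] by (simp add: poly_act_def sum_distrib_left mult.assoc)

lemma poly_act_uminus: "poly_act (- p) f h = - poly_act p f h"
  by (simp add: poly_act_def sum_negf)

lemma poly_act_diff: "poly_act (p - q) f h = poly_act p f h - poly_act q f h"
  using poly_act_add[of p "- q" f h] by (simp add: poly_act_uminus)

lemma poly_act_1: "poly_act 1 f = f"
  by (rule ext) (simp add: poly_act_def)

lemma poly_act_pCons: "poly_act (pCons c p) f h = c * f h + poly_act p f (h - 1)"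
proof -
  have "poly_act (pCons c p) f h = (\<Sum>i\<le>Suc (degree p). Polynomial.coeff (pCons c p) i * f (h - int i))"
    by (rule poly_act_bound) (rule degree_pCons_le)
  then show ?thesis unfolding sum.atMost_Suc_shift by (simp add: poly_act_def algebra_simps)
qed

lemma poly_act_mult: "poly_act (p * q) f = poly_act p (poly_act q f)"
proof (induction p)
  case (pCons c p)
  show ?case
    by (rule ext) (simp add: poly_act_add poly_act_smult poly_act_pCons pCons.IH)
qed (simp add: fun_eq_iff poly_act_0)

lemma poly_act_diff_poly: "poly_act (diff_poly N) f h = f (h - int N) - f h"
  by (simp add: diff_poly_def poly_act_diff poly_act_monom poly_act_1)

lemma poly_act_diff_poly_power:
  "diff_act N k f h = (\<Sum>j\<le>k. of_nat (k choose j) * (- 1) ^ j * f (h - int (N * (k - j))))"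
proof -
  have e: "((- 1) ^ j :: complex poly) = [:(- 1) ^ j:]" for j
    by (induction j) (simp_all add: one_pCons)
  have m: "Polynomial.monom (1 :: complex) N ^ j = Polynomial.monom 1 (N * j)" for j
    by (simp add: monom_power)
  have "diff_poly N ^ k = (- 1 + Polynomial.monom 1 N) ^ k" by (simp add: diff_poly_def)
  also have "\<dots> = (\<Sum>j\<le>k. of_nat (k choose j) * (- 1) ^ j * Polynomial.monom 1 N ^ (k - j))"
    by (rule binomial_ring)
  also have "\<dots> = (\<Sum>j\<le>k. smult (of_nat (k choose j) * (- 1) ^ j) (Polynomial.monom 1 (N * (k - j))))"
    unfolding m e by (intro sum.cong refl) (simp add: of_nat_poly mult.assoc mult.commute)
  finally show ?thesis by (simp add: poly_act_sum poly_act_smult poly_act_monom)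
qed

lemma poly_act_bounded_above: "bounded_above f \<Longrightarrow> bounded_above (poly_act p f)"
proof -
  assume "bounded_above f"
  then obtain b where b: "\<And>h. h > b \<Longrightarrow> f h = 0" by (auto simp: bounded_above_def)
  have "poly_act p f h = 0" if "h > b + int (degree p)" for h
    unfolding poly_act_def by (intro sum.neutral ballI) (use that b in auto)
  then show ?thesis by (auto simp: bounded_above_def)
qed

lemma poly_act_bounded_below: "bounded_below f \<Longrightarrow> bounded_below (poly_act p f)"
proof -
  assume "bounded_below f"
  then obtain b where b: "\<And>h. h < b \<Longrightarrow> f h = 0" by (auto simp: bounded_below_def)
  have "poly_act p f h = 0" if "h < b" for h
    unfolding poly_act_def by (intro sum.neutral ballI) (use that b in auto)
  then show ?thesis by (auto simp: bounded_below_def)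
qed

lemma bounded_finite: "bounded_above f \<Longrightarrow> bounded_below f \<Longrightarrow> finite {h. f h \<noteq> 0}"
proof -
  assume "bounded_above f" "bounded_below f"
  then obtain b c where "\<And>h. h > b \<Longrightarrow> f h = 0" "\<And>h. h < c \<Longrightarrow> f h = 0"
    by (auto simp: bounded_above_def bounded_below_def)
  then have "{h. f h \<noteq> 0} \<subseteq> {c..b}" by (metis (mono_tags) atLeastAtMost_iff mem_Collect_eq not_le subsetI)
  then show ?thesis by (rule finite_subset) simp
qed

text \<open>The product of a series in \<open>y\<close> with \<open>(y^N - 1)^m\<close>, where \<open>(y^N - 1)^m\<close> is expanded
  in powers of \<open>1/y\<close> and of \<open>y\<close>, respectively.\<close>

definition expand_inf :: "nat \<Rightarrow> int \<Rightarrow> (int \<Rightarrow> complex) \<Rightarrow> int \<Rightarrow> complex" where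
  "expand_inf N m f p = Sum_any (\<lambda>i::nat. (of_int m gchoose i) * (- 1) ^ i * f (p - int N * (m - int i)))"

definition expand_zero :: "nat \<Rightarrow> int \<Rightarrow> (int \<Rightarrow> complex) \<Rightarrow> int \<Rightarrow> complex" where
  "expand_zero N m f p = Sum_any (\<lambda>i::nat. (- 1) powi m * ((of_int m gchoose i) * (- 1) ^ i) * f (p - int N * int i))"

lemma finite_support_atMost:
  assumes "\<And>i::nat. i > M \<Longrightarrow> F i = 0"
  shows "finite {i. F i \<noteq> 0}"
  by (rule finite_subset[of _ "{..M}"]) (use assms not_le in auto)

text \<open>Pascal's rule and a shift of the index, that is
  \<open>(1 - T)^(x+1) = (1 - T)^x (1 - T)\<close> for the shift \<open>T\<close>.\<close>

lemma pascal_sum: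
  fixes t :: "nat \<Rightarrow> complex"
  assumes "\<And>i. i > M \<Longrightarrow> t i = 0"
  shows "Sum_any (\<lambda>i. ((x + 1) gchoose i) * (- 1) ^ i * t i) = Sum_any (\<lambda>i. (x gchoose i) * (- 1) ^ i * (t i - t (Suc i)))"
proof -
  let ?c = "\<lambda>i. (x gchoose i) * (- 1) ^ i"
  have "Sum_any (\<lambda>i. ((x + 1) gchoose i) * (- 1) ^ i * t i) = (\<Sum>i\<le>Suc M. ((x + 1) gchoose i) * (- 1) ^ i * t i)"
    by (rule Sum_any_atMost) (simp add: assms)
  also have "\<dots> = t 0 + (\<Sum>i\<le>M. ?c (Suc i) * t (Suc i) - ?c i * t (Suc i))"
  proof -
    have "((x + 1) gchoose Suc i) * (- 1) ^ Suc i * y = ?c (Suc i) * y - ?c i * y" for i y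
    proof -
      have "(a + b) * (- 1 * s) * y = b * (- 1 * s) * y - a * s * y" for a b s :: complex
        by (simp add: ring_distribs)
      then show ?thesis unfolding gbinomial_Suc_Suc power_Suc .
    qed
    then show ?thesis unfolding sum.atMost_Suc_shift by simp
  qed
  also have "\<dots> = (t 0 + (\<Sum>i\<le>M. ?c (Suc i) * t (Suc i))) - (\<Sum>i\<le>M. ?c i * t (Suc i))"
    by (simp add: sum_subtractf)
  also have "t 0 + (\<Sum>i\<le>M. ?c (Suc i) * t (Suc i)) = (\<Sum>i\<le>Suc M. ?c i * t i)"
    unfolding sum.atMost_Suc_shift by simp
  also have "(\<Sum>i\<le>Suc M. ?c i * t i) = (\<Sum>i\<le>M. ?c i * t i)" by (simp add: assms)
  also have "(\<Sum>i\<le>M. ?c i * t i) - (\<Sum>i\<le>M. ?c i * t (Suc i)) = (\<Sum>i\<le>M. ?c i * (t i - t (Suc i)))"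
    by (simp add: sum_subtractf right_diff_distrib)
  also have "\<dots> = Sum_any (\<lambda>i. ?c i * (t i - t (Suc i)))"
    by (rule Sum_any_atMost[symmetric]) (simp add: assms)
  finally show ?thesis .
qed

lemma expand_inf_step:
  assumes N: "N > 0" and f: "bounded_above f"
  shows "expand_inf N (m + 1) f = expand_inf N m (poly_act (diff_poly N) f)"
proof
  fix p
  obtain b where b: "\<And>h. h > b \<Longrightarrow> f h = 0" using f by (auto simp: bounded_above_def)
  let ?t = "\<lambda>i::nat. f (p - int N * (m + 1 - int i))"
  have z: "?t i = 0" if "i > nat (b - p + int N * (m + 1))" for i
  proof (rule b)
    have "int N * int i \<ge> int i" using N by (simp add: mult_le_cancel_right1)
    moreover have "int N * (m + 1 - int i) = int N * (m + 1) - int N * int i" by (rule right_diff_distrib)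
    ultimately show "b < p - int N * (m + 1 - int i)" using that by linarith
  qed
  have "expand_inf N (m + 1) f p = Sum_any (\<lambda>i. (of_int m gchoose i) * (- 1) ^ i * (?t i - ?t (Suc i)))"
    using pascal_sum[of _ ?t "of_int m", OF z] by (simp add: expand_inf_def)
  also have "\<dots> = expand_inf N m (poly_act (diff_poly N) f) p"
    unfolding expand_inf_def poly_act_diff_poly by (simp add: algebra_simps)
  finally show "expand_inf N (m + 1) f p = expand_inf N m (poly_act (diff_poly N) f) p" .
qed

lemma expand_zero_step:
  assumes N: "N > 0" and f: "bounded_below f"
  shows "expand_zero N (m + 1) f = expand_zero N m (poly_act (diff_poly N) f)"
proof
  fix p
  obtain b where b: "\<And>h. h < b \<Longrightarrow> f h = 0" using f by (auto simp: bounded_below_def)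
  let ?t = "\<lambda>i::nat. f (p - int N * int i)"
  let ?s = "(- 1) powi m :: complex"
  have z: "?t i = 0" if "i > nat (p - b)" for i
  proof (rule b)
    have "int N * int i \<ge> int i" using N by (simp add: mult_le_cancel_right1)
    then show "p - int N * int i < b" using that by linarith
  qed
  have fin: "finite {i. (of_int m gchoose i) * (- 1) ^ i * (?t i - ?t (Suc i)) \<noteq> (0::complex)}"
  proof (rule finite_support_atMost)
    fix i assume "i > nat (p - b)"
    then have "?t i = 0" "?t (Suc i) = 0" using z[of i] z[of "Suc i"] by simp_all
    then show "(of_int m gchoose i) * (- 1) ^ i * (?t i - ?t (Suc i)) = (0::complex)" by simp
  qed
  have fin': "finite {i. (of_int (m + 1) gchoose i) * (- 1) ^ i * ?t i \<noteq> (0::complex)}"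
    by (rule finite_support_atMost[of "nat (p - b)"]) (simp add: z)
  have "expand_zero N (m + 1) f p = - ?s * Sum_any (\<lambda>i. (of_int (m + 1) gchoose i) * (- 1) ^ i * ?t i)"
    unfolding Sum_any_right_distrib[OF fin'] expand_zero_def by (simp add: power_int_add mult.assoc)
  also have "Sum_any (\<lambda>i. (of_int (m + 1) gchoose i) * (- 1) ^ i * ?t i)
      = Sum_any (\<lambda>i. (of_int m gchoose i) * (- 1) ^ i * (?t i - ?t (Suc i)))"
    using pascal_sum[of _ ?t "of_int m", OF z] by simp
  also have "- ?s * \<dots> = expand_zero N m (poly_act (diff_poly N) f) p"
    unfolding Sum_any_right_distrib[OF fin] expand_zero_def poly_act_diff_poly by (simp add: algebra_simps)
  finally show "expand_zero N (m + 1) f p = expand_zero N m (poly_act (diff_poly N) f) p" .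
qed

text \<open>Trades a factor \<open>(y^N - 1)^k\<close> of the series for \<open>k\<close> in the
  exponent, also at negative \<open>m\<close>. Boundedness on the proper side keeps all sums
  finite.\<close>

lemma expand_power:
  assumes N: "N > 0"
  shows "bounded_above f \<Longrightarrow> expand_inf N (m + int k) f = expand_inf N m (diff_act N k f)"
    and "bounded_below f \<Longrightarrow> expand_zero N (m + int k) f = expand_zero N m (diff_act N k f)"
proof (induction k arbitrary: f)
  case (Suc k)
  have e: "m + int (Suc k) = m + int k + 1" by simp
  have p: "poly_act (diff_poly N ^ Suc k) f = diff_act N k (poly_act (diff_poly N) f)" for f
    by (simp only: power_Suc2 poly_act_mult)
  {
    case 1
    then show ?case unfolding e p expand_inf_step[OF N 1] by (rule Suc.IH(1)[OF poly_act_bounded_above])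
  next
    case 2
    then show ?case unfolding e p expand_zero_step[OF N 2] by (rule Suc.IH(2)[OF poly_act_bounded_below])
  }
qed (simp_all add: poly_act_1)

lemma expand_0: "expand_inf N 0 f = f" "expand_zero N 0 f = f"
proof -
  have g: "((0::complex) gchoose i) = (if i = 0 then 1 else 0)" for i by (cases i) simp_all
  have S: "Sum_any (\<lambda>i::nat. if i = 0 then c i else 0) = c 0" for c :: "nat \<Rightarrow> complex" by simp
  show "expand_inf N 0 f = f" "expand_zero N 0 f = f"
    by (rule ext, simp add: expand_inf_def expand_zero_def g if_distrib[where f = "\<lambda>x. x * _"] cong: if_cong)+
qed

lemma expand_nonneg:
  assumes N: "N > 0"
  shows "bounded_above f \<Longrightarrow> expand_inf N (int k) f = diff_act N k f"
    and "bounded_below f \<Longrightarrow> expand_zero N (int k) f = diff_act N k f"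
  using expand_power[OF N, of f 0 k] by (simp_all add: expand_0)

lemma Sum_any_int_split:
  fixes F :: "int \<Rightarrow> 'b::comm_monoid_add"
  assumes "finite {h. F h \<noteq> 0}"
  shows "Sum_any F = Sum_any (\<lambda>i. F (int i)) + Sum_any (\<lambda>i. F (- 1 - int i))"
proof -
  have nn: "Sum_any (\<lambda>h. if h \<ge> 0 then F h else 0) = Sum_any (\<lambda>i. F (int i))"
    by (subst Sum_any_reindex[of int]) (auto simp: image_iff dest: nonneg_int_cases)
  have neg: "Sum_any (\<lambda>h. if h < 0 then F h else 0) = Sum_any (\<lambda>i. F (- 1 - int i))"
  proof (subst Sum_any_reindex[of "\<lambda>i. - 1 - int i"])
    show "inj (\<lambda>i. - 1 - int i)" by (auto intro: injI)
    fix d assume d: "d \<notin> range (\<lambda>i. - 1 - int i)"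
    have "\<not> d < 0"
    proof
      assume "d < 0"
      then have "d = - 1 - int (nat (- 1 - d))" by simp
      then show False using d by blast
    qed
    then show "(if d < 0 then F d else 0) = 0" by simp
  qed simp
  have "Sum_any F = Sum_any (\<lambda>h. (if h \<ge> 0 then F h else 0) + (if h < 0 then F h else 0))"
    by (rule Sum_any.cong) auto
  also have "\<dots> = Sum_any (\<lambda>h. if h \<ge> 0 then F h else 0) + Sum_any (\<lambda>h. if h < 0 then F h else 0)"
    by (rule Sum_any.distrib; rule finite_subset[OF _ assms]) auto
  finally show ?thesis unfolding nn neg .
qed

text \<open>The two expansions of \<open>(y^N - 1)^(-1-K)\<close> differ by a derivative of a delta function.\<close>

lemma expand_difference:
  assumes N: "N > 0" and f: "bounded_above f" "bounded_below f"
  shows "expand_inf N (- 1 - int K) f p - expand_zero N (- 1 - int K) f p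
    = Sum_any (\<lambda>h. (of_int h gchoose K) * f (p + int N + int N * h))"
proof -
  let ?F = "\<lambda>h. (of_int h gchoose K) * f (p + int N + int N * h)"
  \<comment> \<open>Both expansions of \<open>(y^N - 1)^(-1-K)\<close> have the coefficients
    \<open>K + i choose K\<close> up to a common sign.\<close>
  have b: "((- 1 - of_nat K :: complex) gchoose i) * (- 1) ^ i = of_nat (K + i choose K)" for i
  proof -
    have "((- 1 - of_nat K :: complex) gchoose i) = (- 1) ^ i * (of_nat (K + i) gchoose i)"
      using gbinomial_negated_upper[of "- 1 - of_nat K :: complex" i] by (simp add: algebra_simps)
    moreover have "(of_nat (K + i) gchoose i :: complex) = of_nat (K + i choose K)"
      using binomial_symmetric[of K "K + i"] by (simp add: binomial_gbinomial[symmetric] del: of_nat_add)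
    ultimately show ?thesis by (simp add: power_mult_distrib[symmetric])
  qed
  have inj: "inj (\<lambda>h. p + int N + int N * h)" using N by (auto intro: injI)
  have fin: "finite {h. ?F h \<noteq> 0}"
  proof (rule finite_subset)
    show "finite ((\<lambda>h. p + int N + int N * h) -` {h. f h \<noteq> 0})"
      by (rule finite_vimageI[OF bounded_finite[OF f] inj])
  qed auto
  \<comment> \<open>Since \<open>h choose K\<close> vanishes for \<open>0 <= h < K\<close>, the
    nonnegative \<open>h\<close> start at \<open>K\<close> and reproduce the expansion at infinity.
    The negative ones will give minus the expansion at zero.\<close>
  have "Sum_any (\<lambda>i. ?F (int i)) = Sum_any (\<lambda>i. ?F (int (K + i)))"
  proof (rule Sum_any_reindex)
    fix d assume "d \<notin> range ((+) K)"
    then have "d < K" by (metis le_add_diff_inverse not_le rangeI)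
    then show "?F (int d) = 0" by (simp add: binomial_gbinomial[symmetric])
  qed simp
  also have "\<dots> = expand_inf N (- 1 - int K) f p"
    unfolding expand_inf_def
  proof (rule Sum_any.cong)
    fix i
    have e: "p - int N * (- 1 - int K - int i) = p + int N + int N * int (K + i)" by (simp add: algebra_simps)
    show "?F (int (K + i)) = (of_int (- 1 - int K) gchoose i) * (- 1) ^ i * f (p - int N * (- 1 - int K - int i))"
      unfolding e using b[of i] by (simp add: binomial_gbinomial)
  qed
  finally have P: "Sum_any (\<lambda>i. ?F (int i)) = expand_inf N (- 1 - int K) f p" .
  have "Sum_any (\<lambda>i. ?F (- 1 - int i)) = Sum_any (\<lambda>i. - ((- 1) powi (- 1 - int K) * ((of_int (- 1 - int K) gchoose i) * (- 1) ^ i) * f (p - int N * int i)))"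
  proof (rule Sum_any.cong)
    fix i
    have "((- 1 - of_nat i :: complex) gchoose K) = (- 1) ^ K * ((- 1) ^ K * ((- 1 - of_nat i :: complex) gchoose K))"
      by (simp add: power_mult_distrib[symmetric] mult.assoc[symmetric])
    also have "\<dots> = (- 1) ^ K * of_nat (K + i choose K)"
      using gbinomial_negated_upper[of "- 1 - of_nat i :: complex" K]
      by (simp add: binomial_gbinomial power_mult_distrib[symmetric] mult.assoc[symmetric] add.commute algebra_simps)
    finally have 1: "((- 1 - of_nat i :: complex) gchoose K) = (- 1) ^ K * of_nat (K + i choose K)" .
    have 2: "- ((- 1) powi (- 1 - int K)) = ((- 1) ^ K :: complex)"
      by (simp add: power_int_diff power_int_minus) (simp add: field_simps power_mult_distrib[symmetric])
    have "- ((- 1) powi (- 1 - int K) * ((of_int (- 1 - int K) gchoose i) * (- 1) ^ i) * f (p - int N * int i))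
      = - ((- 1) powi (- 1 - int K)) * of_nat (K + i choose K) * f (p - int N * int i)"
      using b[of i] by simp
    also have "\<dots> = ?F (- 1 - int i)" unfolding 2 using 1 by (simp add: algebra_simps)
    finally show "?F (- 1 - int i) = - ((- 1) powi (- 1 - int K) * ((of_int (- 1 - int K) gchoose i) * (- 1) ^ i) * f (p - int N * int i))" ..
  qed
  also have "\<dots> = - expand_zero N (- 1 - int K) f p"
    unfolding expand_zero_def Sum_any.expand_set by (simp add: sum_negf)
  finally show ?thesis using Sum_any_int_split[OF fin] P by simp
qed

section \<open>Expansion of Laurent polynomials at \<open>y = 1\<close>\<close>

lemma fls_times_fps_nth:
  fixes F :: "complex fps"
  shows "fls_nth (fps_to_fls F * G) n = Sum_any (\<lambda>i. fps_nth F i * fls_nth G (n - int i))"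
proof -
  define b where "b = fls_subdegree G"
  define M where "M = nat (n - b)"
  have "fls_nth (fps_to_fls F * G) n = (\<Sum>i=0..n - b. fls_nth (fps_to_fls F) i * fls_nth G (n - i))"
    unfolding b_def
  proof (subst fls_times_nth(2), rule sum.mono_neutral_left)
    show "{fls_subdegree (fps_to_fls F)..n - fls_subdegree G} \<subseteq> {0..n - fls_subdegree G}"
      by (simp add: fls_subdegree_fls_to_fps)
    show "\<forall>i\<in>{0..n - fls_subdegree G} - {fls_subdegree (fps_to_fls F)..n - fls_subdegree G}.
        fls_nth (fps_to_fls F) i * fls_nth G (n - i) = 0"
    proof
      fix i assume "i \<in> {0..n - fls_subdegree G} - {fls_subdegree (fps_to_fls F)..n - fls_subdegree G}"
      then have "i < fls_subdegree (fps_to_fls F)" by auto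
      then show "fls_nth (fps_to_fls F) i * fls_nth G (n - i) = 0"
        by (simp only: fls_eq0_below_subdegree mult_zero_left)
    qed
  qed simp
  also have "\<dots> = (\<Sum>i\<le>M. fps_nth F i * fls_nth G (n - int i))"
  proof (cases "n \<ge> b")
    case True
    show ?thesis
      by (rule sum.reindex_bij_witness[where i = int and j = nat]) (use True in \<open>auto simp: M_def\<close>)
  next
    case False
    then show ?thesis by (auto simp: M_def b_def)
  qed
  also have "\<dots> = Sum_any (\<lambda>i. fps_nth F i * fls_nth G (n - int i))"
    by (rule Sum_any_atMost[symmetric]) (auto simp: M_def b_def)
  finally show ?thesis .
qed

text \<open>The substitution \<open>y = 1 + X\<close> in a Laurent polynomial in \<open>y\<close>, given by its coefficients.\<close>

definition taylor :: "(int \<Rightarrow> complex) \<Rightarrow> complex fls" where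
  "taylor f = (\<Sum>h | f h \<noteq> 0. fls_const (f h) * (1 + fls_X) powi h)"

definition taylor_poly :: "complex poly \<Rightarrow> complex fls" where
  "taylor_poly p = poly (map_poly fls_const p) (1 + fls_X)"

lemma one_plus_fls_X_nonzero: "(1 + fls_X :: complex fls) \<noteq> 0"
proof
  assume "(1 + fls_X :: complex fls) = 0"
  then have "fls_nth (1 + fls_X :: complex fls) 0 = 0" by simp
  then show False by simp
qed

lemma taylor_superset:
  assumes "finite S" "{h. f h \<noteq> 0} \<subseteq> S"
  shows "taylor f = (\<Sum>h\<in>S. fls_const (f h) * (1 + fls_X) powi h)"
  unfolding taylor_def by (rule sum.mono_neutral_left) (use assms in auto)

lemma taylor_add:
  assumes "finite {h. f h \<noteq> 0}" "finite {h. g h \<noteq> 0}"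
  shows "taylor (\<lambda>h. f h + g h) = taylor f + taylor g"
proof -
  let ?S = "{h. f h \<noteq> 0} \<union> {h. g h \<noteq> 0}"
  have "taylor (\<lambda>h. f h + g h) = (\<Sum>h\<in>?S. fls_const (f h + g h) * (1 + fls_X) powi h)"
    by (rule taylor_superset) (use assms in auto)
  moreover have "taylor f = (\<Sum>h\<in>?S. fls_const (f h) * (1 + fls_X) powi h)"
    "taylor g = (\<Sum>h\<in>?S. fls_const (g h) * (1 + fls_X) powi h)"
    by (rule taylor_superset; use assms in auto)+
  ultimately show ?thesis
    by (simp add: sum.distrib distrib_right fls_plus_const[symmetric])
qed

lemma taylor_scale: "taylor (\<lambda>h. c * f h) = fls_const c * taylor f"
proof (cases "c = 0")
  case False
  then show ?thesis by (simp add: taylor_def sum_distrib_left mult.assoc[symmetric] fls_const_mult_const)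
qed (simp add: taylor_def)

lemma taylor_shift: "taylor (\<lambda>h. f (h - 1)) = (1 + fls_X) * taylor f"
proof -
  have "taylor (\<lambda>h. f (h - 1)) = (\<Sum>h | f h \<noteq> 0. fls_const (f h) * (1 + fls_X) powi (h + 1))"
    unfolding taylor_def
    by (rule sum.reindex_bij_witness[where i = "\<lambda>h. h + 1" and j = "\<lambda>h. h - 1"]) auto
  then show ?thesis
    by (simp add: taylor_def sum_distrib_left power_int_add one_plus_fls_X_nonzero mult_ac)
qed

lemma poly_act_finite: "finite {h. f h \<noteq> 0} \<Longrightarrow> finite {h. poly_act p f h \<noteq> 0}"
proof -
  assume "finite {h. f h \<noteq> 0}"
  then have "finite (\<Union>i\<le>degree p. (\<lambda>h. h + int i) ` {h. f h \<noteq> 0})" by blast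
  moreover have "{h. poly_act p f h \<noteq> 0} \<subseteq> (\<Union>i\<le>degree p. (\<lambda>h. h + int i) ` {h. f h \<noteq> 0})"
  proof
    fix h assume "h \<in> {h. poly_act p f h \<noteq> 0}"
    then obtain i where "i \<le> degree p" "f (h - int i) \<noteq> 0"
      unfolding poly_act_def by (auto elim!: sum.not_neutral_contains_not_neutral)
    then show "h \<in> (\<Union>i\<le>degree p. (\<lambda>h. h + int i) ` {h. f h \<noteq> 0})"
      by (intro UN_I[of i] image_eqI[of _ _ "h - int i"]) auto
  qed
  ultimately show ?thesis by (rule rev_finite_subset)
qed

lemma taylor_poly_act:
  assumes "finite {h. f h \<noteq> 0}"
  shows "taylor (poly_act p f) = taylor_poly p * taylor f"
proof (induction p)
  case 0
  then show ?case by (simp add: taylor_def poly_act_0 taylor_poly_def)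
next
  case (pCons c p)
  have "poly_act (pCons c p) f = (\<lambda>h. c * f h + poly_act p f (h - 1))"
    by (simp add: fun_eq_iff poly_act_pCons)
  moreover have "finite {h. c * f h \<noteq> 0}" using assms by (rule rev_finite_subset) auto
  moreover have "finite {h. poly_act p f (h - 1) \<noteq> 0}"
  proof -
    have "{h. poly_act p f (h - 1) \<noteq> 0} = (\<lambda>h. h - 1) -` {h. poly_act p f h \<noteq> 0}" by auto
    then show ?thesis using finite_vimageI[OF poly_act_finite[OF assms], of "\<lambda>h. h - 1"] by (simp add: inj_def)
  qed
  ultimately have "taylor (poly_act (pCons c p) f) = fls_const c * taylor f + (1 + fls_X) * (taylor_poly p * taylor f)"
    by (simp add: taylor_add taylor_scale taylor_shift pCons.IH)
  then show ?case by (simp add: taylor_poly_def map_poly_pCons algebra_simps)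
qed

lemma taylor_unit: "taylor (\<lambda>h. if h = 0 then 1 else 0) = 1"
proof -
  have "{h. (if h = 0 then 1 else (0::complex)) \<noteq> 0} = {0::int}" by auto
  then show ?thesis by (simp add: taylor_def)
qed

lemma taylor_poly_hom:
  "taylor_poly (p * q) = taylor_poly p * taylor_poly q" "taylor_poly 1 = 1"
  "taylor_poly (p ^ k) = taylor_poly p ^ k" "taylor_poly (diff_poly N) = (1 + fls_X) ^ N - 1"
proof -
  let ?d = "\<lambda>h::int. if h = 0 then 1 else (0::complex)"
  have d: "finite {h. ?d h \<noteq> 0}" by (rule finite_subset[of _ "{0}"]) auto
  \<comment> \<open>Evaluating on the coefficient sequence of the constant 1 reduces the ring laws
    to those of \<open>poly_act\<close>.\<close>
  have e: "taylor_poly p = taylor (poly_act p ?d)" for p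
    using taylor_poly_act[OF d, of p] by (simp add: taylor_unit)
  show m: "taylor_poly (p * q) = taylor_poly p * taylor_poly q" for p q
    unfolding e[of "p * q"] poly_act_mult by (simp add: taylor_poly_act[OF poly_act_finite[OF d]] e[of q])
  show o: "taylor_poly 1 = 1" by (simp add: e poly_act_1 taylor_unit)
  show "taylor_poly (p ^ k) = taylor_poly p ^ k" by (induction k) (simp_all add: m o)
  show "taylor_poly (diff_poly N) = (1 + fls_X) ^ N - 1"
  proof (cases "N = 0")
    case True
    then show ?thesis by (simp add: diff_poly_def taylor_poly_def)
  next
    case False
    have "poly_act (diff_poly N) ?d = (\<lambda>h. (if h = int N then 1 else 0) + - 1 * ?d h)"
      by (auto simp: fun_eq_iff poly_act_diff_poly)
    moreover have "finite {h. (if h = int N then 1 else (0::complex)) \<noteq> 0}"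
      by (rule finite_subset[of _ "{int N}"]) auto
    moreover have "finite {h. - 1 * ?d h \<noteq> 0}" by (rule finite_subset[of _ "{0}"]) auto
    moreover have "taylor (\<lambda>h. if h = int N then 1 else 0) = (1 + fls_X) ^ N"
    proof -
      have "{h. (if h = int N then 1 else (0::complex)) \<noteq> 0} = {int N}" by auto
      then show ?thesis by (simp add: taylor_def)
    qed
    ultimately show ?thesis
      unfolding e[of "diff_poly N"] by (simp only: taylor_add taylor_scale taylor_unit) simp
  qed
qed

lemma taylor_nth:
  assumes "finite {h. f h \<noteq> 0}"
  shows "fls_nth (taylor f) j = (if j \<ge> 0 then Sum_any (\<lambda>h. f h * (of_int h gchoose nat j)) else 0)"
proof -
  have "fls_nth (taylor f) j = (\<Sum>h | f h \<noteq> 0. f h * (if j \<ge> 0 then of_int h gchoose nat j else 0))"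
    unfolding taylor_def one_plus_fls_X_powi_eq by (cases "j < 0") (simp_all add: fls_nth_sum)
  moreover have "(\<Sum>h | f h \<noteq> 0. f h * (of_int h gchoose nat j)) = Sum_any (\<lambda>h. f h * (of_int h gchoose nat j))"
    by (rule Sum_any.expand_superset[symmetric]) (use assms in auto)
  ultimately show ?thesis by simp
qed

text \<open>\<open>J\<close> is the quasi Jacobi identity coefficient by coefficient. If
  \<open>l\<close> bounds the pole order of its right side, the extra factor
  \<open>(y - 1)^l\<close> makes that side vanish, so the two one-sided series merge into a finite
  \<open>C\<close>, whose expansion at \<open>y = 1\<close> can then be read off from
  \<open>J\<close>.\<close>

lemma taylor_of_residue_identity:
  assumes N: "N > 0" and A: "bounded_above A" and B: "bounded_below B"
    and J: "\<And>m p. expand_inf 1 m (diff_act N k0 A) p - expand_zero 1 m (diff_act N k0 B) p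
      = fls_nth (fps_to_fls (fps_binomial (of_int (- p - 1))) * (((1 + fls_X) ^ N - 1) ^ k0 * I)) (- 1 - m)"
  shows "\<exists>k1. \<forall>k\<ge>k1. diff_act N k A = diff_act N k B \<and>
    taylor (diff_act N k A) = ((1 + fls_X) ^ N - 1) ^ k * I"
proof -
  let ?E = "(1 + fls_X) ^ N - 1 :: complex fls"
  define F where "F = ?E ^ k0 * I"
  define l where "l = nat (- fls_subdegree F)"
  define a where "a = diff_act N k0 A"
  define b where "b = diff_act N k0 B"
  have a: "bounded_above a" and b: "bounded_below b"
    using A B by (simp_all add: a_def b_def poly_act_bounded_above poly_act_bounded_below)
  note J = J[folded a_def b_def F_def]
  define C where "C = diff_act 1 l a"
  have Cb: "C = diff_act 1 l b"
  proof
    fix p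
    have "fls_nth (fps_to_fls (fps_binomial (of_int (- p - 1))) * F) (- 1 - int l) = 0"
      unfolding fls_times_fps_nth by (simp add: l_def)
    then show "C p = diff_act 1 l b p"
      using J[of "int l" p] expand_nonneg[of 1 a l] expand_nonneg[of 1 b l] a b by (simp add: C_def)
  qed
  have Ca: "bounded_above C" using a by (simp add: C_def poly_act_bounded_above)
  have Cl: "bounded_below C" unfolding Cb using b by (simp add: poly_act_bounded_below)
  have fin: "finite {h. C h \<noteq> 0}" by (rule bounded_finite[OF Ca Cl])
  have T: "taylor C = fls_X ^ l * F"
  proof (rule fls_eqI)
    fix j
    have "fls_nth (fls_X ^ l * F) j = fls_nth F (j - int l)"
      by (simp add: fls_X_power_times_conv_shift)
    \<comment> \<open>At \<open>p = -1\<close> the binomial factor on the right of \<open>J\<close>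
      is 1.\<close>
    also have "\<dots> = expand_inf 1 (- 1 - (j - int l)) a (- 1) - expand_zero 1 (- 1 - (j - int l)) b (- 1)"
      using J[of "- 1 - (j - int l)" "- 1"] by simp
    also have "\<dots> = expand_inf 1 (- 1 - j) C (- 1) - expand_zero 1 (- 1 - j) C (- 1)"
    proof -
      have e: "- 1 - (j - int l) = - 1 - j + int l" by simp
      show ?thesis unfolding e
        by (subst expand_power(1)[OF zero_less_one a], subst expand_power(2)[OF zero_less_one b])
          (simp only: C_def[symmetric] Cb[symmetric])
    qed
    \<comment> \<open>For \<open>j >= 0\<close> the exponent \<open>-1 - j\<close> is negative and
      the difference of the two expansions is a Taylor coefficient. For \<open>j < 0\<close> the
      exponent is nonnegative and the expansions agree, so there is no pole.\<close>
    also have "\<dots> = fls_nth (taylor C) j"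
    proof (cases "j \<ge> 0")
      case True
      then have "- 1 - j = - 1 - int (nat j)" by simp
      then show ?thesis
        using expand_difference[of 1 C "nat j" "- 1", OF _ Ca Cl] True by (simp add: taylor_nth[OF fin] mult.commute)
    next
      case False
      define n where "n = nat (- 1 - j)"
      have n: "- 1 - j = int n" using False by (simp add: n_def)
      show ?thesis unfolding n using False
        by (simp add: expand_nonneg Ca Cl taylor_nth[OF fin])
    qed
    finally show "fls_nth (taylor C) j = fls_nth (fls_X ^ l * F) j" ..
  qed
  \<comment> \<open>\<open>y - 1\<close> divides \<open>y^N - 1\<close>, so the auxiliary factor
    \<open>(y - 1)^l\<close> is absorbed by \<open>l\<close> further powers of
    \<open>y^N - 1\<close>.\<close>
  have "diff_poly N = diff_poly 1 * (\<Sum>i<N. Polynomial.monom 1 i)"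
    using power_diff_1_eq[of "Polynomial.monom (1::complex) 1" N] by (simp add: diff_poly_def monom_power)
  then obtain S where S: "diff_poly N = S * diff_poly 1" by (metis mult.commute)
  have "diff_act N k A = diff_act N k B \<and>
    taylor (diff_act N k A) = ?E ^ k * I" if "k \<ge> k0 + l" for k
  proof -
    define Q where "Q = diff_poly N ^ (k - k0 - l) * S ^ l"
    have "diff_poly N ^ k = diff_poly N ^ (k - k0 - l) * diff_poly N ^ l * diff_poly N ^ k0"
      using that by (simp add: power_add[symmetric])
    also have "diff_poly N ^ l = S ^ l * diff_poly 1 ^ l" by (simp add: S power_mult_distrib)
    finally have k: "diff_poly N ^ k = Q * (diff_poly 1 ^ l * diff_poly N ^ k0)"
      by (simp add: Q_def mult.assoc)
    have "diff_act N k A = poly_act Q C" "diff_act N k B = poly_act Q C"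
      unfolding k poly_act_mult by (simp_all only: a_def[symmetric] b_def[symmetric] C_def[symmetric] Cb[symmetric])
    moreover have "taylor (poly_act Q C) = taylor_poly Q * (taylor_poly (diff_poly 1) ^ l * F)"
      by (simp add: taylor_poly_act[OF fin] T taylor_poly_hom(4))
    moreover have "taylor_poly Q * (taylor_poly (diff_poly 1) ^ l * F) = taylor_poly (diff_poly N ^ k) * I"
      unfolding k taylor_poly_hom(1) taylor_poly_hom(3) F_def taylor_poly_hom(4)[of N] by (simp only: mult.assoc)
    ultimately show ?thesis by (simp add: taylor_poly_hom(3,4))
  qed
  then show ?thesis by blast
qed

text \<open>With \<open>y = z1/z2\<close> and \<open>t = x0/x2\<close> this is the coefficient of \<open>t^c\<close> in \<open>t^(-k) f(y)\<close> under \<open>y = (1 + t)^(1/N)\<close>.\<close>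

definition root_taylor :: "nat \<Rightarrow> nat \<Rightarrow> (int \<Rightarrow> complex) \<Rightarrow> int \<Rightarrow> complex" where
  "root_taylor N k f c = (if c + int k \<ge> 0
     then Sum_any (\<lambda>h. f h * ((of_int h / of_nat N) gchoose nat (c + int k))) else 0)"

text \<open>\<open>A\<close> and \<open>B\<close> are the two orders of the product and
  \<open>I\<close> is the iterate, in one total degree. The condition is imposed for all large
  \<open>k\<close>, so that finitely many instances can be added with a common
  \<open>k\<close>.\<close>

definition twisted_local :: "nat \<Rightarrow> (int \<Rightarrow> complex) \<Rightarrow> (int \<Rightarrow> complex) \<Rightarrow> (int \<Rightarrow> complex) \<Rightarrow> bool" where
  "twisted_local N A B I \<longleftrightarrow> bounded_above A \<and> bounded_below B \<and>
     (\<exists>k1. \<forall>k\<ge>k1. diff_act N k A = diff_act N k B \<and>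
        I = root_taylor N k (diff_act N k A))"

lemma poly_act_plus: "poly_act p (\<lambda>h. f h + g h) = (\<lambda>h. poly_act p f h + poly_act p g h)"
  by (rule ext) (simp add: poly_act_def distrib_left sum.distrib)

lemma poly_act_scale: "poly_act p (\<lambda>h. c * f h) = (\<lambda>h. c * poly_act p f h)"
  by (rule ext) (simp add: poly_act_def sum_distrib_left mult.left_commute)

lemma poly_act_shift: "poly_act p (\<lambda>h. f (h - e)) = (\<lambda>h. poly_act p f (h - e))"
  by (rule ext) (simp add: poly_act_def algebra_simps)

lemma bounded_above_simps:
  "bounded_above f \<Longrightarrow> bounded_above g \<Longrightarrow> bounded_above (\<lambda>h. f h + g h)"
  "bounded_above f \<Longrightarrow> bounded_above (\<lambda>h. c * f h)"
  "bounded_above f \<Longrightarrow> bounded_above (\<lambda>h. f (h - e))"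
proof -
  assume f: "bounded_above f"
  then obtain b where b: "\<And>h. h > b \<Longrightarrow> f h = 0" by (auto simp: bounded_above_def)
  show "bounded_above (\<lambda>h. c * f h)" using b by (auto simp: bounded_above_def)
  have "f (h - e) = 0" if "h > b + e" for h using b that by simp
  then show "bounded_above (\<lambda>h. f (h - e))" by (auto simp: bounded_above_def)
  assume "bounded_above g"
  then obtain b' where "\<And>h. h > b' \<Longrightarrow> g h = 0" by (auto simp: bounded_above_def)
  with b have "f h + g h = 0" if "h > max b b'" for h using that by simp
  then show "bounded_above (\<lambda>h. f h + g h)" unfolding bounded_above_def by blast
qed

lemma bounded_below_simps:
  "bounded_below f \<Longrightarrow> bounded_below g \<Longrightarrow> bounded_below (\<lambda>h. f h + g h)"
  "bounded_below f \<Longrightarrow> bounded_below (\<lambda>h. c * f h)"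
  "bounded_below f \<Longrightarrow> bounded_below (\<lambda>h. f (h - e))"
proof -
  assume f: "bounded_below f"
  then obtain b where b: "\<And>h. h < b \<Longrightarrow> f h = 0" by (auto simp: bounded_below_def)
  show "bounded_below (\<lambda>h. c * f h)" using b by (auto simp: bounded_below_def)
  have "f (h - e) = 0" if "h < b + e" for h using b that by simp
  then show "bounded_below (\<lambda>h. f (h - e))" by (auto simp: bounded_below_def)
  assume "bounded_below g"
  then obtain b' where "\<And>h. h < b' \<Longrightarrow> g h = 0" by (auto simp: bounded_below_def)
  with b have "f h + g h = 0" if "h < min b b'" for h using that by simp
  then show "bounded_below (\<lambda>h. f h + g h)" unfolding bounded_below_def by blast
qed

lemma twisted_local_finite:
  assumes "bounded_above A" "bounded_below B" "poly_act p A = poly_act p B"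
  shows "finite {h. poly_act p A h \<noteq> 0}"
  by (rule bounded_finite) (use assms poly_act_bounded_above poly_act_bounded_below in metis)+

lemma root_taylor_plus:
  assumes "finite {h. f h \<noteq> 0}" "finite {h. g h \<noteq> 0}"
  shows "root_taylor N k (\<lambda>h. f h + g h) = (\<lambda>c. root_taylor N k f c + root_taylor N k g c)"
proof -
  have "Sum_any (\<lambda>h. (f h + g h) * x h) = Sum_any (\<lambda>h. f h * x h) + Sum_any (\<lambda>h. g h * x h)" for x
    unfolding distrib_right by (rule Sum_any.distrib; rule finite_subset[OF _ assms(1)] finite_subset[OF _ assms(2)]) auto
  then show ?thesis by (auto simp: root_taylor_def fun_eq_iff)
qed

lemma root_taylor_scale:
  assumes "finite {h. f h \<noteq> 0}"
  shows "root_taylor N k (\<lambda>h. a * f h) = (\<lambda>c. a * root_taylor N k f c)"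
proof -
  have "Sum_any (\<lambda>h. a * f h * x h) = a * Sum_any (\<lambda>h. f h * x h)" for x
  proof (subst Sum_any_right_distrib)
    show "finite {h. f h * x h \<noteq> 0}" by (rule finite_subset[OF _ assms]) auto
  qed (simp add: mult.assoc)
  then show ?thesis by (auto simp: root_taylor_def fun_eq_iff)
qed

lemma twisted_local_add:
  assumes "twisted_local N A B I" "twisted_local N A' B' I'"
  shows "twisted_local N (\<lambda>h. A h + A' h) (\<lambda>h. B h + B' h) (\<lambda>c. I c + I' c)"
proof -
  obtain k1 k2 where k: "bounded_above A" "bounded_below B" "bounded_above A'" "bounded_below B'"
    "\<And>k. k \<ge> k1 \<Longrightarrow> diff_act N k A = diff_act N k B"
    "\<And>k. k \<ge> k1 \<Longrightarrow> I = root_taylor N k (diff_act N k A)"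
    "\<And>k. k \<ge> k2 \<Longrightarrow> diff_act N k A' = diff_act N k B'"
    "\<And>k. k \<ge> k2 \<Longrightarrow> I' = root_taylor N k (diff_act N k A')"
    using assms unfolding twisted_local_def by blast
  have "diff_act N k (\<lambda>h. A h + A' h) = diff_act N k (\<lambda>h. B h + B' h) \<and>
    (\<lambda>c. I c + I' c) = root_taylor N k (diff_act N k (\<lambda>h. A h + A' h))" if "k \<ge> max k1 k2" for k
  proof -
    have k': "k \<ge> k1" "k \<ge> k2" using that by auto
    note fin = twisted_local_finite[OF k(1,2) k(5)[OF k'(1)]] twisted_local_finite[OF k(3,4) k(7)[OF k'(2)]]
    show ?thesis
      unfolding poly_act_plus root_taylor_plus[OF fin]
      using k(5)[OF k'(1)] k(6)[OF k'(1)] k(7)[OF k'(2)] k(8)[OF k'(2)] by metis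
  qed
  then show ?thesis unfolding twisted_local_def
    using bounded_above_simps(1)[OF k(1,3)] bounded_below_simps(1)[OF k(2,4)] by blast
qed

lemma twisted_local_scale:
  assumes "twisted_local N A B I"
  shows "twisted_local N (\<lambda>h. a * A h) (\<lambda>h. a * B h) (\<lambda>c. a * I c)"
proof -
  obtain k1 where k: "bounded_above A" "bounded_below B"
    "\<And>k. k \<ge> k1 \<Longrightarrow> diff_act N k A = diff_act N k B"
    "\<And>k. k \<ge> k1 \<Longrightarrow> I = root_taylor N k (diff_act N k A)"
    using assms unfolding twisted_local_def by blast
  have "diff_act N k (\<lambda>h. a * A h) = diff_act N k (\<lambda>h. a * B h) \<and>
    (\<lambda>c. a * I c) = root_taylor N k (diff_act N k (\<lambda>h. a * A h))" if "k \<ge> k1" for k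
    unfolding poly_act_scale root_taylor_scale[OF twisted_local_finite[OF k(1,2) k(3)[OF that]]]
    using k(3,4)[OF that] by metis
  then show ?thesis unfolding twisted_local_def
    using bounded_above_simps(2)[OF k(1)] bounded_below_simps(2)[OF k(2)] by blast
qed

lemma twisted_local_zero: "twisted_local N (\<lambda>h. 0) (\<lambda>h. 0) (\<lambda>c. 0)"
proof -
  have "poly_act p (\<lambda>h. 0) = (\<lambda>h. 0)" for p by (rule ext) (simp add: poly_act_def)
  moreover have "root_taylor N k (\<lambda>h. 0) = (\<lambda>c. 0)" for k by (auto simp: root_taylor_def)
  ultimately show ?thesis by (auto simp: twisted_local_def bounded_above_def bounded_below_def)
qed

lemma twisted_local_sum:
  assumes "\<And>x. x \<in> S \<Longrightarrow> twisted_local N (A x) (B x) (I x)"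
  shows "twisted_local N (\<lambda>h. \<Sum>x\<in>S. A x h) (\<lambda>h. \<Sum>x\<in>S. B x h) (\<lambda>c. \<Sum>x\<in>S. I x c)"
  using assms
proof (induction S rule: infinite_finite_induct)
  case (insert x F)
  then show ?case using twisted_local_add[of N "A x" "B x" "I x"] by simp
qed (simp_all add: twisted_local_zero)

section \<open>The substitution \<open>y = (1 + t)^(1/N)\<close>\<close>

lemma fls_compose_fps_sum:
  assumes "H \<noteq> 0" "fps_nth H 0 = 0"
  shows "fls_compose_fps (sum F S) H = (\<Sum>x\<in>S. fls_compose_fps (F x) H)"
  by (induction S rule: infinite_finite_induct) (simp_all add: fls_compose_fps_add[OF assms])

lemma fps_binomial_powi:
  "fps_to_fls (fps_binomial x) powi h = fps_to_fls (fps_binomial (of_int h * x :: complex))"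
proof -
  have "fps_nth (fps_binomial x) 0 \<noteq> 0" by simp
  then have nz: "fps_to_fls (fps_binomial x) \<noteq> (0 :: complex fls)" by (metis fps_zero_nth fps_to_fls_eq_0_iff)
  show ?thesis
  proof (induction h rule: int_induct[of _ 0])
    case (step1 h)
    have e: "of_int (h + 1) * x = of_int h * x + x" by (simp add: algebra_simps)
    show ?case unfolding e fps_binomial_add_mult fls_times_fps_to_fls
      using step1 nz by (simp add: power_int_add)
  next
    case (step2 h)
    have e: "of_int h * x = of_int (h - 1) * x + x" by (simp add: algebra_simps)
    have "fps_to_fls (fps_binomial x) powi (h - 1) * fps_to_fls (fps_binomial x)
      = fps_to_fls (fps_binomial (of_int (h - 1) * x)) * fps_to_fls (fps_binomial x)"
      using step2(2) nz unfolding e fps_binomial_add_mult fls_times_fps_to_fls by (simp add: power_int_diff)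
    then show ?case using nz by simp
  qed simp
qed

lemma one_plus_root_series:
  assumes N: "N > 0"
  shows "(1 + fps_to_fls (root_series N)) powi h = fps_to_fls (fps_binomial (of_int h / of_nat N))"
    "(1 + fps_to_fls (root_series N)) ^ N - 1 = fls_X"
proof -
  have 1: "1 + fps_to_fls (root_series N) = fps_to_fls (fps_binomial (1 / of_nat N))"
    by (simp add: root_series_def)
  show p: "(1 + fps_to_fls (root_series N)) powi h = fps_to_fls (fps_binomial (of_int h / of_nat N))" for h
    unfolding 1 fps_binomial_powi by simp
  show "(1 + fps_to_fls (root_series N)) ^ N - 1 = fls_X"
    using p[of "int N"] N by (simp add: fps_binomial_1)
qed

text \<open>Powers of the root series above \<open>c\<close> have order above \<open>c\<close>, and
  \<open>I\<close> has no terms below \<open>c - \<Delta>\<close>; hence only finitely many terms of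
  the possibly infinite series \<open>I\<close> reach degree \<open>c\<close>.\<close>

lemma root_coeff_compose:
  assumes N: "N > 0" and low: "\<And>\<delta>. \<delta> > \<Delta> \<Longrightarrow> fls_nth I (c - int \<delta>) = 0"
  shows "fls_nth (fps_to_fls (fps_binomial e) * fls_compose_fps I (root_series N)) c
    = (\<Sum>\<delta>\<le>\<Delta>. root_coeff N e (c - int \<delta>) c * fls_nth I (c - int \<delta>))"
proof -
  let ?g = "root_series N" and ?B = "fps_to_fls (fps_binomial e)"
  note g = root_series_nonzero[OF N] root_series_nth(1)[of N]
  define P where "P = (\<Sum>\<delta>\<le>\<Delta>. fls_const (fls_nth I (c - int \<delta>)) * fls_X powi (c - int \<delta>))"
  define R where "R = I - P"
  have Rn: "fls_nth R s = 0" if "s \<le> c" for s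
  proof -
    have "fls_nth P s = (\<Sum>\<delta>\<le>\<Delta>. if \<delta> = nat (c - s) then fls_nth I (c - int \<delta>) else 0)"
      unfolding P_def fls_nth_sum using that by (intro sum.cong refl) auto
    then have "fls_nth P s = (if nat (c - s) \<le> \<Delta> then fls_nth I s else 0)" using that by simp
    moreover have "fls_nth I s = 0" if "\<not> nat (c - s) \<le> \<Delta>"
      using low[of "nat (c - s)"] that \<open>s \<le> c\<close> by simp
    ultimately show ?thesis by (simp add: R_def)
  qed
  have "fls_nth (?B * fls_compose_fps R ?g) c = 0"
  proof (cases "R = 0")
    case False
    have "fls_subdegree R > c" using Rn False by (metis nth_fls_subdegree_nonzero not_le)
    moreover have "fls_subdegree (fls_compose_fps R ?g) = fls_subdegree R"
      using subdegree_root_series[OF N] g by simp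
    ultimately have "c < fls_subdegree (fls_compose_fps R ?g)" by simp
    then have "fls_nth (fls_compose_fps R ?g) (c - int i) = 0" for i
      by (intro fls_eq0_below_subdegree) simp
    then show ?thesis by (simp add: fls_times_fps_nth)
  qed simp
  moreover have "I = R + P" by (simp add: R_def)
  ultimately have "fls_nth (?B * fls_compose_fps I ?g) c = fls_nth (?B * fls_compose_fps P ?g) c"
    using g by (simp add: fls_compose_fps_add distrib_left)
  also have "fls_compose_fps P ?g = (\<Sum>\<delta>\<le>\<Delta>. fls_const (fls_nth I (c - int \<delta>)) * fps_to_fls ?g powi (c - int \<delta>))"
    unfolding P_def fls_compose_fps_sum[OF g] fls_compose_fps_mult[OF g] fls_compose_fps_powi[OF g] by simp
  also have "?B * \<dots> = (\<Sum>\<delta>\<le>\<Delta>. fls_const (fls_nth I (c - int \<delta>)) * (?B * fps_to_fls ?g powi (c - int \<delta>)))"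
    by (simp add: sum_distrib_left mult.left_commute)
  finally show ?thesis by (simp add: fls_nth_sum root_coeff_def mult.commute)
qed

text \<open>Composing the expansion at \<open>y = 1\<close> with \<open>(1 + t)^(1/N) - 1\<close>
  substitutes \<open>y = (1 + t)^(1/N)\<close>, under which \<open>(y^N - 1)^k\<close> becomes
  \<open>t^k\<close>. Shifting exponents by \<open>e\<close> is multiplication by
  \<open>y^e = (1 + t)^(e/N)\<close>; such shifts come from the powers of \<open>z1\<close> in
  Delta.\<close>

lemma taylor_root:
  assumes N: "N > 0" and A: "bounded_above A" and B: "bounded_below B"
    and loc: "\<exists>k1. \<forall>k\<ge>k1. diff_act N k A = diff_act N k B \<and>
      taylor (diff_act N k A) = ((1 + fls_X) ^ N - 1) ^ k * I"
  shows "twisted_local N (\<lambda>h. A (h - e)) (\<lambda>h. B (h - e))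
    (\<lambda>c. fls_nth (fps_to_fls (fps_binomial (of_int e / of_nat N)) * fls_compose_fps I (root_series N)) c)"
proof -
  let ?g = "root_series N"
  note g = root_series_nonzero[OF N] root_series_nth(1)[of N]
  let ?B = "\<lambda>x. fps_to_fls (fps_binomial x) :: complex fls"
  obtain k1 where k1: "\<And>k. k \<ge> k1 \<Longrightarrow> diff_act N k A = diff_act N k B"
    "\<And>k. k \<ge> k1 \<Longrightarrow> taylor (diff_act N k A) = ((1 + fls_X) ^ N - 1) ^ k * I"
    using loc by blast
  have "diff_act N k (\<lambda>h. A (h - e)) = diff_act N k (\<lambda>h. B (h - e)) \<and>
    (\<lambda>c. fls_nth (?B (of_int e / of_nat N) * fls_compose_fps I ?g) c)
      = root_taylor N k (diff_act N k (\<lambda>h. A (h - e)))" if k: "k \<ge> k1" for k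
  proof
    show "diff_act N k (\<lambda>h. A (h - e)) = diff_act N k (\<lambda>h. B (h - e))"
      unfolding poly_act_shift k1(1)[OF k] ..
    define C where "C = diff_act N k A"
    have fin: "finite {h. C h \<noteq> 0}" unfolding C_def by (rule twisted_local_finite[OF A B k1(1)[OF k]])
    have X1: "fls_compose_fps (1 + fls_X) ?g = 1 + fps_to_fls ?g"
      using g by (simp add: fls_compose_fps_add)
    have "fls_compose_fps (taylor C) ?g = (\<Sum>h | C h \<noteq> 0. fls_const (C h) * ?B (of_int h / of_nat N))"
      unfolding taylor_def fls_compose_fps_sum[OF g] fls_compose_fps_mult[OF g] fls_compose_fps_powi[OF g] X1
        one_plus_root_series[OF N] by simp
    moreover have "fls_compose_fps (taylor C) ?g = fls_X ^ k * fls_compose_fps I ?g"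
      unfolding C_def k1(2)[OF k] fls_compose_fps_mult[OF g] fls_compose_fps_power[OF g] fls_compose_fps_diff[OF g]
        X1 fls_compose_fps_1 one_plus_root_series(2)[OF N] ..
    ultimately have IX: "fls_X ^ k * fls_compose_fps I ?g = (\<Sum>h | C h \<noteq> 0. fls_const (C h) * ?B (of_int h / of_nat N))"
      by simp
    have sh: "Sum_any (\<lambda>h. C (h - e) * x h) = (\<Sum>h | C h \<noteq> 0. C h * x (h + e))" for x
    proof -
      have "Sum_any (\<lambda>h. C (h - e) * x h) = Sum_any (\<lambda>h. C h * x (h + e))"
        by (rule Sum_any.reindex_cong[of "\<lambda>h. h + e"])
          (auto simp: fun_eq_iff bij_def inj_def surj_def intro: exI[of _ "_ - e"])
      also have "\<dots> = (\<Sum>h | C h \<noteq> 0. C h * x (h + e))"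
        by (rule Sum_any.expand_superset) (use fin in auto)
      finally show ?thesis .
    qed
    show "(\<lambda>c. fls_nth (?B (of_int e / of_nat N) * fls_compose_fps I ?g) c)
      = root_taylor N k (diff_act N k (\<lambda>h. A (h - e)))"
    proof
      fix c
      have "fls_nth (?B (of_int e / of_nat N) * fls_compose_fps I ?g) c
        = fls_nth (fls_X ^ k * (?B (of_int e / of_nat N) * fls_compose_fps I ?g)) (c + int k)"
        by (simp add: fls_X_power_times_conv_shift)
      also have "fls_X ^ k * (?B (of_int e / of_nat N) * fls_compose_fps I ?g)
        = (\<Sum>h | C h \<noteq> 0. fls_const (C h) * (?B (of_int h / of_nat N) * ?B (of_int e / of_nat N)))"
        unfolding mult.left_commute[of "fls_X ^ k"] IX by (simp add: sum_distrib_left mult_ac)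
      also have "\<dots> = (\<Sum>h | C h \<noteq> 0. fls_const (C h) * ?B (of_int (h + e) / of_nat N))"
        unfolding fls_times_fps_to_fls[symmetric] fps_binomial_add_mult[symmetric] by (simp add: add_divide_distrib)
      also have "fls_nth \<dots> (c + int k) = root_taylor N k (\<lambda>h. C (h - e)) c"
        unfolding root_taylor_def sh by (simp add: fls_nth_sum)
      finally show "fls_nth (?B (of_int e / of_nat N) * fls_compose_fps I ?g) c
        = root_taylor N k (diff_act N k (\<lambda>h. A (h - e))) c"
        unfolding poly_act_shift C_def .
    qed
  qed
  then show ?thesis unfolding twisted_local_def
    using bounded_above_simps(3)[OF A] bounded_below_simps(3)[OF B] by blast
qed

section \<open>Quasi modules\<close>

abbreviation functional :: "(complex \<Rightarrow> 'w \<Rightarrow> 'w) \<Rightarrow> ('w::ab_group_add \<Rightarrow> complex) \<Rightarrow> bool" where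
  "functional s \<equiv> Vector_Spaces.linear s (*)"

lemma separating_functional:
  assumes "vector_space (s :: complex \<Rightarrow> 'w \<Rightarrow> 'w::ab_group_add)" and "w \<noteq> 0"
  shows "\<exists>l. functional s l \<and> l w \<noteq> 0"
proof -
  interpret W: vector_space s by fact
  interpret C: vector_space "(*) :: complex \<Rightarrow> complex \<Rightarrow> complex"
    by unfold_locales (simp_all add: algebra_simps)
  interpret vector_space_pair s "(*) :: complex \<Rightarrow> complex \<Rightarrow> complex" ..
  have "W.independent {w}" using assms(2) by simp
  then obtain l where "functional s l" "\<forall>x\<in>{w}. l x = 1"
    using linear_independent_extend[of "{w}" "\<lambda>_. 1"] by blast
  then show ?thesis by (intro exI[of _ l]) auto
qed

context G_phi_quasi_module
begin

text \<open>In total degree \<open>d\<close>, a functional turns the coefficients of the quasi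
  Jacobi identity into the hypothesis of \<open>taylor_of_residue_identity\<close>, where
  \<open>x1 = x2 (1 + X)\<close> and \<open>x0 = x2 X\<close>.\<close>

lemma quasi_module_residues:
  fixes d :: int and u v :: 'v and w :: 'w and l :: "'w \<Rightarrow> complex"
  assumes N: "N > 0" and l: "functional sW l"
  defines "A \<equiv> \<lambda>h. l (YW u (of_int h) (YW v (of_int (d - h)) w))"
    and "B \<equiv> \<lambda>h. l (YW v (of_int (d - h)) (YW u (of_int h) w))"
    and "I \<equiv> \<lambda>c. l (YW (mode u c v) (of_int (d - c)) w)"
  shows "bounded_above A" "bounded_below B" "fls_nth (Abs_fls I) c = I c"
    "\<exists>k1. \<forall>k\<ge>k1. diff_act N k A = diff_act N k B \<and>
      taylor (diff_act N k A) = ((1 + fls_X) ^ N - 1) ^ k * Abs_fls I"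
proof -
  note lin = linear_mapD[OF vertex_mapD(1)[OF module_vertex_map zero_less_one]]
    linear_mapD[OF vertex_mapD(2)[OF module_vertex_map zero_less_one]]
  note ll = linear_mapD[OF l]
  obtain bv bu where bv: "\<And>r::int. r < bv \<Longrightarrow> YW v (of_int r) w = 0"
    and bu: "\<And>r::int. r < bu \<Longrightarrow> YW u (of_int r) w = 0"
    using vertex_mapD(4)[OF module_vertex_map zero_less_one, of v w] vertex_mapD(4)[OF module_vertex_map zero_less_one, of u w]
    by auto
  obtain bm where bm: "\<And>r. r < bm \<Longrightarrow> mode u r v = 0" using mode_truncation by blast
  have "A h = 0" if "h > d - bv" for h using that bv[of "d - h"] by (simp add: A_def lin ll)
  then show A: "bounded_above A" by (auto simp: bounded_above_def)
  have "B h = 0" if "h < bu" for h using that bu[of h] by (simp add: B_def lin ll)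
  then show B: "bounded_below B" by (auto simp: bounded_below_def)
  show I: "fls_nth (Abs_fls I) c = I c" for c
    by (rule nth_Abs_fls_lower_bound[of bm]) (simp add: I_def bm lin ll)
  obtain k0 where qj: "quasi_jacobi V sW YW (x1N_minus_x2N N ^ k0) u v" using quasi_jacobi_power by blast
  let ?F = "\<lambda>p q::int. YW u (of_int p) (YW v (of_int q) w)"
  let ?G = "\<lambda>p q::int. YW v (of_int q) (YW u (of_int p) w)"
  \<comment> \<open>Multiplication by \<open>(x1^N - x2^N)^k0\<close> raises the total degree by
    \<open>N k0\<close>; in that degree it acts through \<open>y^N - 1\<close> alone.\<close>
  have lF: "l (diff_power_mult sW N k0 f p q) = diff_act N k0 (\<lambda>h. l (f h (d - h))) p"
    if "p + q = d + int (N * k0)" for f p q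
  proof -
    have "q - int (N * j) = d - (p - int (N * (k0 - j)))" if "j \<le> k0" for j
    proof -
      have "int (N * (k0 - j)) = int (N * k0) - int (N * j)"
        using that by (simp add: of_nat_diff right_diff_distrib)
      then show ?thesis using \<open>p + q = d + int (N * k0)\<close> by linarith
    qed
    then show ?thesis
      unfolding diff_power_mult_def poly_act_diff_poly_power ll by (intro sum.cong refl) simp
  qed
  have "expand_inf 1 m (diff_act N k0 A) p - expand_zero 1 m (diff_act N k0 B) p
      = fls_nth (fps_to_fls (fps_binomial (of_int (- p - 1))) * (((1 + fls_X) ^ N - 1) ^ k0 * Abs_fls I)) (- 1 - m)" for m p
  proof -
    \<comment> \<open>Dictated by homogeneity: both products on the left are then taken in total
      degree \<open>d + N k0\<close>.\<close>
    define q where "q = d + int (N * k0) + m - p"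
    have J: "Sum_any (\<lambda>i. sW ((of_int m gchoose i) * (- 1) ^ i) (diff_power_mult sW N k0 ?F (p - m + int i) (q - int i)))
      - Sum_any (\<lambda>i. sW ((- 1) powi m * ((of_int m gchoose i) * (- 1) ^ i)) (diff_power_mult sW N k0 ?G (p - int i) (q - m + int i)))
      = (\<Sum>j\<le>k0. sW (of_nat (k0 choose j) * (- 1) ^ j) (Sum_any (\<lambda>i.
        sW ((of_int (p - int (N * (k0 - j)) + int i) gchoose i) * (- 1) ^ i)
          (YW (mode u (- 1 - m - int i) v) (of_int (q + 1 + p - int (N * (k0 - j)) - int (N * j) + int i)) w))))"
      unfolding mode_def
      by (rule quasi_jacobi_components[OF W.vector_space_axioms module_vertex_map _ qj])
        (use mode_truncation[of u v] in \<open>simp add: mode_def\<close>)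
    let ?T1 = "\<lambda>i::nat. sW ((of_int m gchoose i) * (- 1) ^ i) (diff_power_mult sW N k0 ?F (p - m + int i) (q - int i))"
    let ?T2 = "\<lambda>i::nat. sW ((- 1) powi m * ((of_int m gchoose i) * (- 1) ^ i)) (diff_power_mult sW N k0 ?G (p - int i) (q - m + int i))"
    have f1: "finite {i. ?T1 i \<noteq> 0}"
    proof (rule finite_support_atMost)
      fix i assume i: "i > nat (q - bv)"
      have "?F x (q - int i - int (N * j)) = 0" for x j
      proof -
        have "q - int i - int (N * j) < bv" using i by linarith
        then have "YW v (of_int (q - int i - int (N * j))) w = 0" by (rule bv)
        then show ?thesis by (simp only: lin)
      qed
      then show "?T1 i = 0"
        unfolding diff_power_mult_def by (simp only: W.scale_zero_right sum.neutral_const)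
    qed
    have f2: "finite {i. ?T2 i \<noteq> 0}"
    proof (rule finite_support_atMost)
      fix i assume i: "i > nat (p - bu)"
      have "?G (p - int i - int (N * j)) x = 0" for x j
      proof -
        have "p - int i - int (N * j) < bu" using i by linarith
        then have "YW u (of_int (p - int i - int (N * j))) w = 0" by (rule bu)
        then show ?thesis by (simp only: lin)
      qed
      then show "?T2 i = 0"
        unfolding diff_power_mult_def by (simp only: W.scale_zero_right sum.neutral_const)
    qed
    have f3: "finite {i. sW ((of_int (p - t + int i) gchoose i) * (- 1) ^ i)
          (YW (mode u (- 1 - m - int i) v) (x i) w) \<noteq> 0}" for t x
    proof (rule finite_support_atMost)
      fix i assume i: "i > nat (- 1 - m - bm)"
      then have "mode u (- 1 - m - int i) v = 0" by (intro bm) linarith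
      then show "sW ((of_int (p - t + int i) gchoose i) * (- 1) ^ i) (YW (mode u (- 1 - m - int i) v) (x i) w) = 0"
        by (simp add: lin)
    qed
    have 1: "l (Sum_any ?T1) = expand_inf 1 m (diff_act N k0 A) p"
    proof -
      have "l (diff_power_mult sW N k0 ?F (p - m + int i) (q - int i)) = diff_act N k0 A (p - m + int i)" for i
        unfolding A_def by (rule lF) (simp add: q_def)
      then show ?thesis unfolding linear_Sum_any[OF l f1] expand_inf_def by (simp add: ll algebra_simps)
    qed
    have 2: "l (Sum_any ?T2) = expand_zero 1 m (diff_act N k0 B) p"
    proof -
      have "l (diff_power_mult sW N k0 ?G (p - int i) (q - m + int i)) = diff_act N k0 B (p - int i)" for i
        unfolding B_def by (rule lF) (simp add: q_def)
      then show ?thesis unfolding linear_Sum_any[OF l f2] expand_zero_def by (simp add: ll)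
    qed
    let ?t = "\<lambda>j. int (N * (k0 - j))"
    let ?c = "\<lambda>j. of_nat (k0 choose j) * (- 1) ^ j :: complex"
    have 3: "l (Sum_any (\<lambda>i. sW ((of_int (p - ?t j + int i) gchoose i) * (- 1) ^ i)
          (YW (mode u (- 1 - m - int i) v) (of_int (q + 1 + p - ?t j - int (N * j) + int i)) w)))
      = fls_nth (fps_to_fls (fps_binomial (of_int (?t j - p - 1))) * Abs_fls I) (- 1 - m)" if "j \<le> k0" for j
    proof -
      have x: "q + 1 + p - ?t j - int (N * j) + int i = d - (- 1 - m - int i)" for i
      proof -
        have "?t j = int (N * k0) - int (N * j)"
          using that by (simp add: of_nat_diff right_diff_distrib)
        then show ?thesis unfolding q_def by linarith
      qed
      have y: "(of_int (p - ?t j + int i) gchoose i) * (- 1) ^ i = (of_int (?t j - p - 1) gchoose i :: complex)" for i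
      proof -
        have e: "of_nat i - of_int (?t j - p - 1) - 1 = (of_int (p - ?t j + int i) :: complex)" by simp
        show ?thesis using gbinomial_negated_upper[of "of_int (?t j - p - 1) :: complex" i] unfolding e
          by (metis mult.commute)
      qed
      have Ii: "I c = l (YW (mode u c v) (of_int (d - c)) w)" for c by (simp add: I_def)
      have "l (Sum_any (\<lambda>i. sW ((of_int (p - ?t j + int i) gchoose i) * (- 1) ^ i)
          (YW (mode u (- 1 - m - int i) v) (of_int (q + 1 + p - ?t j - int (N * j) + int i)) w)))
        = Sum_any (\<lambda>i. l (sW ((of_int (p - ?t j + int i) gchoose i) * (- 1) ^ i)
          (YW (mode u (- 1 - m - int i) v) (of_int (q + 1 + p - ?t j - int (N * j) + int i)) w)))"
        by (rule linear_Sum_any[OF l f3])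
      also have "\<dots> = Sum_any (\<lambda>i. (of_int (?t j - p - 1) gchoose i) * fls_nth (Abs_fls I) (- 1 - m - int i))"
        by (rule Sum_any.cong) (simp only: ll y x I Ii)
      finally show ?thesis unfolding fls_times_fps_nth fps_binomial_nth .
    qed
    have "expand_inf 1 m (diff_act N k0 A) p - expand_zero 1 m (diff_act N k0 B) p
      = (\<Sum>j\<le>k0. ?c j * fls_nth (fps_to_fls (fps_binomial (of_int (?t j - p - 1))) * Abs_fls I) (- 1 - m))"
      unfolding 1[symmetric] 2[symmetric] ll(5)[symmetric] J ll(6) ll(2)
      by (intro sum.cong refl arg_cong2[where f = "(*)"] 3) simp
    also have "\<dots> = fls_nth ((\<Sum>j\<le>k0. fls_const (?c j) * fps_to_fls (fps_binomial (of_int (?t j - p - 1)))) * Abs_fls I) (- 1 - m)"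
      by (simp add: sum_distrib_right fls_nth_sum mult.assoc)
    \<comment> \<open>Through \<open>x1 = x2 (1 + X)\<close> the monomials of the polynomial
      reassemble to \<open>((1 + X)^N - 1)^k0\<close>.\<close>
    also have "(\<Sum>j\<le>k0. fls_const (?c j) * fps_to_fls (fps_binomial (of_int (?t j - p - 1))))
      = fps_to_fls (fps_binomial (of_int (- p - 1))) * ((1 + fls_X) ^ N - 1) ^ k0"
    proof -
      have e: "fps_to_fls (fps_binomial (of_int (?t j - p - 1)))
        = (fps_to_fls (fps_binomial (of_int (- p - 1))) :: complex fls) * ((1 + fls_X) ^ N) ^ (k0 - j)" for j
      proof -
        have "(of_int (?t j - p - 1) :: complex) = of_int (- p - 1) + of_nat (N * (k0 - j))" by simp
        then have "fps_to_fls (fps_binomial (of_int (?t j - p - 1)))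
          = (fps_to_fls (fps_binomial (of_int (- p - 1))) :: complex fls) * fps_to_fls (fps_binomial (of_nat (N * (k0 - j))))"
          by (simp only: fps_binomial_add_mult fls_times_fps_to_fls)
        also have "fps_to_fls (fps_binomial (of_nat (N * (k0 - j)))) = (((1 + fls_X) ^ N) ^ (k0 - j) :: complex fls)"
          unfolding fps_binomial_of_nat by (simp add: fps_to_fls_power power_mult)
        finally show ?thesis .
      qed
      have c: "fls_const (?c j) = of_nat (k0 choose j) * (- 1) ^ j" for j
        by (cases "even j") (simp_all add: fls_of_nat)
      have "(\<Sum>j\<le>k0. fls_const (?c j) * fps_to_fls (fps_binomial (of_int (?t j - p - 1))))
        = fps_to_fls (fps_binomial (of_int (- p - 1))) * (\<Sum>j\<le>k0. of_nat (k0 choose j) * (- 1) ^ j * ((1 + fls_X) ^ N) ^ (k0 - j))"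
        unfolding e c sum_distrib_left by (intro sum.cong refl) (simp only: mult_ac)
      also have "(\<Sum>j\<le>k0. of_nat (k0 choose j) * (- 1) ^ j * ((1 + fls_X) ^ N) ^ (k0 - j)) = (- 1 + (1 + fls_X :: complex fls) ^ N) ^ k0"
        by (rule binomial_ring[symmetric])
      finally show ?thesis by simp
    qed
    finally show ?thesis by (simp only: mult.assoc)
  qed
  then show "\<exists>k1. \<forall>k\<ge>k1. diff_act N k A = diff_act N k B \<and>
      taylor (diff_act N k A) = ((1 + fls_X) ^ N - 1) ^ k * Abs_fls I"
    by (rule taylor_of_residue_identity[OF N A B])
qed

end

section \<open>The operator Delta on homogeneous vectors\<close>

context vertex_operator_algebra
begin

lemma weight_op_add: "weight_op V c (u + v) = weight_op V c u + weight_op V c v"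
proof -
  have "finite {n. sV (c n) (hcomp V x n) \<noteq> 0}" for x
    by (rule finite_subset[OF _ hcomp(2)[of x]]) auto
  then show ?thesis by (simp add: weight_op_def hcomp_add scale_right_distrib Sum_any.distrib)
qed

lemma weight_op_grade: "u \<in> grade V n \<Longrightarrow> weight_op V c u = sV (c n) u"
proof -
  assume u: "u \<in> grade V n"
  have "weight_op V c u = Sum_any (\<lambda>m. if m = n then sV (c m) u else 0)"
    unfolding weight_op_def hcomp_grade[OF u] by (rule Sum_any.cong) simp
  then show ?thesis by simp
qed

lemma weight_op_0: "weight_op V c 0 = 0"
  using weight_op_grade[OF grade_zero[of 0], of c] by simp

lemma x_pow_L0_add: "x_pow_L0 V N (u + v) r = x_pow_L0 V N u r + x_pow_L0 V N v r"
proof -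
  have fin: "finite {n. (if r = (1 / real N - 1) * real_of_int n then hcomp V x n else 0) \<noteq> 0}" for x
    by (rule finite_subset[OF _ hcomp(2)[of x]]) auto
  have "x_pow_L0 V N (u + v) r = Sum_any (\<lambda>n. (if r = (1 / real N - 1) * real_of_int n then hcomp V u n else 0)
      + (if r = (1 / real N - 1) * real_of_int n then hcomp V v n else 0))"
    unfolding x_pow_L0_def hcomp_add by (rule Sum_any.cong) simp
  then show ?thesis unfolding x_pow_L0_def Sum_any.distrib[OF fin fin] .
qed

lemma x_pow_L0_grade:
  assumes "u \<in> grade V n"
  shows "x_pow_L0 V N u r = (if r = (1 / real N - 1) * real_of_int n then u else 0)"
proof -
  have "x_pow_L0 V N u r = Sum_any (\<lambda>m. if m = n then (if r = (1 / real N - 1) * real_of_int m then u else 0) else 0)"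
    unfolding x_pow_L0_def hcomp_grade[OF assms] by (rule Sum_any.cong) simp
  then show ?thesis by simp
qed

definition Delta_arg :: "nat \<Rightarrow> 'v \<Rightarrow> real \<Rightarrow> 'v" where
  "Delta_arg N u r = weight_op V (\<lambda>n. of_nat N powi (- n)) (x_pow_L0 V N u r)"

lemma Delta_arg_add: "Delta_arg N (u + v) r = Delta_arg N u r + Delta_arg N v r"
  by (simp add: Delta_arg_def x_pow_L0_add weight_op_add)

lemma Delta_arg_grade:
  assumes "u \<in> grade V n"
  shows "Delta_arg N u r = (if r = (1 / real N - 1) * real_of_int n then sV (of_nat N powi (- n)) u else 0)"
  using assms by (simp add: Delta_arg_def x_pow_L0_grade weight_op_grade weight_op_0)

lemma Delta_arg_bounded: "\<exists>R. \<forall>r>R. Delta_arg N u r = 0"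
proof (induction u rule: homogeneous_induct)
  case (grade n u)
  then have "\<forall>r>(1 / real N - 1) * real_of_int n. Delta_arg N u r = 0" by (simp add: Delta_arg_grade)
  then show ?case by blast
next
  case (add u v)
  then obtain R R' where "\<forall>r>R. Delta_arg N u r = 0" "\<forall>r>R'. Delta_arg N v r = 0" by blast
  then have "\<forall>r>max R R'. Delta_arg N (u + v) r = 0" by (simp add: Delta_arg_add)
  then show ?case by blast
qed

lemma Delta_arg_bound: "\<exists>J::nat. \<forall>j>J. Delta_arg N u (r + real j / real N) = 0" if N: "N > 0"
proof -
  obtain R where R: "\<forall>r>R. Delta_arg N u r = 0" using Delta_arg_bounded by blast
  have "Delta_arg N u (r + real j / real N) = 0" if "j > nat \<lceil>real N * (R - r)\<rceil>" for j
  proof -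
    have "real j > real N * (R - r)" using that by linarith
    then have "r + real j / real N > R" using N by (simp add: field_simps)
    then show ?thesis using R by blast
  qed
  then show ?thesis by blast
qed

text \<open>Each \<open>L(n)\<close> comes with \<open>x^(-n/N)\<close>, so the exponent of
  \<open>x\<close> records the total drop in weight: the coefficient at \<open>r\<close> collects
  the values of \<open>f\<close> at \<open>r + j/N\<close>, lowered by \<open>j\<close>. The factor
  \<open>k!\<close> undoes the divided power in \<open>exp_part\<close>.\<close>

lemma vir_sum_power:
  assumes a: "a 0 = 0"
  shows "(\<And>j. j > J \<Longrightarrow> f (r + real j / real N) = 0) \<Longrightarrow>
    (vir_sum V N a ^^ k) f r = sV (fact k) (\<Sum>j\<le>J. exp_part a k j (f (r + real j / real N)))"
proof (induction k arbitrary: r J)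
  case 0
  have "(\<Sum>j\<le>J. exp_part a 0 j (f (r + real j / real N))) = (\<Sum>j\<in>{0}. exp_part a 0 j (f (r + real j / real N)))"
    by (rule sum.mono_neutral_right) auto
  then show ?case by simp
next
  case (Suc k)
  let ?g = "(vir_sum V N a ^^ k) f"
  have add: "r + real n / real N + real j / real N = r + real (n + j) / real N" for n j
    by (simp add: add_divide_distrib)
  have g: "?g (r + real n / real N) = sV (fact k) (\<Sum>j\<le>J - n. exp_part a k j (f (r + real (n + j) / real N)))" for n
    unfolding add[symmetric] by (rule Suc.IH) (unfold add, rule Suc.prems, linarith)
  have g0: "?g (r + real n / real N) = 0" if "n > J" for n
    unfolding g using that Suc.prems by (simp add: linear_mapD(3)[OF exp_part_linear])
  have "(vir_sum V N a ^^ Suc k) f r = Sum_any (\<lambda>n. sV (a n) (Vir V (int n) (?g (r + real n / real N))))"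
    unfolding funpow.simps comp_apply vir_sum_def[of V N a ?g]
  proof (rule Sum_any.cong)
    fix n
    show "(if n \<ge> 1 then sV (a n) (Vir V (int n) (?g (r + real n / real N))) else 0)
      = sV (a n) (Vir V (int n) (?g (r + real n / real N)))"
      using a by (cases n) simp_all
  qed
  also have "\<dots> = (\<Sum>n\<le>J. sV (a n) (Vir V (int n) (?g (r + real n / real N))))"
    by (rule Sum_any_atMost) (simp add: g0 Vir_linear)
  also have "\<dots> = (\<Sum>n\<le>J. \<Sum>j\<le>J - n. sV (fact k) (sV (a n) (Vir V (int n) (exp_part a k j (f (r + real (n + j) / real N))))))"
    unfolding g Vir_linear scale_sum_right by (simp add: mult.commute)
  also have "\<dots> = (\<Sum>q\<le>J. \<Sum>n\<le>q. sV (fact k) (sV (a n) (Vir V (int n) (exp_part a k (q - n) (f (r + real (n + (q - n)) / real N))))))"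
    by (rule sum_triangle_diagonal)
  also have "\<dots> = (\<Sum>q\<le>J. sV (fact k) (\<Sum>n\<le>q. sV (a n) (Vir V (int n) (exp_part a k (q - n) (f (r + real q / real N))))))"
    unfolding scale_sum_right by (intro sum.cong refl) simp
  also have "\<dots> = (\<Sum>q\<le>J. sV (fact (Suc k)) (exp_part a (Suc k) q (f (r + real q / real N))))"
  proof (intro sum.cong refl)
    fix q
    have "sV (fact (Suc k)) x = sV (fact k) (sV (of_nat (Suc k)) x)" for x
      by (simp add: mult.commute)
    then show "sV (fact k) (\<Sum>n\<le>q. sV (a n) (Vir V (int n) (exp_part a k (q - n) (f (r + real q / real N)))))
      = sV (fact (Suc k)) (exp_part a (Suc k) q (f (r + real q / real N)))"
      by (simp only: exp_part_Suc)
  qed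
  finally show ?case by (simp only: scale_sum_right)
qed

lemma exp_vir_sum_eq:
  assumes a: "a 0 = 0" and J: "\<And>j. j > J \<Longrightarrow> f (r + real j / real N) = 0"
  shows "exp_vir_sum V N a f r = (\<Sum>j\<le>J. exp_comp a j (f (r + real j / real N)))"
proof -
  have "exp_vir_sum V N a f r = Sum_any (\<lambda>k. \<Sum>j\<le>J. exp_part a k j (f (r + real j / real N)))"
    unfolding exp_vir_sum_def
    by (rule Sum_any.cong, subst vir_sum_power[of a J f r N, OF a J]) auto
  also have "\<dots> = (\<Sum>k\<le>J. \<Sum>j\<le>J. exp_part a k j (f (r + real j / real N)))"
    by (rule Sum_any_atMost) (auto intro!: sum.neutral exp_part_low[of a, OF a])
  also have "\<dots> = (\<Sum>j\<le>J. \<Sum>k\<le>J. exp_part a k j (f (r + real j / real N)))" by (rule sum.swap)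
  also have "\<dots> = (\<Sum>j\<le>J. exp_comp a j (f (r + real j / real N)))"
    by (intro sum.cong refl exp_comp_sum[of a, OF a]) simp
  finally show ?thesis .
qed

lemma Delta_eq:
  assumes a: "a 0 = 0" and J: "\<And>j. j > J \<Longrightarrow> Delta_arg N u (r + real j / real N) = 0"
  shows "Delta V N a u r = (\<Sum>j\<le>J. exp_comp a j (Delta_arg N u (r + real j / real N)))"
  unfolding Delta_def Delta_arg_def[symmetric, abs_def]
  using exp_vir_sum_eq[of a J "Delta_arg N u" r N, OF a J] by (simp add: Delta_arg_def[abs_def])

lemma Delta_add:
  assumes a: "a 0 = 0" and N: "N > 0"
  shows "Delta V N a (u + v) r = Delta V N a u r + Delta V N a v r"
proof -
  obtain J J' where J: "\<And>j. j > J \<Longrightarrow> Delta_arg N u (r + real j / real N) = 0"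
    "\<And>j. j > J' \<Longrightarrow> Delta_arg N v (r + real j / real N) = 0"
    using Delta_arg_bound[OF N, of u r] Delta_arg_bound[OF N, of v r] by auto
  show ?thesis
    by (simp add: Delta_eq[of a "max J J'" N, OF a] J Delta_arg_add exp_comp_lin(1) sum.distrib)
qed

text \<open>In weight \<open>n\<close> the argument of the exponential sits at the single exponent
  \<open>(1/N - 1) n\<close>, and a drop by \<open>j\<close> subtracts \<open>j/N\<close>, so
  contributions of different \<open>j\<close> never meet.\<close>

lemma Delta_grade:
  assumes a: "a 0 = 0" and N: "N > 0" and u: "u \<in> grade V n"
  shows "Delta V N a u (of_int (weight_exp N n j) / real N) = sV (of_nat N powi (- n)) (exp_comp a j u)"
    and "(\<And>j. s \<noteq> of_int (weight_exp N n j) / real N) \<Longrightarrow> Delta V N a u s = 0"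
proof -
  let ?u = "sV (of_nat N powi (- n)) u"
  have e: "s + real i / real N = (1 / real N - 1) * real_of_int n \<longleftrightarrow> s = of_int (weight_exp N n i) / real N" for s i
    using N by (simp add: weight_exp_def field_simps)
  have arg: "Delta_arg N u (s + real i / real N) = (if s = of_int (weight_exp N n i) / real N then ?u else 0)" for s i
    unfolding Delta_arg_grade[OF u] e ..
  show "Delta V N a u s = 0" if "\<And>j. s \<noteq> of_int (weight_exp N n j) / real N"
  proof -
    have z: "Delta_arg N u (s + real i / real N) = 0" for i using that arg by metis
    show ?thesis using Delta_eq[of a 0 N u s, OF a z] z[of 0] by (simp add: exp_comp_lin(3))
  qed
  have inj: "of_int (weight_exp N n j) / real N = of_int (weight_exp N n i) / real N \<longleftrightarrow> i = j" for i
    using N by (auto simp: weight_exp_def)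
  have "Delta V N a u (of_int (weight_exp N n j) / real N) = (\<Sum>i\<le>j. exp_comp a i (if i = j then ?u else 0))"
  proof -
    have "Delta_arg N u (of_int (weight_exp N n j) / real N + real i / real N) = (if i = j then ?u else 0)" for i
      unfolding arg inj ..
    then show ?thesis using Delta_eq[of a j N u "of_int (weight_exp N n j) / real N", OF a] by simp
  qed
  also have "\<dots> = (\<Sum>i\<in>{j}. exp_comp a i (if i = j then ?u else 0))"
    by (rule sum.mono_neutral_right) (auto simp: exp_comp_lin(3))
  finally show "Delta V N a u (of_int (weight_exp N n j) / real N) = sV (of_nat N powi (- n)) (exp_comp a j u)"
    by (simp add: exp_comp_lin(2))
qed

lemma Delta_scale:
  assumes a: "a 0 = 0" and N: "N > 0"
  shows "Delta V N a (sV c u) r = sV c (Delta V N a u r)"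
proof (induction u rule: homogeneous_induct)
  case (grade n u)
  have cu: "sV c u \<in> grade V n" using grade by (rule grade_closed)
  show ?case
  proof (cases "\<exists>j. r = of_int (weight_exp N n j) / real N")
    case True
    then obtain j where r: "r = of_int (weight_exp N n j) / real N" by blast
    show ?thesis unfolding r Delta_grade(1)[of a, OF a N grade] Delta_grade(1)[of a, OF a N cu]
      by (simp add: exp_comp_lin(2) mult.commute)
  next
    case False
    then show ?thesis by (simp add: Delta_grade(2)[of a, OF a N grade] Delta_grade(2)[of a, OF a N cu])
  qed
next
  case (add u v)
  then show ?case by (simp add: scale_right_distrib Delta_add[of a, OF a N])
qed

lemma Delta_finite:
  assumes a: "a 0 = 0" and N: "N > 0"
  shows "finite {s. Delta V N a u s \<noteq> 0}"
proof (induction u rule: homogeneous_induct)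
  case (grade n u)
  obtain J where J: "\<forall>j>J. exp_comp a j u = 0" using exp_comp_eventually_zero[OF grade] by blast
  have "{s. Delta V N a u s \<noteq> 0} \<subseteq> (\<lambda>j. of_int (weight_exp N n j) / real N) ` {..J}"
  proof
    fix s assume s: "s \<in> {s. Delta V N a u s \<noteq> 0}"
    then obtain j where j: "s = of_int (weight_exp N n j) / real N"
      using Delta_grade(2)[of a, OF a N grade] by blast
    with s have "exp_comp a j u \<noteq> 0" using Delta_grade(1)[of a, OF a N grade, of j] by auto
    then have "j \<le> J" using J not_le by blast
    then show "s \<in> (\<lambda>j. of_int (weight_exp N n j) / real N) ` {..J}" using j by blast
  qed
  then show ?case by (rule finite_subset) simp
next
  case (add u v)
  show ?case
    by (rule finite_subset[OF _ finite_UnI[OF add]]) (auto simp: Delta_add[of a, OF a N])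
qed

end

text \<open>With \<open>q = i + \<delta> + j\<close> and \<open>p = i + \<delta>\<close> the nested
  sum runs over a simplex, which contains the box supporting \<open>T\<close>.\<close>

lemma triple_sum:
  fixes T :: "nat \<Rightarrow> nat \<Rightarrow> nat \<Rightarrow> 'b::comm_monoid_add"
  assumes T: "\<And>i \<delta> j. \<not> (i \<le> I \<and> \<delta> \<le> D \<and> j \<le> J) \<Longrightarrow> T i \<delta> j = 0" and K: "K \<ge> I + D + J"
  shows "(\<Sum>q\<le>K. \<Sum>p\<le>q. \<Sum>i\<le>p. T i (p - i) (q - p)) = (\<Sum>i\<le>I. \<Sum>j\<le>J. \<Sum>\<delta>\<le>D. T i \<delta> j)"
proof -
  let ?S = "SIGMA q:{..K}. SIGMA p:{..q}. {..p}"
  have "(\<Sum>q\<le>K. \<Sum>p\<le>q. \<Sum>i\<le>p. T i (p - i) (q - p)) = (\<Sum>(q, p, i)\<in>?S. T i (p - i) (q - p))"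
    by (simp add: sum.Sigma)
  also have "\<dots> = (\<Sum>(i, j, \<delta>)\<in>{(i, j, \<delta>). i + j + \<delta> \<le> K}. T i \<delta> j)"
    by (rule sum.reindex_bij_witness[where i = "\<lambda>(i, j, \<delta>). (i + j + \<delta>, i + \<delta>, i)" and j = "\<lambda>(q, p, i). (i, q - p, p - i)"])
      auto
  also have "\<dots> = (\<Sum>(i, j, \<delta>)\<in>{..I} \<times> {..J} \<times> {..D}. T i \<delta> j)"
  proof (rule sum.mono_neutral_right)
    have "{(i, j, \<delta>). i + j + \<delta> \<le> K} \<subseteq> {..K} \<times> {..K} \<times> {..K}" by auto
    then show "finite {(i, j, \<delta>). i + j + \<delta> \<le> K}" by (rule finite_subset) simp
    show "{..I} \<times> {..J} \<times> {..D} \<subseteq> {(i, j, \<delta>). i + j + \<delta> \<le> K}" using K by auto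
    show "\<forall>x\<in>{(i, j, \<delta>). i + j + \<delta> \<le> K} - {..I} \<times> {..J} \<times> {..D}. (case x of (i, j, \<delta>) \<Rightarrow> T i \<delta> j) = 0"
      using T by auto
  qed
  also have "\<dots> = (\<Sum>i\<le>I. \<Sum>j\<le>J. \<Sum>\<delta>\<le>D. T i \<delta> j)"
    by (simp add: sum.cartesian_product)
  finally show ?thesis .
qed

section \<open>The twisted vertex operators\<close>

text \<open>\<open>a 0 = 0\<close> fixes the one value that the coordinate change leaves open, so
  that sums over Virasoro modes may start at \<open>n = 0\<close>.\<close>

locale Delta_twist = G_phi_quasi_module V N G \<phi> sW YW
  for V :: "'v::ab_group_add voa" and N :: nat and G :: "('v \<Rightarrow> 'v) monoid"
    and \<phi> :: "('v \<Rightarrow> 'v) \<Rightarrow> complex"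
    and sW :: "complex \<Rightarrow> 'w::ab_group_add \<Rightarrow> 'w" and YW :: "'v \<Rightarrow> real \<Rightarrow> 'w \<Rightarrow> 'w" +
  fixes a :: "nat \<Rightarrow> complex"
  assumes a0: "a 0 = 0" and N0: "N > 0"
    and exp_a: "root_coordinate N a"
begin

abbreviation Yb where "Yb \<equiv> twisted_map V N a YW"

lemmas YW_lin = linear_mapD[OF vertex_mapD(1)[OF module_vertex_map zero_less_one]]
  and YW_lin' = linear_mapD[OF vertex_mapD(2)[OF module_vertex_map zero_less_one]]

lemmas Delta_add' = Delta_add[of a, OF a0 N0] and Delta_scale' = Delta_scale[of a, OF a0 N0]
  and Delta_finite' = Delta_finite[of a, OF a0 N0]

lemma Yb_support: "finite {s. YW (Delta V N a u s) (x s) w \<noteq> 0}"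
  by (rule finite_subset[OF _ Delta_finite'[of u]]) (auto simp: YW_lin)

lemma Yb_linear_left: "Vector_Spaces.linear sV sW (\<lambda>v. Yb v r w)"
proof (rule linear_mapI[OF vector_space_axioms W.vector_space_axioms])
  fix u v c
  show "Yb (u + v) r w = Yb u r w + Yb v r w"
    unfolding twisted_map_def Delta_add' YW_lin by (rule Sum_any.distrib[OF Yb_support Yb_support])
  show "Yb (sV c u) r w = sW c (Yb u r w)"
    unfolding twisted_map_def Delta_scale' YW_lin
    by (rule linear_Sum_any[OF W.linear_scale_self Yb_support, symmetric])
qed

lemma Yb_linear_right: "Vector_Spaces.linear sW sW (Yb u r)"
proof (rule linear_mapI[OF W.vector_space_axioms W.vector_space_axioms])
  fix w w' c
  show "Yb u r (w + w') = Yb u r w + Yb u r w'"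
    unfolding twisted_map_def YW_lin' by (rule Sum_any.distrib[OF Yb_support Yb_support])
  show "Yb u r (sW c w) = sW c (Yb u r w)"
    unfolding twisted_map_def YW_lin'
    by (rule linear_Sum_any[OF W.linear_scale_self Yb_support, symmetric])
qed

lemma Yb_grade:
  assumes u: "u \<in> grade V n" and J: "\<And>j. j > J \<Longrightarrow> exp_comp a j u = 0"
  shows "Yb u r w = sW (of_nat N powi (- n)) (\<Sum>j\<le>J. YW (exp_comp a j u) (real N * r - of_int (weight_exp N n j)) w)"
proof -
  let ?s = "\<lambda>j. of_int (weight_exp N n j) / real N"
  have "Yb u r w = Sum_any (\<lambda>j. YW (Delta V N a u (?s j)) (real N * (r - ?s j)) w)"
    unfolding twisted_map_def
  proof (rule Sum_any_reindex)
    show "inj ?s" using N0 by (auto intro!: injI simp: weight_exp_def)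
    fix d assume "d \<notin> range ?s"
    then have "Delta V N a u d = 0" by (intro Delta_grade(2)[of a, OF a0 N0 u]) blast
    then show "YW (Delta V N a u d) (real N * (r - d)) w = 0" by (simp add: YW_lin)
  qed
  also have "\<dots> = Sum_any (\<lambda>j. sW (of_nat N powi (- n)) (YW (exp_comp a j u) (real N * r - of_int (weight_exp N n j)) w))"
  proof (rule Sum_any.cong)
    fix j
    have "real N * (r - ?s j) = real N * r - of_int (weight_exp N n j)" using N0 by (simp add: right_diff_distrib)
    then show "YW (Delta V N a u (?s j)) (real N * (r - ?s j)) w
      = sW (of_nat N powi (- n)) (YW (exp_comp a j u) (real N * r - of_int (weight_exp N n j)) w)"
      by (simp only: Delta_grade(1)[of a, OF a0 N0 u] YW_lin)
  qed
  also have "\<dots> = (\<Sum>j\<le>J. sW (of_nat N powi (- n)) (YW (exp_comp a j u) (real N * r - of_int (weight_exp N n j)) w))"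
    by (rule Sum_any_atMost) (simp add: J YW_lin)
  finally show ?thesis by (simp only: W.scale_sum_right)
qed

lemma Yb_grade_int:
  assumes u: "u \<in> grade V n" and J: "\<And>j. j > J \<Longrightarrow> exp_comp a j u = 0"
  shows "Yb u (of_int h / real N) w = sW (of_nat N powi (- n)) (\<Sum>j\<le>J. YW (exp_comp a j u) (of_int (h - weight_exp N n j)) w)"
  using N0 by (simp add: Yb_grade[OF u J])

lemma Yb_laurent: "(\<lambda>r. Yb u r w) \<in> laurent_series N"
proof -
  have "(\<forall>r. real N * r \<notin> \<int> \<longrightarrow> Yb u r w = 0) \<and> (\<exists>b. \<forall>r<b. Yb u r w = 0)"
  proof (induction u rule: homogeneous_induct)
    case (grade n u)
    obtain J where J: "\<And>j. j > J \<Longrightarrow> exp_comp a j u = 0" using exp_comp_eventually_zero[OF grade] by blast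
    have "Yb u r w = 0" if "real N * r \<notin> \<int>" for r
    proof -
      have "real N * r - of_int (weight_exp N n j) \<notin> \<int>" for j
        using that by (metis Ints_add Ints_of_int diff_add_cancel)
      then have "YW (exp_comp a j u) (real N * r - of_int (weight_exp N n j)) w = 0" for j
        using vertex_mapD(3)[OF module_vertex_map zero_less_one] by simp
      then show ?thesis by (simp add: Yb_grade[OF grade J])
    qed
    moreover have "\<exists>b. \<forall>r<b. Yb u r w = 0"
    proof -
      have "\<forall>j. \<exists>b. \<forall>r<b. YW (exp_comp a j u) r w = 0"
        using module_vertex_map by (auto simp: vertex_map_def laurent_series_def)
      then obtain b where b: "\<And>j r. r < b j \<Longrightarrow> YW (exp_comp a j u) r w = 0" by metis
      \<comment> \<open>Only \<open>j <= J\<close> occur, so the minimum of finitely many truncation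
        bounds serves all of them.\<close>
      define c where "c = Min ((\<lambda>j. b j + of_int (weight_exp N n j)) ` {..J})"
      have "Yb u r w = 0" if "r < c / real N" for r
      proof -
        have "real N * r < c" using that N0 by (simp add: field_simps)
        moreover have "c \<le> b j + of_int (weight_exp N n j)" if "j \<le> J" for j
          unfolding c_def using that by (intro Min_le) auto
        ultimately have "real N * r - of_int (weight_exp N n j) < b j" if "j \<le> J" for j
          using that by (smt (verit))
        then show ?thesis by (simp add: Yb_grade[OF grade J] b)
      qed
      then show ?thesis by blast
    qed
    ultimately show ?case by blast
  next
    case (add u v)
    then obtain b b' where "\<And>r. r < b \<Longrightarrow> Yb u r w = 0" "\<And>r. r < b' \<Longrightarrow> Yb v r w = 0" by blast
    then have "\<forall>r<min b b'. Yb (u + v) r w = 0" by (simp add: linear_mapD(1)[OF Yb_linear_left])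
    moreover have "\<forall>r. real N * r \<notin> \<int> \<longrightarrow> Yb (u + v) r w = 0"
      using add by (simp add: linear_mapD(1)[OF Yb_linear_left])
    ultimately show ?case by blast
  qed
  then show ?thesis by (auto simp: laurent_series_def)
qed

lemma Yb_vertex_map: "vertex_map V sW N Yb"
  using Yb_linear_left Yb_linear_right Yb_laurent by (auto simp: vertex_map_def)

lemma Yb_vacuum: "Yb (vac V) r w = (if r = 0 then w else 0)"
proof -
  have "Yb (vac V) r w = YW (vac V) (real N * r) w"
    using Yb_grade[OF vac_grade, of 0 r w] by (simp add: exp_comp_vac weight_exp_def)
  then show ?thesis using N0 by (simp add: module_vacuum)
qed

text \<open>For homogeneous vectors both Delta terms are finite sums, and the statements for the
  pairs \<open>(i, j)\<close>, shifted by the exponent of \<open>z1\<close>, add up. The conjugation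
  formula identifies the resulting sum of iterates with the twisted operator of
  \<open>mode u c v\<close>.\<close>

lemma Yb_twisted_local_homogeneous:
  assumes u: "u \<in> grade V n" and v: "v \<in> grade V m"
    and l: "functional sW l"
  shows "twisted_local N (\<lambda>h. l (Yb u (of_int h / real N) (Yb v (of_int (d - h) / real N) w)))
    (\<lambda>h. l (Yb v (of_int (d - h) / real N) (Yb u (of_int h / real N) w)))
    (\<lambda>c. l (Yb (mode u c v) (of_int (d - int N * c) / real N) w))"
proof -
  let ?Du = "\<lambda>i. exp_comp a i u" and ?Dv = "\<lambda>j. exp_comp a j v"
  define e where "e i = weight_exp N n i" for i
  define f where "f j = weight_exp N m j" for j
  note ll = linear_mapD[OF l]
  obtain I where I: "\<And>i. i > I \<Longrightarrow> ?Du i = 0" using exp_comp_eventually_zero[OF u] by blast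
  obtain J where J: "\<And>j. j > J \<Longrightarrow> ?Dv j = 0" using exp_comp_eventually_zero[OF v] by blast
  \<comment> \<open>The total degree left for the pair once the powers of \<open>z1\<close> and
    \<open>z2\<close> in the two Delta terms are removed.\<close>
  define dd where "dd i j = d - e i - f j" for i j
  define A where "A i j h = l (YW (?Du i) (of_int h) (YW (?Dv j) (of_int (dd i j - h)) w))" for i j h
  define B where "B i j h = l (YW (?Dv j) (of_int (dd i j - h)) (YW (?Du i) (of_int h) w))" for i j h
  define It where "It i j c = l (YW (mode (?Du i) c (?Dv j)) (of_int (dd i j - c)) w)" for i j c
  define F where "F i j c = fls_nth (fps_to_fls (fps_binomial (of_int (e i) / of_nat N))
    * fls_compose_fps (Abs_fls (It i j)) (root_series N)) c" for i j c
  let ?k = "of_nat N powi (- n) * of_nat N powi (- m) :: complex"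
  have "twisted_local N (\<lambda>h. A i j (h - e i)) (\<lambda>h. B i j (h - e i)) (F i j)" for i j
    unfolding F_def
    using quasi_module_residues[OF N0 l, where u = "?Du i" and v = "?Dv j" and d = "dd i j" and w = w]
    by (intro taylor_root[OF N0]) (simp_all only: A_def[symmetric, abs_def] B_def[symmetric, abs_def] It_def[symmetric, abs_def])
  then have main: "twisted_local N (\<lambda>h. ?k * (\<Sum>i\<le>I. \<Sum>j\<le>J. A i j (h - e i)))
      (\<lambda>h. ?k * (\<Sum>i\<le>I. \<Sum>j\<le>J. B i j (h - e i))) (\<lambda>c. ?k * (\<Sum>i\<le>I. \<Sum>j\<le>J. F i j c))"
    by (intro twisted_local_scale twisted_local_sum)
  have Yu: "Yb u (of_int h / real N) w = sW (of_nat N powi (- n)) (\<Sum>i\<le>I. YW (?Du i) (of_int (h - e i)) w)" for h w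
    unfolding e_def by (rule Yb_grade_int[OF u]) (rule I)
  have Yv: "Yb v (of_int h / real N) w = sW (of_nat N powi (- m)) (\<Sum>j\<le>J. YW (?Dv j) (of_int (h - f j)) w)" for h w
    unfolding f_def by (rule Yb_grade_int[OF v]) (rule J)
  have d1: "d - h - f j = dd i j - (h - e i)" for h i j by (simp add: dd_def)
  have 1: "l (Yb u (of_int h / real N) (Yb v (of_int (d - h) / real N) w)) = ?k * (\<Sum>i\<le>I. \<Sum>j\<le>J. A i j (h - e i))" for h
    unfolding Yu Yv A_def d1[symmetric]
    by (simp add: YW_lin' ll sum_distrib_left mult.assoc del: of_int_diff)
  have 2: "l (Yb v (of_int (d - h) / real N) (Yb u (of_int h / real N) w)) = ?k * (\<Sum>i\<le>I. \<Sum>j\<le>J. B i j (h - e i))" for h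
  proof -
    have "l (Yb v (of_int (d - h) / real N) (Yb u (of_int h / real N) w)) = ?k * (\<Sum>j\<le>J. \<Sum>i\<le>I. B i j (h - e i))"
      unfolding Yu Yv B_def d1[symmetric]
      by (simp add: YW_lin' ll sum_distrib_left mult.assoc mult.left_commute del: of_int_diff)
    then show ?thesis by (subst (asm) sum.swap)
  qed
  have 3: "l (Yb (mode u c v) (of_int (d - int N * c) / real N) w) = ?k * (\<Sum>i\<le>I. \<Sum>j\<le>J. F i j c)" for c
  proof -
    obtain b where b: "\<forall>n<b. \<forall>u\<in>grade V n. u = 0" using grade_trivial by blast
    \<comment> \<open>The mode index lowers the weight by \<open>\<delta>\<close>, and weights are
      bounded below; the bound is uniform in \<open>i\<close> and \<open>j\<close>.\<close>
    define D where "D = nat (n + m + c - b)"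
    have Dz: "mode (?Du i) (c - int \<delta>) (?Dv j) = 0" if "\<delta> > D" for i j \<delta>
    proof -
      have "mode (?Du i) (c - int \<delta>) (?Dv j) \<in> grade V (n - int i + (m - int j) + (c - int \<delta>))"
        by (intro mode_grade exp_comp_grade u v)
      moreover have "n - int i + (m - int j) + (c - int \<delta>) < b" using that unfolding D_def by linarith
      ultimately show ?thesis using b by blast
    qed
    have uv: "mode u c v \<in> grade V (n + m + c)" by (rule mode_grade[OF u v])
    obtain K' where K': "\<And>q. q > K' \<Longrightarrow> exp_comp a q (mode u c v) = 0" using exp_comp_eventually_zero[OF uv] by blast
    define K where "K = max K' (I + D + J)"
    have K: "\<And>q. q > K \<Longrightarrow> exp_comp a q (mode u c v) = 0" "K \<ge> I + D + J" using K' by (auto simp: K_def)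
    \<comment> \<open>One term of the conjugation formula: \<open>i\<close> and \<open>j\<close> are
      the drops in weight of \<open>u\<close> and \<open>v\<close>, \<open>\<delta>\<close> is that
      of the mode index.\<close>
    define T where "T i \<delta> j = root_coeff N (of_int (e i) / of_nat N) (c - int \<delta>) c * It i j (c - int \<delta>)" for i \<delta> j
    have Tz: "T i \<delta> j = 0" if "\<not> (i \<le> I \<and> \<delta> \<le> D \<and> j \<le> J)" for i \<delta> j
    proof -
      have "mode (?Du i) (c - int \<delta>) (?Dv j) = 0"
        using that I[of i] J[of j] Dz[of \<delta> i j] by (auto simp: mode_zero_left mode_zero not_le)
      then show ?thesis by (simp add: T_def It_def YW_lin ll)
    qed
    have "l (YW (exp_comp a q (mode u c v)) (of_int (d - int N * c - weight_exp N (n + m + c) q)) w)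
      = of_nat N powi c * (\<Sum>p\<le>q. \<Sum>i\<le>p. T i (p - i) (q - p))" for q
    proof -
      have lx: "l (YW (exp_comp a q (mode u c v)) x w)
        = of_nat N powi c * (\<Sum>p\<le>q. \<Sum>i\<le>p. root_coeff N (of_int (e i) / of_nat N) (c - int (p - i)) c
          * l (YW (mode (?Du i) (c - int (p - i)) (?Dv (q - p))) x w))" for x
        unfolding exp_comp_mode[of a, OF a0 N0 exp_a u] conj_part_def e_def
        by (simp add: YW_lin ll sum_distrib_left mult.assoc)
      define X where "X = d - int N * c - weight_exp N (n + m + c) q"
      have "l (YW (exp_comp a q (mode u c v)) (of_int X) w) = of_nat N powi c * (\<Sum>p\<le>q. \<Sum>i\<le>p. T i (p - i) (q - p))"
        unfolding lx
      proof (intro arg_cong2[where f = "(*)"] refl sum.cong)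
        fix p i assume "p \<in> {..q}" "i \<in> {..p}"
        then have X: "X = dd i (q - p) - (c - int (p - i))"
          by (simp add: X_def dd_def e_def f_def weight_exp_def of_nat_diff algebra_simps)
        show "root_coeff N (of_int (e i) / of_nat N) (c - int (p - i)) c
            * l (YW (mode (?Du i) (c - int (p - i)) (?Dv (q - p))) (of_int X) w) = T i (p - i) (q - p)"
          unfolding T_def It_def X[symmetric] ..
      qed
      then show ?thesis unfolding X_def .
    qed
    moreover have "Yb (mode u c v) (of_int h / real N) w = sW (of_nat N powi (- (n + m + c)))
        (\<Sum>q\<le>K. YW (exp_comp a q (mode u c v)) (of_int (h - weight_exp N (n + m + c) q)) w)" for h
      by (rule Yb_grade_int[OF uv]) (rule K)
    ultimately have "l (Yb (mode u c v) (of_int (d - int N * c) / real N) w)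
      = of_nat N powi (- (n + m + c)) * (of_nat N powi c * (\<Sum>q\<le>K. \<Sum>p\<le>q. \<Sum>i\<le>p. T i (p - i) (q - p)))"
      by (simp only: ll sum_distrib_left)
    \<comment> \<open>\<open>N^(-L(0))\<close> gives \<open>N^(-(n+m+c))\<close> on the iterate; the
      factor \<open>N^c\<close> of \<open>conj_part\<close> leaves exactly the factors of
      \<open>u\<close> and \<open>v\<close>.\<close>
    also have "\<dots> = ?k * (\<Sum>q\<le>K. \<Sum>p\<le>q. \<Sum>i\<le>p. T i (p - i) (q - p))"
    proof -
      have nz: "(of_nat N :: complex) \<noteq> 0" using N0 by simp
      have "of_nat N powi (- (n + m + c)) * of_nat N powi c = (of_nat N powi (- (n + m + c) + c) :: complex)"
        using nz by (simp only: power_int_add simp_thms)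
      also have "- (n + m + c) + c = - n + - m" by simp
      also have "(of_nat N powi (- n + - m) :: complex) = ?k" using nz by (simp only: power_int_add simp_thms)
      finally have "of_nat N powi (- (n + m + c)) * of_nat N powi c = ?k" .
      then show ?thesis by (simp only: mult.assoc[symmetric])
    qed
    also have "(\<Sum>q\<le>K. \<Sum>p\<le>q. \<Sum>i\<le>p. T i (p - i) (q - p)) = (\<Sum>i\<le>I. \<Sum>j\<le>J. \<Sum>\<delta>\<le>D. T i \<delta> j)"
      by (rule triple_sum[OF Tz K(2)])
    also have "\<dots> = (\<Sum>i\<le>I. \<Sum>j\<le>J. F i j c)"
    proof (intro sum.cong refl)
      fix i j
      have nth: "fls_nth (Abs_fls (It i j)) s = It i j s" for s
        unfolding It_def by (rule quasi_module_residues(3)[OF N0 l])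
      have "fls_nth (Abs_fls (It i j)) (c - int \<delta>) = 0" if "\<delta> > D" for \<delta>
        unfolding nth It_def by (simp add: Dz[OF that] YW_lin ll)
      \<comment> \<open>Here the analytic and the algebraic side meet: composing the iterate with
        the root series produces the same coefficients as the conjugation formula.\<close>
      then have "F i j c = (\<Sum>\<delta>\<le>D. root_coeff N (of_int (e i) / of_nat N) (c - int \<delta>) c * fls_nth (Abs_fls (It i j)) (c - int \<delta>))"
        unfolding F_def by (rule root_coeff_compose[OF N0])
      then show "(\<Sum>\<delta>\<le>D. T i \<delta> j) = F i j c" by (simp add: T_def nth)
    qed
    finally show ?thesis .
  qed
  show ?thesis unfolding 1 2 3 by (rule main)
qed

lemma Yb_twisted_local:
  assumes l: "functional sW l"
  shows "twisted_local N (\<lambda>h. l (Yb u (of_int h / real N) (Yb v (of_int (d - h) / real N) w)))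
    (\<lambda>h. l (Yb v (of_int (d - h) / real N) (Yb u (of_int h / real N) w)))
    (\<lambda>c. l (Yb (mode u c v) (of_int (d - int N * c) / real N) w))"
proof (induction u rule: homogeneous_induct)
  case (grade n u)
  show ?case
  proof (induction v rule: homogeneous_induct)
    case (grade m v)
    then show ?case by (rule Yb_twisted_local_homogeneous[OF \<open>u \<in> grade V n\<close> _ l])
  next
    case (add v v')
    from twisted_local_add[OF this] show ?case
      by (simp only: linear_mapD(1)[OF Yb_linear_left] linear_mapD(1)[OF Yb_linear_right] mode_add linear_mapD(1)[OF l])
  qed
next
  case (add u u')
  from twisted_local_add[OF this] show ?case
    by (simp only: linear_mapD(1)[OF Yb_linear_left] linear_mapD(1)[OF Yb_linear_right] mode_add_left linear_mapD(1)[OF l])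
qed

end

section \<open>The twisted Jacobi identity\<close>

lemma root_of_unity_power_int: "root_of_unity N powi h = exp (2 * of_real pi * \<i> * of_int h / of_nat N)"
  by (simp add: root_of_unity_def exp_power_int mult.commute mult.left_commute)

lemma root_of_unity_power_int_eq_1:
  assumes "N > 0"
  shows "root_of_unity N powi h = 1 \<longleftrightarrow> int N dvd h"
proof -
  have "2 * of_real pi * \<i> * of_int h / of_nat N = \<i> * of_real (2 * pi * of_int h / of_nat N)"
    by simp
  then have "root_of_unity N powi h = 1 \<longleftrightarrow> (\<exists>n::int. 2 * pi * of_int h / of_nat N = of_int (2 * n) * pi)"
    unfolding root_of_unity_power_int exp_eq_1 by simp
  also have "\<dots> \<longleftrightarrow> (\<exists>n::int. (of_int h :: real) = of_int (n * int N))"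
    using assms by (simp add: field_simps)
  also have "\<dots> \<longleftrightarrow> int N dvd h"
    by (simp only: of_int_eq_iff dvd_def mult.commute)
  finally show ?thesis .
qed

lemma root_of_unity_nonzero: "root_of_unity N \<noteq> 0"
  by (simp add: root_of_unity_def)

lemma root_of_unity_power: "N > 0 \<Longrightarrow> root_of_unity N ^ N = 1"
  using root_of_unity_power_int_eq_1[of N "int N"] by simp

lemma sum_root_of_unity:
  assumes N: "N > 0"
  shows "(\<Sum>r<N. (root_of_unity N ^ r) powi h) = (if int N dvd h then of_nat N else 0)"
proof -
  define z where "z = root_of_unity N powi h"
  have p: "(root_of_unity N ^ r) powi h = z ^ r" for r
    by (simp add: z_def power_int_power' power_int_mult[symmetric] mult.commute flip: power_int_of_nat)
  have zN: "z ^ N = 1" unfolding p[of N, symmetric] root_of_unity_power[OF N] by simp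
  show ?thesis
  proof (cases "z = 1")
    case True
    then show ?thesis using root_of_unity_power_int_eq_1[OF N, of h] by (simp add: p z_def)
  next
    case False
    then have "(\<Sum>r<N. z ^ r) = 0" using zN by (simp add: geometric_sum)
    then show ?thesis using False root_of_unity_power_int_eq_1[OF N, of h] by (simp add: p z_def)
  qed
qed

text \<open>Replacing \<open>y\<close> by \<open>z y\<close> leaves \<open>y^N - 1\<close>
  unchanged, so all branches share the same locality factor.\<close>

lemma poly_act_twist:
  assumes z: "z ^ N = 1" "z \<noteq> 0"
  shows "diff_act N k (\<lambda>h. z powi h * f h) = (\<lambda>h. z powi h * diff_act N k f h)"
proof
  fix h
  have e: "z powi (h - int (N * j)) = z powi h" for j
    using z by (simp add: power_int_diff power_mult del: of_nat_mult)
  show "diff_act N k (\<lambda>h. z powi h * f h) h = z powi h * diff_act N k f h"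
    unfolding poly_act_diff_poly_power e sum_distrib_left by (intro sum.cong refl) (simp only: mult_ac)
qed

text \<open>The factor \<open>(y^N - 1)^k\<close> merges \<open>A\<close> and \<open>B\<close> into
  a finite \<open>C\<close>. The left side becomes the difference of the expansions of
  \<open>(y^N - 1)^(m-k) C\<close>, which sees only exponents congruent to \<open>p\<close> modulo
  \<open>N\<close>. On the right each branch involves all exponents of \<open>C\<close>, and
  averaging over the roots of unity selects the same residue class.\<close>

lemma scalar_twisted_jacobi:
  assumes N: "N > 0" and A: "bounded_above A" and B: "bounded_below B"
    and loc: "\<And>r. r < N \<Longrightarrow> twisted_local N (\<lambda>h. (root_of_unity N ^ r) powi h * A h)
      (\<lambda>h. (root_of_unity N ^ r) powi h * B h) (I r)"
  shows "expand_inf N m A p - expand_zero N m B p = 1 / of_nat N * (\<Sum>r<N. Sum_any (\<lambda>i.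
    (root_of_unity N ^ r) powi (- int N - p) * ((of_int (- int N - p) / of_nat N) gchoose i) * I r (- 1 - m - int i)))"
proof -
  let ?\<omega> = "root_of_unity N"
  let ?n = "- int N - p"
  let ?c = "\<lambda>r i. (?\<omega> ^ r) powi ?n * ((of_int ?n / of_nat N) gchoose i)"
  let ?e = "\<lambda>h K. (of_int h / of_nat N :: complex) gchoose K"
  have \<omega>: "(?\<omega> ^ r) ^ N = 1" "?\<omega> ^ r \<noteq> 0" for r
    using root_of_unity_power[OF N] root_of_unity_nonzero by (simp_all add: power_mult[symmetric] mult.commute[of r]) (simp add: power_mult)
  have "\<forall>r<N. \<exists>k1. \<forall>k\<ge>k1. diff_act N k (\<lambda>h. (?\<omega> ^ r) powi h * A h) = diff_act N k (\<lambda>h. (?\<omega> ^ r) powi h * B h) \<and>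
        I r = root_taylor N k (diff_act N k (\<lambda>h. (?\<omega> ^ r) powi h * A h))"
    using loc unfolding twisted_local_def by blast
  then obtain k1 where k1: "\<And>r k. r < N \<Longrightarrow> k \<ge> k1 r \<Longrightarrow>
      diff_act N k (\<lambda>h. (?\<omega> ^ r) powi h * A h) = diff_act N k (\<lambda>h. (?\<omega> ^ r) powi h * B h) \<and>
        I r = root_taylor N k (diff_act N k (\<lambda>h. (?\<omega> ^ r) powi h * A h))"
    by metis
  \<comment> \<open>The sum serves as a common upper bound of the \<open>k1 r\<close>.\<close>
  define k where "k = (\<Sum>r<N. k1 r)"
  have k: "k \<ge> k1 r" if "r < N" for r
    unfolding k_def by (rule member_le_sum) (use that in auto)
  define C where "C = diff_act N k A"
  have CB: "C = diff_act N k B"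
    using k1[OF N k[OF N]] by (simp add: C_def)
  have I: "I r = root_taylor N k (\<lambda>h. (?\<omega> ^ r) powi h * C h)" if "r < N" for r
    using k1[OF that k[OF that]] unfolding poly_act_twist[OF \<omega>] C_def by blast
  have Ca: "bounded_above C" using A by (simp add: C_def poly_act_bounded_above)
  have Cl: "bounded_below C" using B by (simp add: CB poly_act_bounded_below)
  have fin: "finite {h. C h \<noteq> 0}" by (rule bounded_finite[OF Ca Cl])
  have L: "expand_inf N m A p - expand_zero N m B p = expand_inf N (m - int k) C p - expand_zero N (m - int k) C p"
    using expand_power(1)[OF N A, of "m - int k" k] expand_power(2)[OF N B, of "m - int k" k]
    by (simp add: C_def[symmetric] CB[symmetric])
  show ?thesis
  proof (cases "m - int k \<ge> 0")
    case True
    then obtain j where j: "m - int k = int j" by (metis nonneg_int_cases)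
    \<comment> \<open>No negative power of \<open>y^N - 1\<close> is left: the two expansions agree,
      and the iterates have poles of order at most \<open>k\<close>.\<close>
    have "I r (- 1 - m - int i) = 0" if "r < N" for r i
      unfolding I[OF that] root_taylor_def using True by simp
    then have "(\<Sum>r<N. Sum_any (\<lambda>i. ?c r i * I r (- 1 - m - int i))) = 0"
      by (intro sum.neutral) simp
    then show ?thesis unfolding L j by (simp add: expand_nonneg[OF N] Ca Cl)
  next
    case False
    define K where "K = nat (int k - 1 - m)"
    have K: "m - int k = - 1 - int K" using False by (simp add: K_def)
    let ?S = "{h. C h \<noteq> 0}"
    have Ir: "I r (- 1 - m - int i) = (if i \<le> K then (\<Sum>h\<in>?S. (?\<omega> ^ r) powi h * C h * ?e h (K - i)) else 0)"
      if "r < N" for r i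
    proof -
      have e: "- 1 - m - int i + int k = int K - int i" using K by simp
      have "Sum_any (\<lambda>h. (?\<omega> ^ r) powi h * C h * x h) = (\<Sum>h\<in>?S. (?\<omega> ^ r) powi h * C h * x h)" for x
        by (rule Sum_any.expand_superset[OF fin]) auto
      then show ?thesis unfolding I[OF that] root_taylor_def e by (simp add: nat_diff_distrib)
    qed
    have inner: "Sum_any (\<lambda>i. ?c r i * I r (- 1 - m - int i))
      = (\<Sum>h\<in>?S. (?\<omega> ^ r) powi (?n + h) * (C h * ?e (?n + h) K))" if r: "r < N" for r
    proof -
      have "Sum_any (\<lambda>i. ?c r i * I r (- 1 - m - int i))
        = (\<Sum>i\<le>K. ?c r i * I r (- 1 - m - int i))"
        by (rule Sum_any_atMost) (simp add: Ir[OF r])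
      also have "\<dots> = (\<Sum>i\<le>K. \<Sum>h\<in>?S. ?c r i * ((?\<omega> ^ r) powi h * C h * ?e h (K - i)))"
        by (intro sum.cong refl) (simp add: Ir[OF r] sum_distrib_left)
      also have "\<dots> = (\<Sum>h\<in>?S. \<Sum>i\<le>K. ?c r i * ((?\<omega> ^ r) powi h * C h * ?e h (K - i)))"
        by (rule sum.swap)
      also have "\<dots> = (\<Sum>h\<in>?S. (?\<omega> ^ r) powi (?n + h) * (C h * ?e (?n + h) K))"
      proof (intro sum.cong refl)
        fix h
        have "(of_int (?n + h) / of_nat N :: complex) = of_int ?n / of_nat N + of_int h / of_nat N"
          by (simp only: of_int_add add_divide_distrib)
        \<comment> \<open>Vandermonde's identity multiplies \<open>(1 + t)^((-N-p)/N)\<close> from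
          the delta function with \<open>(1 + t)^(h/N)\<close> from \<open>y^h\<close>.\<close>
        then have V: "(of_int (?n + h) / of_nat N) gchoose K
          = (\<Sum>i\<le>K. ((of_int ?n / of_nat N) gchoose i) * ((of_int h / of_nat N :: complex) gchoose (K - i)))"
          by (simp only: gbinomial_Vandermonde[symmetric] atLeast0AtMost)
        have P: "(?\<omega> ^ r) powi (?n + h) = (?\<omega> ^ r) powi ?n * (?\<omega> ^ r) powi h"
          using \<omega>(2)[of r] by (simp only: power_int_add simp_thms)
        show "(\<Sum>i\<le>K. ?c r i * ((?\<omega> ^ r) powi h * C h * ?e h (K - i)))
          = (?\<omega> ^ r) powi (?n + h) * (C h * ?e (?n + h) K)"
          unfolding V P sum_distrib_left by (intro sum.cong refl) (simp only: mult_ac)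
      qed
      finally show ?thesis .
    qed
    have "1 / of_nat N * (\<Sum>r<N. Sum_any (\<lambda>i. ?c r i * I r (- 1 - m - int i)))
      = 1 / of_nat N * (\<Sum>r<N. \<Sum>h\<in>?S. (?\<omega> ^ r) powi (?n + h) * (C h * ?e (?n + h) K))"
      by (intro arg_cong2[where f = "(*)"] refl sum.cong inner) simp
    also have "(\<Sum>r<N. \<Sum>h\<in>?S. (?\<omega> ^ r) powi (?n + h) * (C h * ?e (?n + h) K))
      = (\<Sum>h\<in>?S. \<Sum>r<N. (?\<omega> ^ r) powi (?n + h) * (C h * ?e (?n + h) K))"
      by (rule sum.swap)
    \<comment> \<open>The sum over \<open>r\<close> vanishes unless \<open>N\<close> divides
      \<open>h - p\<close>; its value \<open>N\<close> otherwise cancels \<open>1/N\<close>.\<close>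
    also have "\<dots> = (\<Sum>h\<in>?S. (if int N dvd ?n + h then of_nat N else 0) * (C h * ?e (?n + h) K))"
      by (simp only: sum_distrib_right[symmetric] sum_root_of_unity[OF N])
    also have "1 / of_nat N * \<dots> = (\<Sum>h\<in>?S. if int N dvd ?n + h then C h * ?e (?n + h) K else 0)"
      unfolding sum_distrib_left by (intro sum.cong refl) (use N in simp)
    also have "\<dots> = Sum_any (\<lambda>h. if int N dvd ?n + h then C h * ?e (?n + h) K else 0)"
      by (rule Sum_any.expand_superset[OF fin, symmetric]) auto
    also have "\<dots> = Sum_any (\<lambda>h. (of_int h gchoose K) * C (p + int N + int N * h))"
    proof (subst Sum_any_reindex[of "\<lambda>h. p + int N + int N * h"])
      show "inj (\<lambda>h. p + int N + int N * h)" using N by (auto intro: injI)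
      fix d assume d: "d \<notin> range (\<lambda>h. p + int N + int N * h)"
      have "\<not> int N dvd ?n + d"
      proof
        assume "int N dvd ?n + d"
        then obtain x where "?n + d = int N * x" by blast
        then have "d = p + int N + int N * x" by linarith
        then show False using d by blast
      qed
      then show "(if int N dvd ?n + d then C d * ((of_int (?n + d) / of_nat N) gchoose K) else 0) = 0" by simp
    next
      show "Sum_any (\<lambda>x. if int N dvd ?n + (p + int N + int N * x) then C (p + int N + int N * x)
          * ((of_int (?n + (p + int N + int N * x)) / of_nat N) gchoose K) else 0)
        = Sum_any (\<lambda>h. (of_int h gchoose K) * C (p + int N + int N * h))"
      proof (rule Sum_any.cong)
        fix x
        have e: "?n + (p + int N + int N * x) = int N * x" by simp
        have e': "(of_int (int N * x) / of_nat N :: complex) = of_int x" using N by simp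
        show "(if int N dvd ?n + (p + int N + int N * x) then C (p + int N + int N * x)
          * ((of_int (?n + (p + int N + int N * x)) / of_nat N) gchoose K) else 0) = (of_int x gchoose K) * C (p + int N + int N * x)"
          unfolding e e' by simp
      qed
    qed
    also have "\<dots> = expand_inf N (m - int k) C p - expand_zero N (m - int k) C p"
      unfolding K by (rule expand_difference[OF N Ca Cl, symmetric])
    finally show ?thesis unfolding L ..
  qed
qed

section \<open>Automorphisms and equivariance\<close>

context vertex_operator_algebra
begin

text \<open>An automorphism fixes the conformal vector, hence commutes with all Virasoro modes and
  with everything built from them.\<close>

lemma aut_Vir: "g \<in> carrier (aut_group V) \<Longrightarrow> g (Vir V k u) = Vir V k (g u)"
  by (simp add: aut_group_def Vir_def)

lemma aut_linear: "g \<in> carrier (aut_group V) \<Longrightarrow> Vector_Spaces.linear sV sV g"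
  by (simp add: aut_group_def)

lemma aut_grade: "g \<in> carrier (aut_group V) \<Longrightarrow> u \<in> grade V n \<Longrightarrow> g u \<in> grade V n"
  unfolding grade_iff by (simp add: aut_Vir[symmetric] linear_mapD(2)[OF aut_linear])

lemma aut_exp_comp:
  assumes g: "g \<in> carrier (aut_group V)"
  shows "g (exp_comp a j u) = exp_comp a j (g u)"
proof -
  note lg = linear_mapD[OF aut_linear[OF g]]
  have "g (exp_part a k j u) = exp_part a k j (g u)" for k j
  proof (induction k arbitrary: j)
    case (Suc k)
    show ?case by (simp add: lg aut_Vir[OF g] Suc)
  qed (simp add: lg)
  then show ?thesis by (simp add: exp_comp_def lg)
qed

end

context Delta_twist
begin

text \<open>On the component of weight \<open>n - j\<close>, equivariance at the exponent
  \<open>p - weight_exp N n j\<close> of \<open>z\<close> gives the root of unity to the power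
  \<open>p + N n\<close>: the dependence on \<open>j\<close> cancels, and the \<open>N n\<close>
  part contributes 1.\<close>

lemma Yb_automorphism:
  assumes g: "g \<in> carrier (aut_group V)" "g \<in> carrier G" and \<phi>: "\<phi> g = root_of_unity N"
  shows "Yb (g u) (of_int p / real N) w = sW (root_of_unity N powi p) (Yb u (of_int p / real N) w)"
proof (induction u rule: homogeneous_induct)
  case (grade n u)
  let ?\<omega> = "root_of_unity N"
  obtain J where J: "\<And>j. j > J \<Longrightarrow> exp_comp a j u = 0" using exp_comp_eventually_zero[OF grade] by blast
  have J': "exp_comp a j (g u) = 0" if "j > J" for j
    using J[OF that] by (simp add: aut_exp_comp[OF g(1), symmetric] linear_mapD(3)[OF aut_linear[OF g(1)]])
  have gu: "g u \<in> grade V n" by (rule aut_grade[OF g(1) grade])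
  have nz: "?\<omega> \<noteq> 0" by (rule root_of_unity_nonzero)
  have "YW (exp_comp a j (g u)) (of_int (p - weight_exp N n j)) w
    = sW (?\<omega> powi p) (YW (exp_comp a j u) (of_int (p - weight_exp N n j)) w)" for j
  proof -
    let ?x = "exp_comp a j u" and ?M = "p - weight_exp N n j"
    have x: "?x \<in> grade V (n - int j)" by (rule exp_comp_grade[OF grade])
    have "sW (?\<omega> powi (- (n - int j))) (YW (g ?x) (of_int ?M) w) = sW (?\<omega> powi ?M) (YW ?x (of_int ?M) w)"
      using equivariance[OF g(2), of ?x ?M w] by (simp only: \<phi> weight_op_grade[OF aut_grade[OF g(1) x]] YW_lin)
    then have "sW (?\<omega> powi (n - int j)) (sW (?\<omega> powi (- (n - int j))) (YW (g ?x) (of_int ?M) w))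
      = sW (?\<omega> powi (n - int j)) (sW (?\<omega> powi ?M) (YW ?x (of_int ?M) w))" by simp
    moreover have "?\<omega> powi y * ?\<omega> powi (- y) = 1" for y
      using nz by (simp add: power_int_minus)
    moreover have "?\<omega> powi (n - int j) * ?\<omega> powi ?M = ?\<omega> powi p"
    proof -
      have "?\<omega> powi (int N * n) = 1" using root_of_unity_power_int_eq_1[OF N0] by simp
      moreover have "n - int j + ?M = p + int N * n" by (simp add: weight_exp_def algebra_simps)
      ultimately show ?thesis using nz by (metis power_int_add mult.right_neutral)
    qed
    ultimately show ?thesis by (simp only: W.scale_scale W.scale_one aut_exp_comp[OF g(1)])
  qed
  moreover have "Yb (g u) (of_int p / real N) w = sW (of_nat N powi (- n)) (\<Sum>j\<le>J. YW (exp_comp a j (g u)) (of_int (p - weight_exp N n j)) w)"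
    by (rule Yb_grade_int[OF gu]) (rule J')
  moreover have "Yb u (of_int p / real N) w = sW (of_nat N powi (- n)) (\<Sum>j\<le>J. YW (exp_comp a j u) (of_int (p - weight_exp N n j)) w)"
    by (rule Yb_grade_int[OF grade]) (rule J)
  ultimately show ?case by (simp only: W.scale_sum_right W.scale_scale mult.commute)
next
  case (add u v)
  then show ?case
    by (simp only: linear_mapD(1)[OF aut_linear[OF g(1)]] linear_mapD(1)[OF Yb_linear_left] W.scale_right_distrib)
qed

lemma Yb_automorphism_power:
  assumes g: "g \<in> carrier (aut_group V)" "g \<in> carrier G" and \<phi>: "\<phi> g = root_of_unity N"
  shows "Yb ((g ^^ r) u) (of_int p / real N) w = sW ((root_of_unity N ^ r) powi p) (Yb u (of_int p / real N) w)"
proof (induction r)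
  case (Suc r)
  then show ?case
    by (simp add: Yb_automorphism[OF g \<phi>] power_int_mult_distrib)
qed simp

text \<open>Off the lattice of exponents that the fields can produce, all three kinds of series
  vanish. On it the claim is the scalar identity, in which the action of \<open>g^r\<close> supplies
  the branch of the root.\<close>

lemma Yb_twisted_jacobi:
  assumes g: "g \<in> carrier (aut_group V)" "g \<in> carrier G" and \<phi>: "\<phi> g = root_of_unity N"
  shows "series_mult sW (delta_series 1 1 X0 X1 (- 1) X2) (prod12 Yb u v w) e
       - series_mult sW (delta_series 1 (- 1) X0 X2 (- 1) X1) (prod21 Yb u v w) e
       = sW (1 / of_nat N) (\<Sum>r<N.
           series_mult sW (delta_series N (root_of_unity N ^ r) X1 X2 1 X0)
             (iterate V Yb ((g ^^ r) u) v w) e)"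
proof -
  interpret scaled sW by unfold_locales simp_all
  note YL = linear_mapD[OF Yb_linear_left] and YR = linear_mapD[OF Yb_linear_right]
  obtain x y z where e: "e = (x, y, z)" by (cases e)
  have int: "real N * r \<in> \<int>" if "Yb u (r + of_int k) w \<noteq> 0" for u r k w
  proof -
    have "real N * (r + of_int k) \<in> \<int>" using that vertex_mapD(3)[OF Yb_vertex_map N0] by blast
    moreover have "real N * (r + of_int k) = real N * r + of_int (int N * k)" by (simp add: algebra_simps)
    ultimately show ?thesis by (metis Ints_of_int Ints_diff add_diff_cancel_right')
  qed
  show ?thesis
  proof (cases "x \<in> \<int> \<and> real N * y \<in> \<int> \<and> real N * z \<in> \<int>")
    case True
    then obtain x' p q where x': "x = of_int x'" "real N * y = of_int p" "real N * z = of_int q"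
      by (auto elim!: Ints_cases)
    define m where "m = - 1 - x'"
    have x: "x = - 1 - of_int m" by (simp add: m_def x')
    have y: "y = of_int p / real N" and z: "z = of_int q / real N"
      using x'(2,3) N0 by (simp_all add: field_simps)
    \<comment> \<open>The total degree in \<open>z\<close> of the products entering this
      coefficient, after \<open>(x1 - x2)^m\<close>, of degree \<open>N m\<close> in
      \<open>z\<close>, is taken out.\<close>
    define d where "d = p + q - int N * m"
    obtain bv bu where bv: "\<And>r::int. r < bv \<Longrightarrow> Yb v (of_int r / real N) w = 0"
      and bu: "\<And>r::int. r < bu \<Longrightarrow> Yb u (of_int r / real N) w = 0"
      using vertex_mapD(4)[OF Yb_vertex_map N0, of v w] vertex_mapD(4)[OF Yb_vertex_map N0, of u w] by auto
    have Nge: "int N * int i \<ge> int i" for i using N0 by (simp add: mult_le_cancel_right1)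
    let ?LHS = "series_mult sW (delta_series 1 1 X0 X1 (- 1) X2) (prod12 Yb u v w) e
       - series_mult sW (delta_series 1 (- 1) X0 X2 (- 1) X1) (prod21 Yb u v w) e"
    let ?RHS = "sW (1 / of_nat N) (\<Sum>r<N.
           series_mult sW (delta_series N (root_of_unity N ^ r) X1 X2 1 X0)
             (iterate V Yb ((g ^^ r) u) v w) e)"
    let ?F1 = "\<lambda>i::nat. sW ((of_int m gchoose i) * (- 1) ^ i)
      (Yb u (of_int (p - int N * (m - int i)) / real N) (Yb v (of_int (q - int N * int i) / real N) w))"
    let ?F2 = "\<lambda>i::nat. sW ((- 1) powi m * ((of_int m gchoose i) * (- 1) ^ i))
      (Yb v (of_int (q - int N * m + int N * int i) / real N) (Yb u (of_int (p - int N * int i) / real N) w))"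
    let ?F3 = "\<lambda>r (i::nat). sW ((root_of_unity N ^ r) powi (- int N - p) * ((of_int (- int N - p) / of_nat N) gchoose i))
      (Yb (mode ((g ^^ r) u) (- 1 - m - int i) v) (of_int (d - int N * (- 1 - m - int i)) / real N) w)"
    have 1: "series_mult sW (delta_series 1 1 X0 X1 (- 1) X2) (prod12 Yb u v w) e = Sum_any ?F1"
    proof -
      have "of_int p / real N - of_int m + real i = of_int (p - int N * (m - int i)) / real N"
        "of_int q / real N - real i = of_int (q - int N * int i) / real N" for i
        using N0 by (simp_all add: field_simps)
      then show ?thesis unfolding e x y z
        by (subst delta_012) (simp_all add: prod12_def)
    qed
    have 2: "series_mult sW (delta_series 1 (- 1) X0 X2 (- 1) X1) (prod21 Yb u v w) e = Sum_any ?F2"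
    proof -
      have "of_int q / real N - of_int m + real i = of_int (q - int N * m + int N * int i) / real N"
        "of_int p / real N - real i = of_int (p - int N * int i) / real N" for i
        using N0 by (simp_all add: field_simps)
      then show ?thesis unfolding e x y z
        by (subst delta_021) (simp_all add: prod21_def)
    qed
    have 3: "series_mult sW (delta_series N (root_of_unity N ^ r) X1 X2 1 X0) (iterate V Yb ((g ^^ r) u) v w) e = Sum_any (?F3 r)" for r
    proof -
      have s: "of_int q / real N - of_int (- int N - p) / real N + real i = of_int (d - int N * (- 1 - m - int i)) / real N"
        "- 1 - of_int m - real i = of_int (- 1 - m - int i)" for i
        using N0 by (simp_all add: d_def field_simps)
      have c: "complex_of_real (of_int (- int N - p) / real N) = of_int (- int N - p) / of_nat N" by simp
      show ?thesis unfolding e x y z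
        by (subst delta_120[OF _ N0]) (simp_all only: iterate_def s c mode_def prod.case simp_thms if_True if_False refl)
    qed
    have f1: "finite {i. ?F1 i \<noteq> 0}"
    proof (rule finite_support_atMost)
      fix i assume "i > nat (q - bv)"
      then have "q - int N * int i < bv" using Nge[of i] by linarith
      then show "?F1 i = 0" by (simp only: bv YR W.scale_zero_right)
    qed
    have f2: "finite {i. ?F2 i \<noteq> 0}"
    proof (rule finite_support_atMost)
      fix i assume "i > nat (p - bu)"
      then have "p - int N * int i < bu" using Nge[of i] by linarith
      then show "?F2 i = 0" by (simp only: bu YR W.scale_zero_right)
    qed
    have f3: "finite {i. ?F3 r i \<noteq> 0}" for r
    proof -
      obtain bm where bm: "\<And>s. s < bm \<Longrightarrow> mode ((g ^^ r) u) s v = 0" using mode_truncation by blast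
      show ?thesis
      proof (rule finite_support_atMost)
        fix i assume "i > nat (- 1 - m - bm)"
        then have "- 1 - m - int i < bm" by linarith
        then show "?F3 r i = 0" by (simp only: bm YL W.scale_zero_right)
      qed
    qed
    have "l (?LHS - ?RHS) = 0" if l: "functional sW l" for l
    proof -
      note ll = linear_mapD[OF l]
      define A where "A h = l (Yb u (of_int h / real N) (Yb v (of_int (d - h) / real N) w))" for h
      define B where "B h = l (Yb v (of_int (d - h) / real N) (Yb u (of_int h / real N) w))" for h
      define I where "I r c = l (Yb (mode ((g ^^ r) u) c v) (of_int (d - int N * c) / real N) w)" for r c
      \<comment> \<open>The operators of \<open>g^r u\<close> are multiples of those of
        \<open>u\<close>, so the pair \<open>g^r u\<close>, \<open>v\<close> has the same
        \<open>A\<close> and \<open>B\<close> up to a root of unity, while its iterate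
        \<open>I r\<close> is a different one.\<close>
      have loc: "twisted_local N (\<lambda>h. (root_of_unity N ^ r) powi h * A h) (\<lambda>h. (root_of_unity N ^ r) powi h * B h) (I r)" for r
        using Yb_twisted_local[OF l, of "(g ^^ r) u" v d w]
        unfolding A_def B_def I_def by (simp only: Yb_automorphism_power[OF g \<phi>] YR ll)
      have AB: "bounded_above A" "bounded_below B"
        using loc[of 0] by (simp_all add: twisted_local_def)
      have l1: "l (Sum_any ?F1) = expand_inf N m A p"
      proof -
        have "d - (p - int N * (m - int i)) = q - int N * int i" for i by (simp add: d_def algebra_simps)
        then show ?thesis unfolding linear_Sum_any[OF l f1] expand_inf_def A_def by (simp only: ll)
      qed
      have l2: "l (Sum_any ?F2) = expand_zero N m B p"
      proof -
        have "d - (p - int N * int i) = q - int N * m + int N * int i" for i by (simp add: d_def)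
        then show ?thesis unfolding linear_Sum_any[OF l f2] expand_zero_def B_def by (simp only: ll)
      qed
      have l3: "l (Sum_any (?F3 r)) = Sum_any (\<lambda>i. (root_of_unity N ^ r) powi (- int N - p)
          * ((of_int (- int N - p) / of_nat N) gchoose i) * I r (- 1 - m - int i))" for r
        unfolding linear_Sum_any[OF l f3] I_def by (simp only: ll)
      show ?thesis
        unfolding 1 2 3 ll l1 l2 l3 scalar_twisted_jacobi[OF N0 AB loc] by simp
    qed
    then have "?LHS - ?RHS = 0" using separating_functional[OF W.vector_space_axioms] by blast
    then show ?thesis by simp
  next
    \<comment> \<open>A nonzero coefficient would put \<open>x\<close>, \<open>N y\<close> and
      \<open>N z\<close> into the integers: the delta functions shift exponents by integers or by
      multiples of \<open>1/N\<close>, and the fields live on these lattices.\<close>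
    case False
    have int0: "x \<in> \<int>" if "x + of_int k = 0" for k
      using that by (metis Ints_of_int Ints_minus add_eq_0_iff2)
    have x12: "e - delta_exp 1 X0 X1 X2 n i = (x + of_int (1 + n), y + of_int (int i - n), z + of_int (- int i))"
      "e - delta_exp 1 X0 X2 X1 n i = (x + of_int (1 + n), y + of_int (- int i), z + of_int (int i - n))" for n i
      by (simp_all add: e delta_exp_def)
    have zero12: "series_mult sW (delta_series 1 1 X0 X1 (- 1) X2) (prod12 Yb u v w) e = 0"
    proof (rule series_mult_delta_zero[of sW, OF s0 s0'], unfold x12 prod12_def prod.case)
      fix n i
      show "(if x + of_int (1 + n) = 0 then Yb u (y + of_int (int i - n)) (Yb v (z + of_int (- int i)) w) else 0) = 0"
        using False int0 int YR(3) by (metis (no_types))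
    qed
    have zero21: "series_mult sW (delta_series 1 (- 1) X0 X2 (- 1) X1) (prod21 Yb u v w) e = 0"
    proof (rule series_mult_delta_zero[of sW, OF s0 s0'], unfold x12 prod21_def prod.case)
      fix n i
      show "(if x + of_int (1 + n) = 0 then Yb v (z + of_int (int i - n)) (Yb u (y + of_int (- int i)) w) else 0) = 0"
        using False int0 int YR(3) by (metis (no_types))
    qed
    have zeroit: "series_mult sW (delta_series N \<zeta> X1 X2 1 X0) (iterate V Yb u' v w) e = 0" for \<zeta> u'
    proof (rule series_mult_delta_zero[of sW, OF s0 s0'])
      fix n i
      have c: "e - delta_exp N X1 X2 X0 n i
        = (x - real i, y + 1 + of_int n / real N, (z - of_int n / real N) + of_int (int i))"
        by (simp add: e delta_exp_def)
      have "Yb (vop V u' (x - real i) v) ((z - of_int n / real N) + of_int (int i)) w = 0"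
        if "y + 1 + of_int n / real N = 0"
      proof (rule ccontr)
        assume nz: "Yb (vop V u' (x - real i) v) ((z - of_int n / real N) + of_int (int i)) w \<noteq> 0"
        then have "x - real i \<in> \<int>" using vop_nonint YL(3) by metis
        then have "x \<in> \<int>" by (metis Ints_add Ints_of_nat diff_add_cancel)
        moreover have "real N * y = of_int (- int N - n)" using that N0 by (simp add: field_simps) algebra
        moreover have "real N * z = real N * (z - of_int n / real N) + of_int n" using N0 by (simp add: field_simps)
        ultimately show False using False int[OF nz] by (metis Ints_add Ints_of_int)
      qed
      then show "iterate V Yb u' v w (e - delta_exp N X1 X2 X0 n i) = 0"
        unfolding c iterate_def prod.case by (simp only: if_False split: if_split) simp
    qed
    show ?thesis by (simp only: zero12 zero21 zeroit diff_self sum.neutral_const W.scale_zero_right)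
  qed
qed

end

theorem theorem2p9:
  fixes V :: "'v::ab_group_add voa"
    and \<sigma> :: "'v \<Rightarrow> 'v"
    and N :: nat
    and G :: "('v \<Rightarrow> 'v) monoid"
    and \<phi> :: "('v \<Rightarrow> 'v) \<Rightarrow> complex"
    and sW :: "complex \<Rightarrow> 'w::ab_group_add \<Rightarrow> 'w"
    and YW :: "'v \<Rightarrow> real \<Rightarrow> 'w \<Rightarrow> 'w"
    and a :: "nat \<Rightarrow> complex"
  assumes "vertex_operator_algebra V"
    and "\<sigma> \<in> carrier (aut_group V)" and "N > 0" and "group.ord (aut_group V) \<sigma> = N"
    and "G = subgroup_generated (aut_group V) {\<sigma>}"
    and "\<phi> \<in> mon G complex_units" and "\<And>j. j < N \<Longrightarrow> \<phi> (\<sigma> ^^ j) = root_of_unity N ^ j"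
    and "G_phi_quasi_module V N G \<phi> sW YW"
    and "exp_vector_field a fps_X =
           fps_const (1 / of_nat N) * (1 + fps_X) ^ N - fps_const (1 / of_nat N)"
  shows "weak_twisted_module V N \<sigma> sW (twisted_map V N a YW)"
proof -
  \<comment> \<open>The hypothesis determines \<open>a n\<close> only for \<open>n >= 1\<close>; the
    reset value supplies the normalisation of \<open>Delta_twist\<close> and changes neither the
    exponential of the vector field nor Delta.\<close>
  let ?a = "a(0 := 0)"
  interpret G_phi_quasi_module V N G \<phi> sW YW by fact
  interpret aut: group "aut_group V" by (rule group_aut_group[OF vector_space_axioms])
  have "(\<lambda>m. if m \<ge> 2 then ?a (m - 1) else 0) = (\<lambda>m. if m \<ge> 2 then a (m - 1) else 0)" by auto
  then have "vector_field ?a = vector_field a" unfolding vector_field_def[abs_def] by (simp only:)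
  then have "exp_vector_field ?a = exp_vector_field a" unfolding exp_vector_field_def[abs_def] by (simp only:)
  then interpret Delta_twist V N G \<phi> sW YW ?a
    by unfold_locales (use assms(3,9) in auto)
  have "vir_sum V N ?a = vir_sum V N a" by (auto simp: vir_sum_def fun_eq_iff intro!: Sum_any.cong)
  then have map: "twisted_map V N ?a YW = twisted_map V N a YW"
    unfolding twisted_map_def[abs_def] Delta_def exp_vir_sum_def by (simp only:)
  have \<sigma>G: "\<sigma> \<in> carrier G"
    unfolding assms(5) carrier_subgroup_generated using assms(2) by (auto intro: generate.incl)
  have \<phi>: "\<phi> \<sigma> = root_of_unity N"
  \<comment> \<open>For \<open>N = 1\<close> the values of \<open>\<phi>\<close> are prescribed only
    at \<open>j = 0\<close>, so \<open>\<sigma> = id\<close> is first derived from the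
    order.\<close>
  proof (cases "N = 1")
    case True
    then have "\<sigma> = id"
      using aut.pow_ord_eq_1[OF assms(2)] assms(2,4) by (simp add: aut_group_def)
    then show ?thesis using assms(7)[of 0] True root_of_unity_power[of 1] by simp
  next
    case False
    then show ?thesis using assms(7)[of 1] assms(3) by simp
  qed
  show ?thesis
    unfolding map[symmetric]
  proof unfold_locales
    show "vertex_map V sW N (twisted_map V N ?a YW)" by (rule Yb_vertex_map)
    show "twisted_map V N ?a YW (vac V) r w = (if r = 0 then w else 0)" for r w by (rule Yb_vacuum)
  qed (fact assms Yb_twisted_jacobi[OF assms(2) \<sigma>G \<phi>])+
qed

end
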